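(* Let $V$ be a Banach space with norm $\|\cdot\|_V$, $K\subset V$ a compact convex subset, and $(X,\mathbb{Z}^k,T)$ a dynamical system with the marker property. Then for a dense $G_\delta$ subset of $f\in C(X,K)$, \[\mathrm{mdim}_M(I_f(X),D)\le\mathrm{mdim}(X).\]
   Context: $C(X,K)$ has the metric $\|f-g\|=\sup_x\|f(x)-g(x)\|_V$. $I_f(x)=(f(T^nx))_{n\in\mathbb{Z}^k}\in K^{\mathbb{Z}^k}$; $I_f(X)$ is a closed subsystem of the shift $\sigma^n((x_m)_m)=(x_{m+n})_m$ on $K^{\mathbb{Z}^k}$, with metric $D(x,y)=\sum_{n\in\mathbb{Z}^k}2^{-|n|}\|x_n-y_n\|_V$ ($|\cdot|$ Euclidean). For a system $(Y,\mathbb{Z}^k)$ with metric $\rho$: $\rho_\Omega(x,y)=\sup_{n\in\Omega}\rho(T^nx,T^ny)$, $[N]=\{0,\dots,N-1\}^k$, $A(Y,\varepsilon,\rho)$ is the minimal cardinality of an open cover by sets of $\rho$-diameter $<\varepsilon$, $S(Y,\varepsilon,\rho)=\lim_{N}N^{-k}\log A(Y,\varepsilon,\rho_{[N]})$, $\mathrm{mdim}_M(Y,\rho)=\liminf_{\varepsilon\to0}S(Y,\varepsilon,\rho)/|\log\varepsilon|$. Mean dimension: $\mathrm{widim}_\varepsilon(X,d)$ is the minimal dimension of a finite simplicial complex admitting a continuous map with fibers of $d$-diameter $<\varepsilon$, $\mathrm{mdim}(X)=\lim_{\varepsilon\to0}\lim_NN^{-k}\mathrm{widim}_\varepsilon(X,d_{[N]})$.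 Marker property: for every finite $F\subset\mathbb{Z}^k$ there is an open $U$ with $X=\bigcup_nT^nU$ and $U\cap T^nU=\emptyset$ for nonzero $n\in F$. *)

theory Defs
  imports "HOL-Analysis.Analysis"
begin

definition zabs :: "int^'k \<Rightarrow> real" where
  "zabs n = sqrt (\<Sum>i\<in>UNIV. (real_of_int (n$i))^2)"

definition cube :: "nat \<Rightarrow> (int^'k) set" where
  "cube N = {n. \<forall>i. 0 \<le> n$i \<and> n$i < int N}"

definition dynsys :: "'a::metric_space set \<Rightarrow> (int^'k \<Rightarrow> 'a \<Rightarrow> 'a) \<Rightarrow> bool" where
  "dynsys X T \<longleftrightarrow> compact X \<and> (\<forall>n. continuous_on X (T n) \<and> T n ` X \<subseteq> X)
     \<and> (\<forall>x\<in>X. T 0 x = x) \<and> (\<forall>m n. \<forall>x\<in>X. T (m + n) x = T m (T n x))"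

definition marker_property :: "'a::metric_space set \<Rightarrow> (int^'k \<Rightarrow> 'a \<Rightarrow> 'a) \<Rightarrow> bool" where
  "marker_property X T \<longleftrightarrow> (\<forall>F::(int^'k) set. finite F \<longrightarrow>
     (\<exists>U. openin (top_of_set X) U \<and> X = (\<Union>n. T n ` U)
          \<and> (\<forall>n\<in>F. n \<noteq> 0 \<longrightarrow> U \<inter> T n ` U = {})))"

definition bowen :: "(int^'k \<Rightarrow> 'b \<Rightarrow> 'b) \<Rightarrow> ('b \<Rightarrow> 'b \<Rightarrow> real) \<Rightarrow> (int^'k) set \<Rightarrow> 'b \<Rightarrow> 'b \<Rightarrow> real" where
  "bowen T \<rho> \<Omega> x y = Sup ((\<lambda>n. \<rho> (T n x) (T n y)) ` \<Omega>)"

definition diam_lt :: "('b \<Rightarrow> 'b \<Rightarrow> real) \<Rightarrow> 'b set \<Rightarrow> real \<Rightarrow> bool" where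
  "diam_lt \<rho> U \<epsilon> \<longleftrightarrow> (\<exists>c<\<epsilon>. \<forall>x\<in>U. \<forall>y\<in>U. \<rho> x y \<le> c)"

definition rho_open :: "'b set \<Rightarrow> ('b \<Rightarrow> 'b \<Rightarrow> real) \<Rightarrow> 'b set \<Rightarrow> bool" where
  "rho_open Y \<rho> U \<longleftrightarrow> U \<subseteq> Y \<and> (\<forall>x\<in>U. \<exists>r>0. \<forall>y\<in>Y. \<rho> x y < r \<longrightarrow> y \<in> U)"

definition cover_num :: "'b set \<Rightarrow> real \<Rightarrow> ('b \<Rightarrow> 'b \<Rightarrow> real) \<Rightarrow> nat" where
  "cover_num Y \<epsilon> \<rho> = (LEAST n. \<exists>\<U>. finite \<U> \<and> card \<U> = n \<and>
      (\<forall>U\<in>\<U>. rho_open Y \<rho> U \<and> diam_lt \<rho> U \<epsilon>) \<and> Y \<subseteq> \<Union>\<U>)"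

definition S_ent :: "(int^'k \<Rightarrow> 'b \<Rightarrow> 'b) \<Rightarrow> 'b set \<Rightarrow> real \<Rightarrow> ('b \<Rightarrow> 'b \<Rightarrow> real) \<Rightarrow> real" where
  "S_ent T Y \<epsilon> \<rho> = lim (\<lambda>N. ln (real (cover_num Y \<epsilon> (bowen T \<rho> (cube N))))
                                / real N ^ CARD('k))"

definition mdim_M :: "(int^'k \<Rightarrow> 'b \<Rightarrow> 'b) \<Rightarrow> 'b set \<Rightarrow> ('b \<Rightarrow> 'b \<Rightarrow> real) \<Rightarrow> ereal" where
  "mdim_M T Y \<rho> = Liminf (at_right 0) (\<lambda>\<epsilon>. ereal (S_ent T Y \<epsilon> \<rho> / \<bar>ln \<epsilon>\<bar>))"

definition simplicial_complex :: "nat set set \<Rightarrow> bool" where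
  "simplicial_complex S \<longleftrightarrow> finite S \<and> S \<noteq> {} \<and> (\<forall>\<sigma>\<in>S. finite \<sigma> \<and> \<sigma> \<noteq> {})
     \<and> (\<forall>\<sigma>\<in>S. \<forall>\<tau>. \<tau> \<subseteq> \<sigma> \<and> \<tau> \<noteq> {} \<longrightarrow> \<tau> \<in> S)"

definition sc_dim :: "nat set set \<Rightarrow> nat" where
  "sc_dim S = Max (card ` S) - 1"

text \<open>Geometric realization: barycentric coordinate functions whose support is a simplex.
  Its topology is the one induced by pointwise convergence (only finitely many coordinates).\<close>
definition realization :: "nat set set \<Rightarrow> (nat \<Rightarrow> real) set" where
  "realization S = {t. (\<forall>i. 0 \<le> t i) \<and> {i. t i \<noteq> 0} \<in> S \<and> (\<Sum>i\<in>{i. t i \<noteq> 0}. t i) = 1}"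

definition rho_continuous :: "'b set \<Rightarrow> ('b \<Rightarrow> 'b \<Rightarrow> real) \<Rightarrow> ('b \<Rightarrow> real) \<Rightarrow> bool" where
  "rho_continuous Y \<rho> g \<longleftrightarrow> (\<forall>x\<in>Y. \<forall>e>0. \<exists>\<delta>>0. \<forall>y\<in>Y. \<rho> x y < \<delta> \<longrightarrow> \<bar>g y - g x\<bar> < e)"

definition widim :: "'b set \<Rightarrow> real \<Rightarrow> ('b \<Rightarrow> 'b \<Rightarrow> real) \<Rightarrow> nat" where
  "widim Y \<epsilon> \<rho> = (LEAST n. \<exists>S \<phi>. simplicial_complex S \<and> sc_dim S = n
      \<and> (\<forall>i. rho_continuous Y \<rho> (\<lambda>x. \<phi> x i)) \<and> \<phi> ` Y \<subseteq> realization S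
      \<and> (\<forall>p. diam_lt \<rho> {x\<in>Y. \<phi> x = p} \<epsilon>))"

definition mdim :: "(int^'k \<Rightarrow> 'b \<Rightarrow> 'b) \<Rightarrow> 'b set \<Rightarrow> ('b \<Rightarrow> 'b \<Rightarrow> real) \<Rightarrow> ereal" where
  "mdim T X d = Lim (at_right 0)
     (\<lambda>\<epsilon>. ereal (lim (\<lambda>N. real (widim X \<epsilon> (bowen T d (cube N))) / real N ^ CARD('k))))"

definition shift :: "int^'k \<Rightarrow> (int^'k \<Rightarrow> 'v) \<Rightarrow> (int^'k \<Rightarrow> 'v)" where
  "shift n x = (\<lambda>m. x (m + n))"

definition Dmetric :: "(int^'k \<Rightarrow> 'v::real_normed_vector) \<Rightarrow> (int^'k \<Rightarrow> 'v) \<Rightarrow> real" where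
  "Dmetric x y = infsum (\<lambda>n. 2 powr (- zabs n) * norm (x n - y n)) UNIV"

definition I_map :: "(int^'k \<Rightarrow> 'a \<Rightarrow> 'a) \<Rightarrow> ('a \<Rightarrow> 'v) \<Rightarrow> 'a \<Rightarrow> (int^'k \<Rightarrow> 'v)" where
  "I_map T f x = (\<lambda>n. f (T n x))"

text \<open>Functions are normalised to 0 outside X so that they are determined by their values on X.\<close>
definition CXK :: "'a::topological_space set \<Rightarrow> 'v::real_normed_vector set \<Rightarrow> ('a \<Rightarrow> 'v) set" where
  "CXK X K = {f. continuous_on X f \<and> f ` X \<subseteq> K \<and> (\<forall>x. x \<notin> X \<longrightarrow> f x = 0)}"

definition supdist :: "'a set \<Rightarrow> ('a \<Rightarrow> 'v::real_normed_vector) \<Rightarrow> ('a \<Rightarrow> 'v) \<Rightarrow> real" where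
  "supdist X f g = Sup (insert 0 ((\<lambda>x. norm (f x - g x)) ` X))"

definition dense_Gdelta_in :: "'c set \<Rightarrow> ('c \<Rightarrow> 'c \<Rightarrow> real) \<Rightarrow> 'c set \<Rightarrow> bool" where
  "dense_Gdelta_in C \<rho> G \<longleftrightarrow> G \<subseteq> C
     \<and> (\<forall>f\<in>C. \<forall>r>0. \<exists>g\<in>G. \<rho> f g < r)
     \<and> (\<exists>U::nat \<Rightarrow> 'c set. (\<forall>m. rho_open C \<rho> (U m)) \<and> G = (\<Inter>m. U m))"

end

theory Submission
  imports Defs
begin

text \<open>
  Pick \<open>N\<close> and an \<open>\<epsilon>\<close>-embedding \<open>\<phi>\<close> of \<open>(X, d\<^bsub>[N]\<^esub>)\<close> into a complex of dimension less than
  \<open>N\<^sup>k (mdim X + \<delta>)\<close>. On \<open>\<phi>(X)\<close> the \<open>N\<close>-cube of values of \<open>f\<close> along an orbit is close to a Lipschitz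
  function of \<open>\<phi>\<close>. The marker property yields equivariant, continuously varying disjoint
  \<open>N\<close>-cubes in \<open>\<int>\<^sup>k\<close> covering all but a proportion \<open>\<eta>\<close> of it. Let \<open>g\<close> be given by the Lipschitz
  function on these cubes and by a convex interpolation elsewhere; then \<open>g\<close> is close to \<open>f\<close>, and
  at scale \<open>\<epsilon>\<close> each cube costs \<open>N\<^sup>k (mdim X + \<delta>) log (1/\<epsilon>)\<close>, while the uncovered positions add only
  \<open>O(\<eta> log (1/\<epsilon>))\<close> per lattice point, because \<open>g\<close> takes values in a fixed finite-dimensional polytope.
  Having a covering number this small at some scale below \<open>1/m\<close> is an open condition, so Baire's
  theorem applies.
\<close>

section \<open>Cubes and subadditivity\<close>

text \<open>The order of choices decides whether the count closes. The size of the complex and the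
  number of sample points are not controlled by the mean dimension, so \<open>N\<close>, the complex
  and the Lipschitz functions are fixed before \<eta>. Then \<eta> is taken small against the
  dimension of the polytope. Only after that is \<epsilon> taken so small that |ln \<epsilon>|
  absorbs every remaining constant: the number of simplices, the factor 2 per site for recording
  tile positions, the Lipschitz constants. The window is chosen last. The limit inferior is what
  makes the condition open and reachable: for each m one scale suffices, and by subadditivity one
  window at that scale already bounds the limit in \<open>S_ent\<close>. The tiles are cut from a
  Voronoi diagram with additive weights. Its cells have no gap between them, so the cubes are taken
  in a contracted diagram, and their density is found by counting lattice points instead of
  comparing volumes. \<open>lim\<close> and \<open>LEAST\<close> in the definitions are meaningful
  only once convergence and attainment are known. Hence products of complexes have to be
  triangulated with additive dimension, and covers are replaced by codes, which multiply.\<close>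

lemma cube_eq_image: "cube N = vec_lambda ` (PiE UNIV (\<lambda>i::'k::finite. {0..<int N}))"
proof -
  have "n \<in> vec_lambda ` (PiE UNIV (\<lambda>i::'k. {0..<int N}))" if "n \<in> cube N" for n :: "int^'k"
    using that by (intro image_eqI[of _ _ "vec_nth n"]) (auto simp: cube_def)
  then show ?thesis by (auto simp: cube_def PiE_iff)
qed

lemma finite_cube [simp]: "finite (cube N :: (int^'k) set)"
  unfolding cube_eq_image by (intro finite_imageI finite_PiE) auto

lemma card_cube: "card (cube N :: (int^'k) set) = N ^ CARD('k)"
proof -
  have "card (cube N :: (int^'k) set) = card (PiE UNIV (\<lambda>i::'k. {0..<int N}))"
    unfolding cube_eq_image by (intro card_image inj_onI) (simp add: vec_lambda_inject)
  also have "\<dots> = N ^ CARD('k)" by (simp add: card_PiE)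
  finally show ?thesis .
qed

lemma zero_in_cube: "N \<ge> 1 \<Longrightarrow> 0 \<in> cube N"
  by (auto simp: cube_def)

lemma cube_nonempty: "N \<ge> 1 \<Longrightarrow> cube N \<noteq> {}"
  using zero_in_cube by blast

definition zscale :: "nat \<Rightarrow> int^'k \<Rightarrow> int^'k" where
  "zscale N c = (\<chi> i. int N * c$i)"

text \<open>Coordinatewise division with remainder by \<open>N\<close>. The \<open>+ 1\<close> pays
  for the last, possibly incomplete block and keeps the statement valid when
  \<open>L < N\<close>.\<close>

lemma cube_cover:
  assumes "N \<ge> 1"
  shows "cube L \<subseteq> (\<Union>c\<in>cube (L div N + 1). (+) (zscale N c) ` (cube N :: (int^'k) set))"
proof
  fix m :: "int^'k" assume m: "m \<in> cube L"
  define c :: "int^'k" where "c = (\<chi> i. m$i div int N)"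
  define r :: "int^'k" where "r = (\<chi> i. m$i mod int N)"
  have "c \<in> cube (L div N + 1)"
  proof -
    have "m$i div int N \<le> int L div int N" for i
      using m assms by (intro zdiv_mono1) (auto simp: cube_def less_imp_le)
    moreover have "m$i div int N \<ge> 0" for i
      using m assms by (simp add: cube_def pos_imp_zdiv_nonneg_iff)
    ultimately show ?thesis by (auto simp: cube_def c_def zdiv_int add.commute[of 1] zle_add1_eq_le)
  qed
  moreover have "r \<in> cube N" using assms by (auto simp: cube_def r_def)
  moreover have "m = zscale N c + r" by (simp add: vec_eq_iff zscale_def c_def r_def)
  ultimately show "m \<in> (\<Union>c\<in>cube (L div N + 1). (+) (zscale N c) ` cube N)" by blast
qed

text \<open>Fekete's argument in dimension \<open>k\<close>: the limit is the infimum. The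
  hypothesis is what covering a large cube by translates of a small one gives; the excess at the
  border disappears in the limit because \<open>(L div N + 1) / L\<close> is at most
  \<open>1 / N + 1 / L\<close>.\<close>

lemma subadditive_cubes:
  fixes a :: "nat \<Rightarrow> real" and k :: nat
  assumes nn: "\<And>n. a n \<ge> 0"
    and sub: "\<And>N L. N \<ge> 1 \<Longrightarrow> L \<ge> 1 \<Longrightarrow> a L \<le> real (L div N + 1) ^ k * a N"
  shows "\<exists>l\<ge>0. (\<lambda>L. a L / real L ^ k) \<longlonglongrightarrow> l \<and> (\<forall>N\<ge>1. l \<le> a N / real N ^ k)"
proof -
  define l where "l = (INF N\<in>{1..}. a N / real N ^ k)"
  have bdd: "bdd_below ((\<lambda>N. a N / real N ^ k) ` {1..})"
    by (intro bdd_belowI2[where m=0]) (simp add: nn)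
  have le: "l \<le> a N / real N ^ k" if "N \<ge> 1" for N
    unfolding l_def using that by (intro cINF_lower bdd) auto
  have l0: "l \<ge> 0" unfolding l_def by (intro cINF_greatest) (auto simp: nn)
  have lim: "(\<lambda>L. a L / real L ^ k) \<longlonglongrightarrow> l"
  proof (rule LIMSEQ_I)
    fix e :: real assume e: "e > 0"
    have "\<exists>N\<in>{1..}. a N / real N ^ k < l + e"
      using cINF_less_iff[OF _ bdd, of "l + e"] e unfolding l_def by auto
    then obtain N where N: "N \<ge> 1" "a N / real N ^ k < l + e" by auto
    have "(\<lambda>L. (1 / real N + 1 / real L) ^ k * a N) \<longlonglongrightarrow> (1 / real N + 0) ^ k * a N"
      by (intro tendsto_intros lim_1_over_n)
    then have "(\<lambda>L. (1 / real N + 1 / real L) ^ k * a N) \<longlonglongrightarrow> a N / real N ^ k"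
      by (simp add: power_divide)
    then have "eventually (\<lambda>L. (1 / real N + 1 / real L) ^ k * a N < l + e) sequentially"
      using N(2) by (rule order_tendstoD)
    then obtain L0 where L0: "\<And>L. L \<ge> L0 \<Longrightarrow> (1 / real N + 1 / real L) ^ k * a N < l + e"
      by (auto simp: eventually_sequentially)
    have "norm (a L / real L ^ k - l) < e" if L: "L \<ge> max 1 L0" for L
    proof -
      have L1: "L \<ge> 1" using L by simp
      have "a L / real L ^ k \<le> real (L div N + 1) ^ k * a N / real L ^ k"
        using sub[OF N(1) L1] by (simp add: divide_right_mono)
      also have "\<dots> = (real (L div N + 1) / real L) ^ k * a N" by (simp add: power_divide)
      also have "\<dots> \<le> (1 / real N + 1 / real L) ^ k * a N"
      proof (intro mult_right_mono power_mono)
        have "real (L div N) \<le> real L / real N" by (metis of_nat_div_le_of_nat)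
        then have "real (L div N + 1) / real L \<le> (real L / real N + 1) / real L"
          by (intro divide_right_mono) auto
        also have "\<dots> = 1 / real N + 1 / real L" using L1 by (simp add: field_simps)
        finally show "real (L div N + 1) / real L \<le> 1 / real N + 1 / real L" .
      qed (auto simp: nn)
      also have "\<dots> < l + e" using L by (intro L0) simp
      finally show ?thesis using le[OF L1] by simp
    qed
    then show "\<exists>no. \<forall>n\<ge>no. norm (a n / real n ^ k - l) < e" by blast
  qed
  show ?thesis using lim l0 le by blast
qed

lemma diam_lt_bowen:
  assumes "finite \<Omega>" "\<Omega> \<noteq> {}"
  shows "diam_lt (bowen T \<rho> \<Omega>) U \<epsilon> \<longleftrightarrow> (\<exists>c<\<epsilon>. \<forall>x\<in>U. \<forall>y\<in>U. \<forall>n\<in>\<Omega>. \<rho> (T n x) (T n y) \<le> c)"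
proof -
  have "bowen T \<rho> \<Omega> x y \<le> c \<longleftrightarrow> (\<forall>n\<in>\<Omega>. \<rho> (T n x) (T n y) \<le> c)" for x y c
    unfolding bowen_def using assms by (subst cSup_le_iff) auto
  then show ?thesis by (simp add: diam_lt_def)
qed

lemma bowen_le_iff:
  assumes "finite \<Omega>" "\<Omega> \<noteq> {}"
  shows "bowen T \<rho> \<Omega> x y \<le> c \<longleftrightarrow> (\<forall>n\<in>\<Omega>. \<rho> (T n x) (T n y) \<le> c)"
  unfolding bowen_def using assms by (subst cSup_le_iff) auto

lemma bowen_less_iff:
  assumes "finite \<Omega>" "\<Omega> \<noteq> {}"
  shows "bowen T \<rho> \<Omega> x y < c \<longleftrightarrow> (\<forall>n\<in>\<Omega>. \<rho> (T n x) (T n y) < c)"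
  unfolding bowen_def using assms by (simp add: cSup_eq_Max)

section \<open>Products of simplicial complexes\<close>

lemma simplicial_complex_finite: "simplicial_complex S \<Longrightarrow> finite S"
  unfolding simplicial_complex_def by (elim conjE)

lemma simplicial_complex_ne: "simplicial_complex S \<Longrightarrow> S \<noteq> {}"
  unfolding simplicial_complex_def by (elim conjE)

lemma simplex_finite: "simplicial_complex S \<Longrightarrow> \<sigma> \<in> S \<Longrightarrow> finite \<sigma>"
  unfolding simplicial_complex_def by simp

lemma simplex_nonempty: "simplicial_complex S \<Longrightarrow> \<sigma> \<in> S \<Longrightarrow> \<sigma> \<noteq> {}"
  unfolding simplicial_complex_def by simp

lemma face:
  assumes "simplicial_complex S" "\<sigma> \<in> S" "\<tau> \<subseteq> \<sigma>" "\<tau> \<noteq> {}"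
  shows "\<tau> \<in> S"
  using assms unfolding simplicial_complex_def by blast

lemma card_le_sc_dim:
  assumes "simplicial_complex S" "\<sigma> \<in> S"
  shows "card \<sigma> \<le> sc_dim S + 1"
proof -
  have "card \<sigma> \<le> Max (card ` S)"
    using assms simplicial_complex_finite by (intro Max_ge) auto
  then show ?thesis by (simp add: sc_dim_def)
qed

lemma sc_dim_le:
  assumes "simplicial_complex S" "\<And>\<sigma>. \<sigma> \<in> S \<Longrightarrow> card \<sigma> \<le> n + 1"
  shows "sc_dim S \<le> n"
proof -
  have "Max (card ` S) \<le> n + 1"
    using assms(2) simplicial_complex_finite[OF assms(1)] simplicial_complex_ne[OF assms(1)]
    by (subst Max_le_iff) auto
  then show ?thesis by (simp add: sc_dim_def)
qed

lemma simplicial_complex_bounded: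
  assumes "simplicial_complex S"
  obtains m where "\<Union>S \<subseteq> {..<m}"
proof -
  have "finite (\<Union>S)" using simplicial_complex_finite[OF assms] simplex_finite[OF assms] by blast
  then have "\<exists>m. \<forall>i\<in>\<Union>S. i < m" by (rule iffD1[OF finite_nat_set_iff_bounded])
  then show ?thesis using that by blast
qed

lemma realization_iff:
  assumes "\<Union>S \<subseteq> {..<m}"
  shows "t \<in> realization S \<longleftrightarrow> (\<forall>i. 0 \<le> t i) \<and> {i. t i \<noteq> 0} \<in> S \<and> sum t {..<m} = 1"
proof -
  have "sum t {i. t i \<noteq> 0} = sum t {..<m}" if "{i. t i \<noteq> 0} \<in> S"
    using that assms by (intro sum.mono_neutral_left) auto
  then show ?thesis by (auto simp: realization_def)
qed

lemma realization_le_1: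
  assumes "t \<in> realization S" "simplicial_complex S"
  shows "t i \<le> 1"
proof -
  obtain m where m: "\<Union>S \<subseteq> {..<m}" using assms simplicial_complex_bounded by blast
  have t: "\<forall>i. 0 \<le> t i" "{i. t i \<noteq> 0} \<in> S" "sum t {..<m} = 1"
    using assms realization_iff[OF m] by auto
  show ?thesis
  proof (cases "i < m")
    case True
    have "t i \<le> sum t {..<m}" using True t(1) by (intro member_le_sum) auto
    then show ?thesis using t by simp
  next
    case False
    then have "t i = 0" using t(2) m by blast
    then show ?thesis by simp
  qed
qed

text \<open>The product of two realizations is triangulated by chains of the product order: subdividing
  \<open>[0,1]\<close> into consecutive intervals of lengths \<open>s i\<close>, respectively \<open>t j\<close>, the vertex \<open>(i, j)\<close> receives
  the length of the intersection of the \<open>i\<close>-th and the \<open>j\<close>-th interval.\<close>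

definition psum :: "(nat \<Rightarrow> real) \<Rightarrow> nat \<Rightarrow> real" where
  "psum t i = (\<Sum>j<i. t j)"

text \<open>Since \<open>min a b\<close> is the length of the intersection of [0,a] and [0,b], this
  mixed second difference of \<open>min\<close> is the length of the intersection of two intervals.
  Written with \<open>min\<close> it is visibly continuous in both arguments.\<close>

definition overlap :: "(nat \<Rightarrow> real) \<Rightarrow> (nat \<Rightarrow> real) \<Rightarrow> nat \<Rightarrow> nat \<Rightarrow> real" where
  "overlap s t i j = (min (psum s (Suc i)) (psum t (Suc j)) - min (psum s (Suc i)) (psum t j))
     - (min (psum s i) (psum t (Suc j)) - min (psum s i) (psum t j))"

definition prod_point :: "(nat \<Rightarrow> real) \<Rightarrow> (nat \<Rightarrow> real) \<Rightarrow> nat \<Rightarrow> real" where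
  "prod_point s t l = overlap s t (fst (prod_decode l)) (snd (prod_decode l))"

text \<open>Vertices are pairs coded as natural numbers, so that the product is again a complex of
  the required type and the construction can be iterated.\<close>

definition chain_product :: "nat set set \<Rightarrow> nat set set \<Rightarrow> nat set set" where
  "chain_product S1 S2 = {\<sigma>. (fst \<circ> prod_decode) ` \<sigma> \<in> S1 \<and> (snd \<circ> prod_decode) ` \<sigma> \<in> S2 \<and>
     (\<forall>p\<in>\<sigma>. \<forall>q\<in>\<sigma>. \<not> (fst (prod_decode p) < fst (prod_decode q) \<and> snd (prod_decode q) < snd (prod_decode p)))}"

lemma simplicial_complex_chain_product:
  assumes S1: "simplicial_complex S1" and S2: "simplicial_complex S2"
  shows "simplicial_complex (chain_product S1 S2)"
proof -
  obtain m1 where m1: "\<Union>S1 \<subseteq> {..<m1}" using S1 simplicial_complex_bounded by blast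
  obtain m2 where m2: "\<Union>S2 \<subseteq> {..<m2}" using S2 simplicial_complex_bounded by blast
  have sub: "\<sigma> \<subseteq> prod_encode ` ({..<m1} \<times> {..<m2})" if "\<sigma> \<in> chain_product S1 S2" for \<sigma>
  proof
    fix l assume l: "l \<in> \<sigma>"
    have "fst (prod_decode l) \<in> (fst \<circ> prod_decode) ` \<sigma>" "snd (prod_decode l) \<in> (snd \<circ> prod_decode) ` \<sigma>"
      using l by auto
    then have "fst (prod_decode l) \<in> \<Union>S1" "snd (prod_decode l) \<in> \<Union>S2"
      using that unfolding chain_product_def by blast+
    then have "fst (prod_decode l) < m1" "snd (prod_decode l) < m2"
      using m1 m2 by auto
    then show "l \<in> prod_encode ` ({..<m1} \<times> {..<m2})"
      by (intro image_eqI[of _ _ "prod_decode l"]) (auto simp: mem_Times_iff)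
  qed
  have "chain_product S1 S2 \<subseteq> Pow (prod_encode ` ({..<m1} \<times> {..<m2}))" using sub by blast
  then have fin: "finite (chain_product S1 S2)" by (rule finite_subset) auto
  obtain \<sigma>1 \<sigma>2 where "\<sigma>1 \<in> S1" "\<sigma>2 \<in> S2" using simplicial_complex_ne S1 S2 by blast
  then obtain i j where ij: "i \<in> \<sigma>1" "j \<in> \<sigma>2" using simplex_nonempty[OF S1] simplex_nonempty[OF S2] by blast
  have "{i} \<in> S1" "{j} \<in> S2"
    using face[OF S1 \<open>\<sigma>1 \<in> S1\<close>, of "{i}"] face[OF S2 \<open>\<sigma>2 \<in> S2\<close>, of "{j}"] ij by auto
  then have "{prod_encode (i,j)} \<in> chain_product S1 S2" by (simp add: chain_product_def)
  moreover have "finite \<sigma> \<and> \<sigma> \<noteq> {}" if "\<sigma> \<in> chain_product S1 S2" for \<sigma>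
  proof
    show "finite \<sigma>" by (rule finite_subset[OF sub[OF that]]) auto
    show "\<sigma> \<noteq> {}" using that simplex_nonempty[OF S1, of "{}"] by (auto simp: chain_product_def)
  qed
  moreover have "\<tau> \<in> chain_product S1 S2" if "\<sigma> \<in> chain_product S1 S2" "\<tau> \<subseteq> \<sigma>" "\<tau> \<noteq> {}" for \<sigma> \<tau>
  proof -
    have "(fst \<circ> prod_decode) ` \<tau> \<in> S1"
      by (rule face[OF S1, of "(fst \<circ> prod_decode) ` \<sigma>"]) (use that in \<open>auto simp: chain_product_def\<close>)
    moreover have "(snd \<circ> prod_decode) ` \<tau> \<in> S2"
      by (rule face[OF S2, of "(snd \<circ> prod_decode) ` \<sigma>"]) (use that in \<open>auto simp: chain_product_def\<close>)
    ultimately show ?thesis using that unfolding chain_product_def by blast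
  qed
  ultimately show ?thesis using fin unfolding simplicial_complex_def by blast
qed

lemma card_less_strict_mono:
  fixes A :: "nat set"
  assumes "finite A" "i \<in> A" "i < j"
  shows "card {l\<in>A. l < i} < card {l\<in>A. l < j}"
  using assms by (intro psubset_card_mono) auto

text \<open>A chain over \<open>A\<close> and \<open>B\<close> has at most |A| + |B| - 1 elements:
  the rank \<open>r\<close>, counting the smaller elements in both projections, increases strictly
  along the chain and ranges over 0, ..., |A| + |B| - 2. This is why dimensions add, without an
  extra 1.\<close>

lemma sc_dim_chain_product:
  assumes S1: "simplicial_complex S1" and S2: "simplicial_complex S2"
  shows "sc_dim (chain_product S1 S2) \<le> sc_dim S1 + sc_dim S2"
proof (rule sc_dim_le[OF simplicial_complex_chain_product[OF assms]])
  fix \<sigma> assume \<sigma>: "\<sigma> \<in> chain_product S1 S2"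
  define p where "p = fst \<circ> prod_decode"
  define q where "q = snd \<circ> prod_decode"
  define A where "A = p ` \<sigma>"
  define B where "B = q ` \<sigma>"
  have AB: "A \<in> S1" "B \<in> S2" using \<sigma> by (auto simp: chain_product_def A_def B_def p_def q_def)
  have finAB: "finite A" "finite B" using simplex_finite AB S1 S2 by blast+
  define r where "r l = card {i\<in>A. i < p l} + card {j\<in>B. j < q l}" for l
  have eq: "l = l'" if "p l = p l'" "q l = q l'" for l l'
    using that unfolding p_def q_def comp_apply
    by (metis prod.expand prod_decode_inverse)
  have ne: "r l \<noteq> r l'" if "l \<in> \<sigma>" "l' \<in> \<sigma>" "p l < p l' \<or> (p l = p l' \<and> q l < q l')" for l l'
  proof -
    have "\<not> (p l < p l' \<and> q l' < q l)"
      using that(1,2) \<sigma> unfolding chain_product_def p_def q_def by simp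
    then have "q l \<le> q l'" using that(3) by linarith
    then have "card {j\<in>B. j < q l} \<le> card {j\<in>B. j < q l'}"
      using finAB by (intro card_mono) auto
    moreover have "card {i\<in>A. i < p l} \<le> card {i\<in>A. i < p l'}"
      using that finAB by (intro card_mono) auto
    moreover have "card {i\<in>A. i < p l} < card {i\<in>A. i < p l'} \<or> card {j\<in>B. j < q l} < card {j\<in>B. j < q l'}"
      using that(3)
    proof
      assume "p l < p l'"
      then show ?thesis using card_less_strict_mono[OF finAB(1), of "p l"] that(1) by (simp add: A_def)
    next
      assume "p l = p l' \<and> q l < q l'"
      then show ?thesis using card_less_strict_mono[OF finAB(2), of "q l"] that(1) by (simp add: B_def)
    qed
    ultimately show ?thesis unfolding r_def by linarith
  qed
  have inj: "inj_on r \<sigma>"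
  proof (rule inj_onI)
    fix l l' assume l: "l \<in> \<sigma>" "l' \<in> \<sigma>" "r l = r l'"
    show "l = l'"
    proof (rule ccontr)
      assume "l \<noteq> l'"
      then have "p l < p l' \<or> p l' < p l \<or> (p l = p l' \<and> (q l < q l' \<or> q l' < q l))"
        using eq by (metis linorder_neqE_nat)
      then show False using ne[OF l(1,2)] ne[OF l(2,1)] l(3) by auto
    qed
  qed
  have "card \<sigma> = card (r ` \<sigma>)" using inj by (simp add: card_image)
  also have "\<dots> \<le> card {..< card A + card B - 1}"
  proof (rule card_mono)
    show "r ` \<sigma> \<subseteq> {..< card A + card B - 1}"
    proof
      fix y assume "y \<in> r ` \<sigma>"
      then obtain l where l: "l \<in> \<sigma>" "y = r l" by auto
      have "card {i\<in>A. i < p l} < card A" using l finAB by (intro psubset_card_mono) (auto simp: A_def)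
      moreover have "card {j\<in>B. j < q l} < card B" using l finAB by (intro psubset_card_mono) (auto simp: B_def)
      ultimately show "y \<in> {..< card A + card B - 1}" using l by (auto simp: r_def)
    qed
  qed auto
  finally show "card \<sigma> \<le> sc_dim S1 + sc_dim S2 + 1"
    using card_le_sc_dim[OF S1 AB(1)] card_le_sc_dim[OF S2 AB(2)] by simp
qed

lemma overlap_nonneg:
  assumes "\<forall>i. 0 \<le> s i" "\<forall>i. 0 \<le> t i"
  shows "0 \<le> overlap s t i j"
proof -
  have "psum s i \<le> psum s (Suc i)" "psum t j \<le> psum t (Suc j)" using assms by (auto simp: psum_def)
  then show ?thesis unfolding overlap_def by (auto simp: min_def)
qed

lemma overlap_nonzero:
  assumes "\<forall>i. 0 \<le> s i" "\<forall>i. 0 \<le> t i" "overlap s t i j \<noteq> 0"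
  shows "psum s i < psum t (Suc j) \<and> psum t j < psum s (Suc i) \<and> s i \<noteq> 0 \<and> t j \<noteq> 0"
proof -
  have "psum s (Suc i) = psum s i + s i" "psum t (Suc j) = psum t j + t j" using assms by (auto simp: psum_def)
  moreover have "0 \<le> s i" "0 \<le> t j" using assms by auto
  ultimately show ?thesis using assms(3) unfolding overlap_def by (auto simp: min_def split: if_splits)
qed

lemma psum_mono: "\<forall>i. 0 \<le> s i \<Longrightarrow> i \<le> j \<Longrightarrow> psum s i \<le> psum s j"
  unfolding psum_def by (intro sum_mono2) auto

text \<open>The intervals of \<open>t\<close> partition [0,1], so their intersections with the
  \<open>i\<close>-th interval of \<open>s\<close> exhaust its length. The sum telescopes. Hence
  both factors can be read off as marginals.\<close>

lemma sum_overlap_right: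
  assumes "\<forall>i. 0 \<le> s i" "\<forall>i. 0 \<le> t i" "psum t m = 1" "psum s m = 1" "i < m"
  shows "(\<Sum>j<m. overlap s t i j) = s i"
proof -
  have le: "psum s l \<le> 1" if "l \<le> m" for l using psum_mono[of s l m] assms that by simp
  have ge: "0 \<le> psum s l" for l using assms by (auto simp: psum_def intro: sum_nonneg)
  have tele: "(\<Sum>j<m. min a (psum t (Suc j)) - min a (psum t j)) = min a (psum t m) - min a (psum t 0)" for a
    by (rule sum_lessThan_telescope)
  have "(\<Sum>j<m. overlap s t i j) = (min (psum s (Suc i)) (psum t m) - min (psum s (Suc i)) (psum t 0))
      - (min (psum s i) (psum t m) - min (psum s i) (psum t 0))"
    using tele[of "psum s (Suc i)"] tele[of "psum s i"] by (simp only: overlap_def sum_subtractf)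
  moreover have "psum t 0 = 0" by (simp add: psum_def)
  moreover have "psum s (Suc i) = psum s i + s i" by (simp add: psum_def)
  moreover
  have "min (psum s l) (psum t m) = psum s l" "min (psum s l) 0 = 0" if "l \<le> m" for l
    using le[OF that] ge[of l] assms by auto
  from this[of i] this[of "Suc i"] have "min (psum s i) (psum t m) = psum s i" "min (psum s i) 0 = 0"
      "min (psum s (Suc i)) (psum t m) = psum s (Suc i)" "min (psum s (Suc i)) 0 = 0"
    using assms(5) by auto
  ultimately show ?thesis by simp
qed

lemma overlap_commute: "overlap s t i j = overlap t s j i"
  by (simp add: overlap_def min.commute)

lemma prod_point_encode [simp]: "prod_point s t (prod_encode (i, j)) = overlap s t i j"
  by (simp add: prod_point_def)

lemma prod_point_realization:
  assumes S1: "simplicial_complex S1" and S2: "simplicial_complex S2"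
    and s: "s \<in> realization S1" and t: "t \<in> realization S2"
  shows "prod_point s t \<in> realization (chain_product S1 S2)"
proof -
  obtain m1 where m1: "\<Union>S1 \<subseteq> {..<m1}" using S1 simplicial_complex_bounded by blast
  obtain m2 where m2: "\<Union>S2 \<subseteq> {..<m2}" using S2 simplicial_complex_bounded by blast
  define m where "m = max m1 m2"
  have m: "\<Union>S1 \<subseteq> {..<m}" "\<Union>S2 \<subseteq> {..<m}" using m1 m2 unfolding m_def by fastforce+
  have s': "\<forall>i. 0 \<le> s i" "{i. s i \<noteq> 0} \<in> S1" "psum s m = 1"
    using s realization_iff[OF m(1)] by (auto simp: psum_def)
  have t': "\<forall>i. 0 \<le> t i" "{i. t i \<noteq> 0} \<in> S2" "psum t m = 1"
    using t realization_iff[OF m(2)] by (auto simp: psum_def)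
  define \<sigma> where "\<sigma> = {l. prod_point s t l \<noteq> 0}"
  have nz: "psum s (fst (prod_decode l)) < psum t (Suc (snd (prod_decode l)))"
      "psum t (snd (prod_decode l)) < psum s (Suc (fst (prod_decode l)))"
      "s (fst (prod_decode l)) \<noteq> 0" "t (snd (prod_decode l)) \<noteq> 0" if "l \<in> \<sigma>" for l
    using that overlap_nonzero[OF s'(1) t'(1)] by (auto simp: \<sigma>_def prod_point_def)
  have sub: "\<sigma> \<subseteq> prod_encode ` ({..<m} \<times> {..<m})"
  proof
    fix l assume l: "l \<in> \<sigma>"
    have "fst (prod_decode l) < m" "snd (prod_decode l) < m"
      using nz(3,4)[OF l] s'(2) t'(2) m by blast+
    then show "l \<in> prod_encode ` ({..<m} \<times> {..<m})"
      by (intro image_eqI[of _ _ "prod_decode l"]) (auto simp: mem_Times_iff)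
  qed
  have "sum (prod_point s t) \<sigma> = sum (prod_point s t) (prod_encode ` ({..<m} \<times> {..<m}))"
    using sub by (intro sum.mono_neutral_left) (auto simp: \<sigma>_def)
  also have "\<dots> = (\<Sum>p\<in>{..<m} \<times> {..<m}. overlap s t (fst p) (snd p))"
    by (subst sum.reindex) (auto simp: inj_prod_encode prod_point_def)
  also have "\<dots> = (\<Sum>i<m. \<Sum>j<m. overlap s t i j)"
    by (simp add: sum.cartesian_product case_prod_unfold)
  also have "\<dots> = (\<Sum>i<m. s i)" using s' t' by (intro sum.cong) (auto simp: sum_overlap_right)
  also have "\<dots> = 1" using s' by (simp add: psum_def)
  finally have sum1: "sum (prod_point s t) \<sigma> = 1" .
  then have ne: "\<sigma> \<noteq> {}" by auto
  have "(fst \<circ> prod_decode) ` \<sigma> \<subseteq> {i. s i \<noteq> 0}" using nz(3) by auto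
  then have 1: "(fst \<circ> prod_decode) ` \<sigma> \<in> S1" using ne by (intro face[OF S1 s'(2)]) auto
  have "(snd \<circ> prod_decode) ` \<sigma> \<subseteq> {i. t i \<noteq> 0}" using nz(4) by auto
  then have 2: "(snd \<circ> prod_decode) ` \<sigma> \<in> S2" using ne by (intro face[OF S2 t'(2)]) auto
  \<comment> \<open>Two crossing vertices of the support are impossible: the interval of
    \<open>t\<close> at \<open>p\<close> would begin before the interval of \<open>s\<close> at
    \<open>p\<close> ends, hence before the one at \<open>q\<close> begins, hence before the
    interval of \<open>t\<close> at \<open>q\<close> ends, although the latter precedes it.\<close>
  have 3: "\<not> (fst (prod_decode p) < fst (prod_decode q) \<and> snd (prod_decode q) < snd (prod_decode p))"
    if "p \<in> \<sigma>" "q \<in> \<sigma>" for p q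
  proof
    assume a: "fst (prod_decode p) < fst (prod_decode q) \<and> snd (prod_decode q) < snd (prod_decode p)"
    have "psum s (Suc (fst (prod_decode p))) \<le> psum s (fst (prod_decode q))"
      using a by (intro psum_mono s') auto
    moreover have "psum t (Suc (snd (prod_decode q))) \<le> psum t (snd (prod_decode p))"
      using a by (intro psum_mono t') auto
    ultimately show False using nz(2)[OF that(1)] nz(1)[OF that(2)] by linarith
  qed
  have "\<sigma> \<in> chain_product S1 S2" using 1 2 3 unfolding chain_product_def by blast
  moreover have "\<forall>l. 0 \<le> prod_point s t l" using overlap_nonneg s' t' by (auto simp: prod_point_def)
  ultimately show ?thesis using sum1 unfolding realization_def \<sigma>_def by blast
qed

lemma prod_point_inject:
  assumes S1: "simplicial_complex S1" and S2: "simplicial_complex S2"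
    and "s \<in> realization S1" "t \<in> realization S2" "s' \<in> realization S1" "t' \<in> realization S2"
    and eq: "prod_point s t = prod_point s' t'"
  shows "s = s' \<and> t = t'"
proof -
  obtain m1 where m1: "\<Union>S1 \<subseteq> {..<m1}" using S1 simplicial_complex_bounded by blast
  obtain m2 where m2: "\<Union>S2 \<subseteq> {..<m2}" using S2 simplicial_complex_bounded by blast
  define m where "m = max m1 m2"
  have m: "\<Union>S1 \<subseteq> {..<m}" "\<Union>S2 \<subseteq> {..<m}" using m1 m2 unfolding m_def by fastforce+
  have r: "\<forall>i. 0 \<le> s i" "{i. s i \<noteq> 0} \<in> S1" "psum s m = 1" "\<forall>i. 0 \<le> s' i" "{i. s' i \<noteq> 0} \<in> S1" "psum s' m = 1"
     "\<forall>i. 0 \<le> t i" "{i. t i \<noteq> 0} \<in> S2" "psum t m = 1" "\<forall>i. 0 \<le> t' i" "{i. t' i \<noteq> 0} \<in> S2" "psum t' m = 1"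
    using assms realization_iff[OF m(1)] realization_iff[OF m(2)] by (auto simp: psum_def)
  have ov: "overlap s t i j = overlap s' t' i j" for i j
    using fun_cong[OF eq, of "prod_encode (i, j)"] by simp
  have "s i = s' i" for i
  proof (cases "i < m")
    case True
    then show ?thesis
      using sum_overlap_right[of s t m i] sum_overlap_right[of s' t' m i] r ov by simp
  next
    case False
    then have "s i = 0" "s' i = 0" using m(1) r(2,5) by blast+
    then show ?thesis by simp
  qed
  moreover have "t i = t' i" for i
  proof (cases "i < m")
    case True
    then show ?thesis
      using sum_overlap_right[of t s m i] sum_overlap_right[of t' s' m i] r ov by (simp add: overlap_commute)
  next
    case False
    then have "t i = 0" "t' i = 0" using m(2) r(8,11) by blast+
    then show ?thesis by simp
  qed
  ultimately show ?thesis by auto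
qed

section \<open>Mean dimension\<close>

lemma dynsys_compact: "dynsys X T \<Longrightarrow> compact X"
  and dynsys_cont: "dynsys X T \<Longrightarrow> continuous_on X (T n)"
  and dynsys_in: "dynsys X T \<Longrightarrow> x \<in> X \<Longrightarrow> T n x \<in> X"
  and dynsys_0: "dynsys X T \<Longrightarrow> x \<in> X \<Longrightarrow> T 0 x = x"
  and dynsys_add: "dynsys X T \<Longrightarrow> x \<in> X \<Longrightarrow> T m (T n x) = T (m + n) x"
  unfolding dynsys_def by auto

lemma dynsys_cont_comp:
  assumes "dynsys X T" "continuous_on X g"
  shows "continuous_on X (\<lambda>x. g (T n x))"
  by (rule continuous_on_compose2[OF assms(2) dynsys_cont[OF assms(1)]])
     (use dynsys_in[OF assms(1)] in auto)

lemma dynsys_uniform: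
  assumes "dynsys X T" "finite \<Omega>" "\<epsilon> > 0"
  obtains \<delta> where "\<delta> > 0" "\<And>x y n. x \<in> X \<Longrightarrow> y \<in> X \<Longrightarrow> dist x y < \<delta> \<Longrightarrow> n \<in> \<Omega> \<Longrightarrow> dist (T n x) (T n y) < \<epsilon>"
proof -
  have "\<exists>\<delta>>0. \<forall>x\<in>X. \<forall>y\<in>X. dist x y < \<delta> \<longrightarrow> (\<forall>n\<in>\<Omega>. dist (T n x) (T n y) < \<epsilon>)"
    using assms(2)
  proof (induction \<Omega>)
    case empty
    show ?case by (intro exI[of _ 1]) auto
  next
    case (insert n \<Omega>)
    obtain d1 where d1: "d1 > 0" "\<forall>x\<in>X. \<forall>y\<in>X. dist x y < d1 \<longrightarrow> (\<forall>n\<in>\<Omega>. dist (T n x) (T n y) < \<epsilon>)"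
      using insert by blast
    have "uniformly_continuous_on X (T n)"
      by (rule compact_uniformly_continuous[OF dynsys_cont[OF assms(1)] dynsys_compact[OF assms(1)]])
    then obtain d2 where d2: "d2 > 0" "\<forall>x\<in>X. \<forall>y\<in>X. dist y x < d2 \<longrightarrow> dist (T n y) (T n x) < \<epsilon>"
      using assms(3) unfolding uniformly_continuous_on_def by meson
    show ?case
      by (rule exI[of _ "min d1 d2"]) (use d1 d2 in \<open>auto simp: dist_commute\<close>)
  qed
  then show ?thesis using that by blast
qed

text \<open>The Bowen supremum is unfolded into one bound valid on all of \<Omega>, so that windows
  can be translated and united freely. The bound \<open>c\<close> is strict because
  \<open>diam_lt\<close> is, and it may be negative on an empty fibre.\<close>

definition eps_map :: "'a::metric_space set \<Rightarrow> (int^'k \<Rightarrow> 'a \<Rightarrow> 'a) \<Rightarrow> (int^'k) set \<Rightarrow> real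
    \<Rightarrow> nat set set \<Rightarrow> ('a \<Rightarrow> nat \<Rightarrow> real) \<Rightarrow> bool" where
  "eps_map X T \<Omega> \<epsilon> S \<phi> \<longleftrightarrow> simplicial_complex S \<and> (\<forall>i. continuous_on X (\<lambda>x. \<phi> x i))
     \<and> \<phi> ` X \<subseteq> realization S
     \<and> (\<forall>p. \<exists>c<\<epsilon>. \<forall>x\<in>X. \<forall>y\<in>X. \<phi> x = p \<longrightarrow> \<phi> y = p \<longrightarrow> (\<forall>n\<in>\<Omega>. dist (T n x) (T n y) \<le> c))"

lemma eps_mapD:
  assumes "eps_map X T \<Omega> \<epsilon> S \<phi>"
  shows "simplicial_complex S" "continuous_on X (\<lambda>x. \<phi> x i)" "x \<in> X \<Longrightarrow> \<phi> x \<in> realization S"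
    "\<exists>c<\<epsilon>. \<forall>x\<in>X. \<forall>y\<in>X. \<phi> x = p \<longrightarrow> \<phi> y = p \<longrightarrow> (\<forall>n\<in>\<Omega>. dist (T n x) (T n y) \<le> c)"
  using assms unfolding eps_map_def by (elim conjE, blast)+

lemma eps_map_mono:
  assumes "eps_map X T \<Omega> \<epsilon> S \<phi>" "\<Omega>' \<subseteq> \<Omega>" "\<epsilon> \<le> \<epsilon>'"
  shows "eps_map X T \<Omega>' \<epsilon>' S \<phi>"
  unfolding eps_map_def
proof (intro conjI allI)
  fix p
  obtain c where "c < \<epsilon>" "\<forall>x\<in>X. \<forall>y\<in>X. \<phi> x = p \<longrightarrow> \<phi> y = p \<longrightarrow> (\<forall>n\<in>\<Omega>. dist (T n x) (T n y) \<le> c)"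
    using eps_mapD(4)[OF assms(1)] by blast
  then show "\<exists>c<\<epsilon>'. \<forall>x\<in>X. \<forall>y\<in>X. \<phi> x = p \<longrightarrow> \<phi> y = p \<longrightarrow> (\<forall>n\<in>\<Omega>'. dist (T n x) (T n y) \<le> c)"
    using assms(2,3) by (intro exI[of _ c]) auto
qed (use eps_mapD[OF assms(1)] in auto)

lemma eps_map_translate:
  assumes "dynsys X T" "eps_map X T \<Omega> \<epsilon> S \<phi>"
  shows "eps_map X T ((+) c ` \<Omega>) \<epsilon> S (\<lambda>x. \<phi> (T c x))"
  unfolding eps_map_def
proof (intro conjI allI)
  show "simplicial_complex S" using eps_mapD[OF assms(2)] by blast
  show "continuous_on X (\<lambda>x. \<phi> (T c x) i)" for i
    by (rule dynsys_cont_comp[OF assms(1) eps_mapD(2)[OF assms(2)]])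
  show "(\<lambda>x. \<phi> (T c x)) ` X \<subseteq> realization S"
    using eps_mapD(3)[OF assms(2)] dynsys_in[OF assms(1)] by blast
  fix p
  obtain d where d: "d < \<epsilon>" "\<forall>x\<in>X. \<forall>y\<in>X. \<phi> x = p \<longrightarrow> \<phi> y = p \<longrightarrow> (\<forall>n\<in>\<Omega>. dist (T n x) (T n y) \<le> d)"
    using eps_mapD(4)[OF assms(2)] by blast
  have "dist (T (c + n) x) (T (c + n) y) \<le> d" if "x \<in> X" "y \<in> X" "\<phi> (T c x) = p" "\<phi> (T c y) = p" "n \<in> \<Omega>" for x y n
  proof -
    have "dist (T n (T c x)) (T n (T c y)) \<le> d"
      using d(2) dynsys_in[OF assms(1)] that by blast
    then show ?thesis using dynsys_add[OF assms(1)] that(1,2) by (simp add: add.commute)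
  qed
  then show "\<exists>d<\<epsilon>. \<forall>x\<in>X. \<forall>y\<in>X. \<phi> (T c x) = p \<longrightarrow> \<phi> (T c y) = p
      \<longrightarrow> (\<forall>n\<in>(+) c ` \<Omega>. dist (T n x) (T n y) \<le> d)"
    using d(1) by (intro exI[of _ d]) blast
qed

text \<open>Because \<open>prod_point\<close> is injective, a nonempty fibre of the product map is
  an intersection of a fibre of each factor and inherits both diameter bounds. For a point outside
  the image any bound below \<epsilon> will do.\<close>

lemma eps_map_Un:
  assumes 1: "eps_map X T \<Omega>1 \<epsilon> S1 \<phi>1" and 2: "eps_map X T \<Omega>2 \<epsilon> S2 \<phi>2"
  shows "eps_map X T (\<Omega>1 \<union> \<Omega>2) \<epsilon> (chain_product S1 S2) (\<lambda>x. prod_point (\<phi>1 x) (\<phi>2 x))"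
  unfolding eps_map_def
proof (intro conjI allI)
  note S1 = eps_mapD(1)[OF 1] and S2 = eps_mapD(1)[OF 2]
  show "simplicial_complex (chain_product S1 S2)" by (rule simplicial_complex_chain_product[OF S1 S2])
  show "continuous_on X (\<lambda>x. prod_point (\<phi>1 x) (\<phi>2 x) i)" for i
    unfolding prod_point_def overlap_def psum_def
    by (intro continuous_intros eps_mapD(2)[OF 1] eps_mapD(2)[OF 2])
  show "(\<lambda>x. prod_point (\<phi>1 x) (\<phi>2 x)) ` X \<subseteq> realization (chain_product S1 S2)"
    using prod_point_realization[OF S1 S2] eps_mapD(3)[OF 1] eps_mapD(3)[OF 2] by blast
  fix p
  show "\<exists>c<\<epsilon>. \<forall>x\<in>X. \<forall>y\<in>X. prod_point (\<phi>1 x) (\<phi>2 x) = p \<longrightarrow> prod_point (\<phi>1 y) (\<phi>2 y) = p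
      \<longrightarrow> (\<forall>n\<in>\<Omega>1 \<union> \<Omega>2. dist (T n x) (T n y) \<le> c)"
  proof (cases "\<exists>x\<in>X. prod_point (\<phi>1 x) (\<phi>2 x) = p")
    case False
    then show ?thesis by (intro exI[of _ "\<epsilon> - 1"]) auto
  next
    case True
    then obtain z where z: "z \<in> X" "prod_point (\<phi>1 z) (\<phi>2 z) = p" by blast
    have eq: "\<phi>1 x = \<phi>1 z \<and> \<phi>2 x = \<phi>2 z" if "x \<in> X" "prod_point (\<phi>1 x) (\<phi>2 x) = p" for x
      using prod_point_inject[OF S1 S2] eps_mapD(3)[OF 1] eps_mapD(3)[OF 2] that z by metis
    obtain c1 where c1: "c1 < \<epsilon>" "\<forall>x\<in>X. \<forall>y\<in>X. \<phi>1 x = \<phi>1 z \<longrightarrow> \<phi>1 y = \<phi>1 z \<longrightarrow> (\<forall>n\<in>\<Omega>1. dist (T n x) (T n y) \<le> c1)"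
      using eps_mapD(4)[OF 1] by blast
    obtain c2 where c2: "c2 < \<epsilon>" "\<forall>x\<in>X. \<forall>y\<in>X. \<phi>2 x = \<phi>2 z \<longrightarrow> \<phi>2 y = \<phi>2 z \<longrightarrow> (\<forall>n\<in>\<Omega>2. dist (T n x) (T n y) \<le> c2)"
      using eps_mapD(4)[OF 2] by blast
    show ?thesis
    proof (intro exI[of _ "max c1 c2"] conjI ballI impI)
      show "max c1 c2 < \<epsilon>" using c1 c2 by simp
      fix x y n assume a: "x \<in> X" "y \<in> X" "prod_point (\<phi>1 x) (\<phi>2 x) = p" "prod_point (\<phi>1 y) (\<phi>2 y) = p"
        "n \<in> \<Omega>1 \<union> \<Omega>2"
      have "dist (T n x) (T n y) \<le> c1 \<or> dist (T n x) (T n y) \<le> c2"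
        using a(5) c1(2) c2(2) a(1,2) eq[OF a(1,3)] eq[OF a(2,4)] by blast
      then show "dist (T n x) (T n y) \<le> max c1 c2" by auto
    qed
  qed
qed

lemma eps_map_UN:
  assumes "dynsys X T" "finite C" "C \<noteq> {}" "eps_map X T \<Omega> \<epsilon> S \<phi>"
  shows "\<exists>S' \<phi>'. eps_map X T (\<Union>c\<in>C. (+) c ` \<Omega>) \<epsilon> S' \<phi>' \<and> sc_dim S' \<le> card C * sc_dim S"
  using assms(2,3)
proof (induction C rule: finite_ne_induct)
  case (singleton c)
  show ?case using eps_map_translate[OF assms(1,4), of c] by (intro exI conjI) auto
next
  case (insert c C)
  then obtain S' \<phi>' where IH: "eps_map X T (\<Union>c\<in>C. (+) c ` \<Omega>) \<epsilon> S' \<phi>'" "sc_dim S' \<le> card C * sc_dim S"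
    by blast
  have "sc_dim (chain_product S S') \<le> sc_dim S + sc_dim S'"
    using sc_dim_chain_product eps_mapD(1)[OF IH(1)] eps_mapD(1)[OF assms(4)] by blast
  also have "\<dots> \<le> card (insert c C) * sc_dim S" using IH(2) insert by simp
  finally show ?case
    using eps_map_Un[OF eps_map_translate[OF assms(1,4), of c] IH(1)] by auto
qed

lemma simplicial_complex_full: "simplicial_complex {\<sigma>. \<sigma> \<subseteq> {..<Suc J} \<and> \<sigma> \<noteq> {}}"
  unfolding simplicial_complex_def
proof (intro conjI ballI allI impI)
  show "{\<sigma>. \<sigma> \<subseteq> {..<Suc J} \<and> \<sigma> \<noteq> {}} \<noteq> {}" by auto
qed (auto intro: finite_subset)

text \<open>Without this the \<open>LEAST\<close> in \<open>widim\<close> could be a junk value. The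
  map is a normalized partition of unity for a finite cover by balls of radius \<delta>/2, into the
  full simplex: equal images share a positive coordinate, hence a ball. Empty \<open>X\<close> is
  separate because the list of centres must be nonempty.\<close>

lemma eps_map_exists:
  assumes "dynsys X T" "finite \<Omega>" "\<epsilon> > 0"
  shows "\<exists>S \<phi>. eps_map X T \<Omega> \<epsilon> S \<phi>"
proof (cases "X = {}")
  case True
  have "eps_map X T \<Omega> \<epsilon> {\<sigma>. \<sigma> \<subseteq> {..<Suc 0} \<and> \<sigma> \<noteq> {}} (\<lambda>_ _. 0)"
    unfolding eps_map_def using simplicial_complex_full[of 0] True
    by (auto intro!: exI[of _ "\<epsilon> - 1"])
  then show ?thesis by blast
next
  case False
  obtain \<delta> where \<delta>: "\<delta> > 0" "\<And>x y n. x \<in> X \<Longrightarrow> y \<in> X \<Longrightarrow> dist x y < \<delta> \<Longrightarrow> n \<in> \<Omega> \<Longrightarrow> dist (T n x) (T n y) < \<epsilon>/2"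
    using dynsys_uniform[OF assms(1,2), of "\<epsilon>/2"] assms(3) by auto
  have "\<exists>k. finite k \<and> X \<subseteq> (\<Union>x\<in>k. ball x (\<delta>/2))"
    using dynsys_compact[OF assms(1)] \<delta>(1) unfolding compact_eq_totally_bounded by simp
  then obtain k where k: "finite k" "X \<subseteq> (\<Union>x\<in>k. ball x (\<delta>/2))" by blast
  obtain xs where xs: "set xs = k" using k(1) finite_list by blast
  have "xs \<noteq> []" using xs k False by auto
  then obtain J where J: "length xs = Suc J" by (cases xs) auto
  define \<beta> where "\<beta> x i = (if i < Suc J then max 0 (\<delta>/2 - dist x (xs ! i)) else 0)" for x i
  define \<Sigma> where "\<Sigma> x = (\<Sum>i<Suc J. \<beta> x i)" for x
  define \<phi> where "\<phi> x i = \<beta> x i / \<Sigma> x" for x i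
  have \<beta>0: "\<beta> x i \<ge> 0" for x i by (simp add: \<beta>_def)
  have \<Sigma>pos: "\<Sigma> x > 0" if x: "x \<in> X" for x
  proof -
    obtain z where "z \<in> k" "dist z x < \<delta>/2" using k(2) x by auto
    then obtain i where i: "i < Suc J" "dist x (xs ! i) < \<delta>/2"
      using xs J by (metis dist_commute in_set_conv_nth)
    have "0 < \<beta> x i" using i by (simp add: \<beta>_def)
    also have "\<beta> x i \<le> \<Sigma> x" unfolding \<Sigma>_def using i \<beta>0 by (intro member_le_sum) auto
    finally show ?thesis .
  qed
  have cont\<beta>: "continuous_on X (\<lambda>x. \<beta> x i)" for i
    unfolding \<beta>_def by (cases "i < Suc J") (auto intro!: continuous_intros)
  define S where "S = {\<sigma>. \<sigma> \<subseteq> {..<Suc J} \<and> \<sigma> \<noteq> {}}"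
  have "eps_map X T \<Omega> \<epsilon> S \<phi>"
    unfolding eps_map_def
  proof (intro conjI allI)
    show "simplicial_complex S" unfolding S_def by (rule simplicial_complex_full)
    show "continuous_on X (\<lambda>x. \<phi> x i)" for i
      unfolding \<phi>_def using \<Sigma>pos unfolding \<Sigma>_def
      by (intro continuous_intros cont\<beta>) (metis less_irrefl)
    show "\<phi> ` X \<subseteq> realization S"
    proof
      fix p assume "p \<in> \<phi> ` X"
      then obtain x where x: "x \<in> X" "p = \<phi> x" by blast
      have sum1: "sum p {..<Suc J} = 1"
      proof -
        have "sum p {..<Suc J} = (\<Sum>i<Suc J. \<beta> x i / \<Sigma> x)" by (intro sum.cong) (simp_all only: x(2) \<phi>_def)
        also have "\<dots> = \<Sigma> x / \<Sigma> x" by (simp only: sum_divide_distrib[symmetric] \<Sigma>_def)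
        finally show ?thesis using \<Sigma>pos[OF x(1)] by simp
      qed
      have "{i. p i \<noteq> 0} \<subseteq> {..<Suc J}" by (auto simp: x(2) \<phi>_def \<beta>_def split: if_splits)
      moreover have "{i. p i \<noteq> 0} \<noteq> {}" using sum1 by (metis (mono_tags, lifting) Collect_empty_eq sum.neutral zero_neq_one)
      moreover have "\<Union>S \<subseteq> {..<Suc J}" unfolding S_def by blast
      moreover have "\<forall>i. 0 \<le> p i" using \<Sigma>pos[OF x(1)] \<beta>0 by (simp add: x(2) \<phi>_def)
      ultimately show "p \<in> realization S" using sum1 unfolding S_def by (subst realization_iff) auto
    qed
    fix p
    show "\<exists>c<\<epsilon>. \<forall>x\<in>X. \<forall>y\<in>X. \<phi> x = p \<longrightarrow> \<phi> y = p \<longrightarrow> (\<forall>n\<in>\<Omega>. dist (T n x) (T n y) \<le> c)"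
    proof (intro exI[of _ "\<epsilon>/2"] conjI ballI impI)
      fix x y n assume a: "x \<in> X" "y \<in> X" "\<phi> x = p" "\<phi> y = p" "n \<in> \<Omega>"
      have "\<exists>i<Suc J. \<beta> x i > 0"
      proof (rule ccontr)
        assume "\<not> (\<exists>i<Suc J. \<beta> x i > 0)"
        then have "\<Sigma> x \<le> 0" unfolding \<Sigma>_def by (intro sum_nonpos) auto
        then show False using \<Sigma>pos[OF a(1)] by simp
      qed
      then obtain i where i: "i < Suc J" "\<beta> x i > 0" by blast
      have "\<phi> x i = \<phi> y i" using a by simp
      moreover have "\<phi> x i > 0" using i \<Sigma>pos[OF a(1)] by (simp add: \<phi>_def)
      ultimately have "\<beta> y i > 0"
        using \<Sigma>pos[OF a(2)] by (simp add: \<phi>_def zero_less_divide_iff)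
      then have "dist y (xs ! i) < \<delta>/2" using i by (simp add: \<beta>_def split: if_splits)
      moreover have "dist x (xs ! i) < \<delta>/2" using i by (simp add: \<beta>_def split: if_splits)
      ultimately have "dist x y < \<delta>" by (metis dist_commute dist_triangle_half_l)
      then show "dist (T n x) (T n y) \<le> \<epsilon>/2" using \<delta>(2) a by (meson less_imp_le)
    qed (use assms(3) in auto)
  qed
  then show ?thesis by blast
qed

text \<open>Bowen metrics over a nonempty finite window induce the original topology: one direction
  is uniform continuity of finitely many \<open>T n\<close>, the other uses that the window contains
  0.\<close>

lemma rho_continuous_bowen:
  fixes T :: "int^'k \<Rightarrow> 'a::metric_space \<Rightarrow> 'a"
  assumes "dynsys X T" "N \<ge> 1"
  shows "rho_continuous X (bowen T dist (cube N)) g \<longleftrightarrow> continuous_on X g"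
proof
  assume L: "rho_continuous X (bowen T dist (cube N)) g"
  show "continuous_on X g"
    unfolding continuous_on_iff
  proof (intro ballI allI impI)
    fix x and e :: real assume x: "x \<in> X" "e > 0"
    then obtain d where d: "d > 0" "\<forall>y\<in>X. bowen T dist (cube N) x y < d \<longrightarrow> \<bar>g y - g x\<bar> < e"
      using L unfolding rho_continuous_def by meson
    obtain d' where d': "d' > 0" "\<And>x y n. x \<in> X \<Longrightarrow> y \<in> X \<Longrightarrow> dist x y < d' \<Longrightarrow> n \<in> cube N \<Longrightarrow> dist (T n x) (T n y) < d"
      using dynsys_uniform[OF assms(1) finite_cube d(1)] by metis
    show "\<exists>d>0. \<forall>x'\<in>X. dist x' x < d \<longrightarrow> dist (g x') (g x) < e"
    proof (intro exI[of _ d'] conjI ballI impI)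
      fix y assume y: "y \<in> X" "dist y x < d'"
      have "bowen T dist (cube N) x y < d"
        using d'(2) x y cube_nonempty[OF assms(2)] by (subst bowen_less_iff) (auto simp: dist_commute)
      then show "dist (g y) (g x) < e" using d(2) y by (simp add: dist_real_def)
    qed (rule d'(1))
  qed
next
  assume R: "continuous_on X g"
  show "rho_continuous X (bowen T dist (cube N)) g"
    unfolding rho_continuous_def
  proof (intro ballI allI impI)
    fix x and e :: real assume x: "x \<in> X" "e > 0"
    then obtain d where d: "d > 0" "\<forall>y\<in>X. dist y x < d \<longrightarrow> dist (g y) (g x) < e"
      using R unfolding continuous_on_iff by meson
    show "\<exists>\<delta>>0. \<forall>y\<in>X. bowen T dist (cube N) x y < \<delta> \<longrightarrow> \<bar>g y - g x\<bar> < e"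
    proof (intro exI[of _ d] conjI ballI impI)
      fix y assume y: "y \<in> X" "bowen T dist (cube N) x y < d"
      have "dist (T 0 x) (T 0 y) < d"
        using y cube_nonempty[OF assms(2)] zero_in_cube[OF assms(2)] by (subst (asm) bowen_less_iff) auto
      then show "\<bar>g y - g x\<bar> < e"
        using d x y dynsys_0[OF assms(1)] by (simp add: dist_real_def dist_commute)
    qed (rule d(1))
  qed
qed

lemma widim_eq:
  fixes T :: "int^'k \<Rightarrow> 'a::metric_space \<Rightarrow> 'a"
  assumes "dynsys X T" "N \<ge> 1"
  shows "widim X \<epsilon> (bowen T dist (cube N)) = (LEAST n. \<exists>S \<phi>. eps_map X T (cube N) \<epsilon> S \<phi> \<and> sc_dim S = n)"
proof -
  have "diam_lt (bowen T dist (cube N)) {x\<in>X. \<phi> x = p} \<epsilon> \<longleftrightarrow>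
     (\<exists>c<\<epsilon>. \<forall>x\<in>X. \<forall>y\<in>X. \<phi> x = p \<longrightarrow> \<phi> y = p \<longrightarrow> (\<forall>n\<in>cube N. dist (T n x) (T n y) \<le> c))" for \<phi> :: "'a \<Rightarrow> nat \<Rightarrow> real" and p
    unfolding diam_lt_bowen[OF finite_cube cube_nonempty[OF assms(2)]]
    by (intro arg_cong[where f = Ex] ext conj_cong refl) blast
  then show ?thesis
    unfolding widim_def eps_map_def rho_continuous_bowen[OF assms] by (simp only: conj_ac)
qed

lemma widim_attained:
  fixes T :: "int^'k \<Rightarrow> 'a::metric_space \<Rightarrow> 'a"
  assumes "dynsys X T" "N \<ge> 1" "\<epsilon> > 0"
  shows "\<exists>S \<phi>. eps_map X T (cube N) \<epsilon> S \<phi> \<and> sc_dim S = widim X \<epsilon> (bowen T dist (cube N))"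
  unfolding widim_eq[OF assms(1,2)]
  by (rule LeastI_ex) (use eps_map_exists[OF assms(1) finite_cube assms(3)] in blast)

lemma widim_le:
  fixes T :: "int^'k \<Rightarrow> 'a::metric_space \<Rightarrow> 'a"
  assumes "dynsys X T" "N \<ge> 1" "eps_map X T (cube N) \<epsilon> S \<phi>"
  shows "widim X \<epsilon> (bowen T dist (cube N)) \<le> sc_dim S"
  unfolding widim_eq[OF assms(1,2)] by (rule Least_le) (use assms(3) in blast)

text \<open>The product of the translated maps over the blocks of \<open>cube_cover\<close> is an
  \<epsilon>-map for the large cube, and dimensions add along products.\<close>

lemma widim_subadditive:
  fixes T :: "int^'k \<Rightarrow> 'a::metric_space \<Rightarrow> 'a"
  assumes "dynsys X T" "\<epsilon> > 0" "N \<ge> 1" "L \<ge> 1"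
  shows "real (widim X \<epsilon> (bowen T dist (cube L)))
     \<le> real (L div N + 1) ^ CARD('k) * real (widim X \<epsilon> (bowen T dist (cube N)))"
proof -
  obtain S \<phi> where S: "eps_map X T (cube N) \<epsilon> S \<phi>" "sc_dim S = widim X \<epsilon> (bowen T dist (cube N))"
    using widim_attained[OF assms(1,3,2)] by blast
  define C :: "(int^'k) set" where "C = zscale N ` cube (L div N + 1)"
  have C: "finite C" "C \<noteq> {}" unfolding C_def using cube_nonempty[of "L div N + 1"] by auto
  have "card C \<le> card (cube (L div N + 1) :: (int^'k) set)" unfolding C_def by (rule card_image_le) simp
  then have cC: "card C \<le> (L div N + 1) ^ CARD('k)" by (simp only: card_cube)
  obtain S' \<phi>' where S': "eps_map X T (\<Union>c\<in>C. (+) c ` cube N) \<epsilon> S' \<phi>'" "sc_dim S' \<le> card C * sc_dim S"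
    using eps_map_UN[OF assms(1) C S(1)] by blast
  have "cube L \<subseteq> (\<Union>c\<in>C. (+) c ` cube N)" using cube_cover[OF assms(3), of L] unfolding C_def by simp
  then have "eps_map X T (cube L) \<epsilon> S' \<phi>'" using eps_map_mono[OF S'(1)] by blast
  then have "widim X \<epsilon> (bowen T dist (cube L)) \<le> sc_dim S'" by (rule widim_le[OF assms(1,4)])
  also have "\<dots> \<le> card C * sc_dim S" by (rule S'(2))
  also have "\<dots> \<le> (L div N + 1) ^ CARD('k) * sc_dim S" using cC by (rule mult_right_mono) simp
  finally show ?thesis unfolding S(2) by (metis of_nat_le_iff of_nat_mult of_nat_power)
qed

text \<open>The inner limit exists by subadditivity and grows as \<epsilon> shrinks, so the outer
  \<open>Lim\<close> is a supremum. Consequently every \<epsilon>, however small, has a cube whose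
  complex has dimension below \<open>D\<close> per site.\<close>

lemma mdim_properties:
  fixes T :: "int^'k \<Rightarrow> 'a::metric_space \<Rightarrow> 'a"
  assumes "dynsys X T"
  shows "0 \<le> mdim T X dist"
    and "\<epsilon> > 0 \<Longrightarrow> mdim T X dist < ereal D \<Longrightarrow>
       \<exists>N\<ge>1. \<exists>S \<phi>. eps_map X T (cube N) \<epsilon> S \<phi> \<and> real (sc_dim S) < D * real N ^ CARD('k)"
proof -
  define a where "a \<epsilon> N = real (widim X \<epsilon> (bowen T dist (cube N)))" for \<epsilon> N
  have "\<exists>l\<ge>0. (\<lambda>N. a \<epsilon> N / real N ^ CARD('k)) \<longlonglongrightarrow> l \<and> (\<forall>N\<ge>1. l \<le> a \<epsilon> N / real N ^ CARD('k))" if "\<epsilon> > 0" for \<epsilon>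
    by (rule subadditive_cubes) (use widim_subadditive[OF assms that] in \<open>auto simp: a_def\<close>)
  then obtain l where l: "\<And>\<epsilon>. \<epsilon> > 0 \<Longrightarrow> l \<epsilon> \<ge> 0"
      "\<And>\<epsilon>. \<epsilon> > 0 \<Longrightarrow> (\<lambda>N. a \<epsilon> N / real N ^ CARD('k)) \<longlonglongrightarrow> l \<epsilon>" by metis
  define F where "F = (\<lambda>\<epsilon>. ereal (lim (\<lambda>N. a \<epsilon> N / real N ^ CARD('k))))"
  have F: "F \<epsilon> = ereal (l \<epsilon>)" if "\<epsilon> > 0" for \<epsilon> using limI[OF l(2)[OF that]] by (simp add: F_def)
  have anti: "l \<epsilon>' \<le> l \<epsilon>" if "0 < \<epsilon>" "\<epsilon> \<le> \<epsilon>'" for \<epsilon> \<epsilon>'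
  proof (rule LIMSEQ_le[OF l(2) l(2)])
    have "a \<epsilon>' N / real N ^ CARD('k) \<le> a \<epsilon> N / real N ^ CARD('k)" if N: "N \<ge> 1" for N
    proof -
      obtain S \<phi> where S: "eps_map X T (cube N) \<epsilon> S \<phi>" "sc_dim S = widim X \<epsilon> (bowen T dist (cube N))"
        using widim_attained[OF assms N] \<open>0 < \<epsilon>\<close> by blast
      have "eps_map X T (cube N) \<epsilon>' S \<phi>" by (rule eps_map_mono[OF S(1) order_refl \<open>\<epsilon> \<le> \<epsilon>'\<close>])
      then have "a \<epsilon>' N \<le> a \<epsilon> N" unfolding a_def S(2)[symmetric] using widim_le[OF assms N] by simp
      then show ?thesis by (rule divide_right_mono) simp
    qed
    then show "\<exists>N. \<forall>n\<ge>N. a \<epsilon>' n / real n ^ CARD('k) \<le> a \<epsilon> n / real n ^ CARD('k)" by blast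
  qed (use that in auto)
  define s where "s = (SUP \<epsilon>\<in>{0<..}. F \<epsilon>)"
  have le_s: "F \<epsilon> \<le> s" if "\<epsilon> > 0" for \<epsilon> unfolding s_def using that by (intro SUP_upper) auto
  have "(F \<longlongrightarrow> s) (at_right 0)"
  proof (rule order_tendstoI)
    fix y assume "y < s"
    then obtain e where e: "e > 0" "y < F e" unfolding s_def less_SUP_iff by auto
    have "y < F \<epsilon>" if "0 < \<epsilon>" "\<epsilon> < e" for \<epsilon>
      using e(2) anti[of \<epsilon> e] that F[of \<epsilon>] F[of e] by (metis dual_order.strict_trans1 ereal_less_eq(3) less_le_not_le less_trans)
    then show "eventually (\<lambda>\<epsilon>. y < F \<epsilon>) (at_right 0)"
      unfolding eventually_at_right_field using e(1) by blast
  next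
    fix y assume "s < y"
    then have "F \<epsilon> < y" if "0 < \<epsilon>" for \<epsilon> using le_s[OF that] by simp
    then show "eventually (\<lambda>\<epsilon>. F \<epsilon> < y) (at_right 0)"
      unfolding eventually_at_right_field by (intro exI[of _ 1]) auto
  qed
  then have "Lim (at_right 0) F = s" by (intro tendsto_Lim) simp_all
  then have s: "mdim T X dist = s" unfolding mdim_def F_def a_def .
  show "0 \<le> mdim T X dist"
    using le_s[of 1] F[of 1] l(1)[of 1] unfolding s by (metis ereal_less_eq(5) order_trans zero_less_one)
  show "\<exists>N\<ge>1. \<exists>S \<phi>. eps_map X T (cube N) \<epsilon> S \<phi> \<and> real (sc_dim S) < D * real N ^ CARD('k)"
    if e: "\<epsilon> > 0" and D: "mdim T X dist < ereal D"
  proof -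
    have "F \<epsilon> < ereal D" using le_s[OF e] D unfolding s by (rule order_le_less_trans)
    then have "l \<epsilon> < D" using F[OF e] by simp
    then have "eventually (\<lambda>N. a \<epsilon> N / real N ^ CARD('k) < D) sequentially"
      by (rule order_tendstoD(2)[OF l(2)[OF e]])
    then obtain N where N: "N \<ge> 1" "a \<epsilon> N / real N ^ CARD('k) < D"
      unfolding eventually_sequentially by (metis le_add1 le_add2)
    have "a \<epsilon> N < D * real N ^ CARD('k)" using N by (simp add: divide_less_eq)
    then show ?thesis using widim_attained[OF assms N(1) e] N(1) unfolding a_def by metis
  qed
qed

section \<open>Tilings from power diagrams\<close>

definition rv :: "int^'k \<Rightarrow> real^'k" where
  "rv n = (\<chi> i. real_of_int (n$i))"

lemma rv_nth [simp]: "rv n $ i = real_of_int (n$i)"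
  by (simp add: rv_def)

lemma rv_add: "rv (m + n) = rv m + rv n" and rv_diff: "rv (m - n) = rv m - rv n"
  by (simp_all add: vec_eq_iff)

lemma finite_int_box: "finite {n::int^'k. \<forall>i. lo i \<le> n$i \<and> n$i \<le> hi i}"
proof (rule finite_subset)
  show "{n::int^'k. \<forall>i. lo i \<le> n$i \<and> n$i \<le> hi i} \<subseteq> vec_lambda ` (PiE UNIV (\<lambda>i. {lo i..hi i}))"
  proof
    fix n :: "int^'k" assume "n \<in> {n. \<forall>i. lo i \<le> n$i \<and> n$i \<le> hi i}"
    then show "n \<in> vec_lambda ` (PiE UNIV (\<lambda>i. {lo i..hi i}))"
      by (intro image_eqI[of _ _ "vec_nth n"]) auto
  qed
  show "finite (vec_lambda ` (PiE UNIV (\<lambda>i::'k. {lo i..hi i})))"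
    by (intro finite_imageI finite_PiE) auto
qed

lemma finite_rv_ball: "finite {n::int^'k. norm (p - rv n) \<le> R}"
proof (rule finite_subset[OF _ finite_int_box])
  show "{n. norm (p - rv n) \<le> R} \<subseteq> {n::int^'k. \<forall>i. \<lfloor>p$i - R\<rfloor> \<le> n$i \<and> n$i \<le> \<lceil>p$i + R\<rceil>}"
  proof (intro subsetI CollectI allI)
    fix n :: "int^'k" and i assume "n \<in> {n. norm (p - rv n) \<le> R}"
    then have "\<bar>p$i - real_of_int (n$i)\<bar> \<le> R"
      using component_le_norm_cart[of "p - rv n" i] by simp
    then have "p$i - R \<le> real_of_int (n$i)" "real_of_int (n$i) \<le> p$i + R" by linarith+
    then show "\<lfloor>p$i - R\<rfloor> \<le> n$i \<and> n$i \<le> \<lceil>p$i + R\<rceil>" by linarith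
  qed
qed

lemma finite_rv_ball0: "finite {n::int^'k. norm (rv n) \<le> R}"
  using finite_rv_ball[of 0 R] by simp

lemma norm_le_card:
  fixes x :: "real^'k"
  assumes "\<And>i. \<bar>x$i\<bar> \<le> c"
  shows "norm x \<le> real CARD('k) * c"
proof -
  have "norm x \<le> (\<Sum>i\<in>UNIV. \<bar>x$i\<bar>)" by (rule norm_le_l1_cart)
  also have "\<dots> \<le> (\<Sum>i\<in>(UNIV::'k set). c)" by (intro sum_mono assms)
  finally show ?thesis by simp
qed

text \<open>If \<open>c\<close> is the nearest centre of \<open>p\<close> for the weights \<open>w\<close>, then moving \<open>p\<close> towards \<open>c\<close> by a factor
  \<open>1 - s\<close> leaves a quantitative gap for the weights \<open>(1 - s) w\<close>. So the points well inside the cells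
  of the scaled diagram have density at least \<open>(1 - s)\<^sup>k\<close>.\<close>

lemma power_diagram_gap:
  fixes p c c' v :: "'e::real_inner"
  assumes s: "0 \<le> s" "s \<le> 1"
    and min: "(norm (p - c))\<^sup>2 + w \<le> (norm (p - c'))\<^sup>2 + w'"
    and v: "norm (v - ((1 - s) *\<^sub>R p + s *\<^sub>R c)) \<le> \<rho>"
  shows "(norm (v - c))\<^sup>2 + (1 - s) * w + norm (c - c') * (s * norm (c - c') - 2 * \<rho>)
     \<le> (norm (v - c'))\<^sup>2 + (1 - s) * w'"
proof -
  define P where "P = p - c"
  define d where "d = c - c'"
  define e where "e = v - ((1 - s) *\<^sub>R p + s *\<^sub>R c)"
  have eqs: "v - c = e + (1 - s) *\<^sub>R P" "v - c' = (e + (1 - s) *\<^sub>R P) + d" "p - c' = P + d"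
    by (simp_all add: e_def P_def d_def algebra_simps)
  have sq: "(norm (a + d))\<^sup>2 = (norm a)\<^sup>2 + 2 * (a \<bullet> d) + (norm d)\<^sup>2" for a
    by (simp add: power2_norm_eq_inner inner_simps inner_commute)
  have "w - w' \<le> 2 * (P \<bullet> d) + (norm d)\<^sup>2"
    using min unfolding eqs(3) sq P_def[symmetric] by linarith
  then have "(1 - s) * (w - w') \<le> (1 - s) * (2 * (P \<bullet> d) + (norm d)\<^sup>2)"
    using s by (intro mult_left_mono) auto
  moreover have "\<bar>e \<bullet> d\<bar> \<le> \<rho> * norm d"
    using Cauchy_Schwarz_ineq2[of e d] v mult_right_mono[of "norm e" \<rho> "norm d"] unfolding e_def by fastforce
  moreover have "(norm (v - c'))\<^sup>2 = (norm (v - c))\<^sup>2 + 2 * (e \<bullet> d) + 2 * (1 - s) * (P \<bullet> d) + (norm d)\<^sup>2"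
    unfolding eqs sq by (simp add: inner_simps algebra_simps)
  ultimately show ?thesis
    unfolding d_def[symmetric] by (simp add: algebra_simps power2_eq_square)
qed

text \<open>The weight \<open>u\<close> is a continuous cut-off for the marker set:
  \<open>u < 1\<close> exactly on \<open>U\<close> within \<open>X\<close>, so positions with
  \<open>u < 1\<close> are far apart. Compactness turns the covering of \<open>X\<close> by
  translates of \<open>U\<close> into a radius \<open>R\<close> within which every orbit has a
  position of weight 0.\<close>

lemma marker_weight:
  fixes T :: "int^'k \<Rightarrow> 'a::metric_space \<Rightarrow> 'a"
  assumes dyn: "dynsys X T" and mark: "marker_property X T"
  shows "\<exists>(u::'a \<Rightarrow> real) (R::real). continuous_on X u \<and> (\<forall>x. 0 \<le> u x \<and> u x \<le> 1) \<and>
    (\<forall>x\<in>X. \<forall>n n'. n \<noteq> n' \<longrightarrow> u (T n x) < 1 \<longrightarrow> u (T n' x) < 1 \<longrightarrow> (\<exists>i. int M < \<bar>n$i - n'$i\<bar>)) \<and>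
    R \<ge> 0 \<and> (\<forall>x\<in>X. \<exists>n. norm (rv n) \<le> R \<and> u (T n x) = 0)"
proof -
  define F where "F = {n::int^'k. \<forall>i. - int M \<le> n$i \<and> n$i \<le> int M}"
  have "finite F" unfolding F_def by (rule finite_int_box)
  then obtain U where U: "openin (top_of_set X) U" "X = (\<Union>n. T n ` U)"
      "\<And>n. n \<in> F \<Longrightarrow> n \<noteq> 0 \<Longrightarrow> U \<inter> T n ` U = {}"
    using mark unfolding marker_property_def by meson
  have UX: "U \<subseteq> X" using U(1) by (rule openin_imp_subset)
  have "closedin (top_of_set X) (X - U)" using U(1) by (simp add: closedin_diff)
  then have cl: "closed (X - U)"
    using closedin_closed_trans compact_imp_closed[OF dynsys_compact[OF dyn]] by blast
  define v where "v x = (if X - U = {} then 1 else infdist x (X - U))" for x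
  have vcont: "continuous_on X v"
    unfolding v_def by (cases "X - U = {}") (auto intro!: continuous_intros)
  have v0: "v x \<ge> 0" for x by (simp add: v_def infdist_nonneg)
  have vpos: "v x > 0 \<longleftrightarrow> x \<in> U" if "x \<in> X" for x
    using in_closed_iff_infdist_zero[OF cl, of x] that infdist_nonneg[of x "X - U"] unfolding v_def
    by (cases "X - U = {}") auto
  \<comment> \<open>These open sets cover \<open>X\<close>, as every orbit enters \<open>U\<close>
    and there \<open>v\<close> exceeds some 1/(j+1). A finite subcover bounds both the lattice
    positions and the threshold.\<close>
  define Q where "Q = (\<lambda>(n, j::nat). {x\<in>X. 1 / real (Suc j) < v (T n x)})"
  have Qopen: "openin (top_of_set X) (Q nj)" for nj
  proof -
    have "openin (top_of_set X) (X \<inter> (\<lambda>x. v (T (fst nj) x)) -` {1 / real (Suc (snd nj)) <..})"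
      by (rule continuous_openin_preimage_gen[OF dynsys_cont_comp[OF dyn vcont]]) simp
    moreover have "Q nj = X \<inter> (\<lambda>x. v (T (fst nj) x)) -` {1 / real (Suc (snd nj)) <..}"
      by (auto simp: Q_def case_prod_unfold)
    ultimately show ?thesis by simp
  qed
  have "X \<subseteq> \<Union>(range Q)"
  proof
    fix x assume x: "x \<in> X"
    obtain n y where y: "y \<in> U" "x = T n y" using U(2) x by blast
    have "T (- n) x = y" using y UX dynsys_add[OF dyn, of y "- n" n] dynsys_0[OF dyn] by auto
    then have "v (T (- n) x) > 0" using y UX vpos by auto
    then obtain j where "1 / real (Suc j) < v (T (- n) x)"
      using reals_Archimedean by (metis inverse_eq_divide)
    then have "x \<in> Q (- n, j)" using x by (simp add: Q_def)
    then show "x \<in> \<Union>(range Q)" by blast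
  qed
  then have "\<exists>D. D \<subseteq> range Q \<and> finite D \<and> X \<subseteq> \<Union>D"
    using dynsys_compact[OF dyn] Qopen unfolding compact_eq_openin_cover by (metis (no_types, lifting) rangeE)
  then obtain D where D: "D \<subseteq> range Q" "finite D" "X \<subseteq> \<Union>D" by blast
  obtain P where P: "finite P" "D = Q ` P" using finite_subset_image[OF D(2,1)] by blast
  obtain J where J: "\<And>nj. nj \<in> P \<Longrightarrow> snd nj \<le> J"
    using P(1) by (metis Max_ge finite_imageI imageI)
  define \<kappa> where "\<kappa> = 1 / real (Suc J)"
  define R where "R = (\<Sum>nj\<in>P. norm (rv (fst nj)))"
  \<comment> \<open>With \<kappa> the smallest threshold of the subcover, \<open>u\<close> is
    already 0 at the position that the subcover supplies.\<close>
  define u where "u x = max 0 (1 - v x / \<kappa>)" for x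
  have \<kappa>: "\<kappa> > 0" by (simp add: \<kappa>_def)
  show ?thesis
  proof (intro exI[of _ u] exI[of _ R] conjI ballI allI impI)
    show "continuous_on X u" unfolding u_def using \<kappa> by (intro continuous_intros vcont) auto
    show "0 \<le> u x" "u x \<le> 1" for x using \<kappa> v0[of x] by (auto simp: u_def)
    show "R \<ge> 0" unfolding R_def by (simp add: sum_nonneg)
    fix x assume x: "x \<in> X"
    show "\<exists>n. norm (rv n) \<le> R \<and> u (T n x) = 0"
    proof -
      obtain n j where nj: "(n, j) \<in> P" "x \<in> Q (n, j)" using D(3) x P(2) by auto
      have "\<kappa> \<le> 1 / real (Suc j)" unfolding \<kappa>_def using J[OF nj(1)] by (intro divide_left_mono) auto
      also have "\<dots> < v (T n x)" using nj(2) by (simp add: Q_def)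
      finally have "u (T n x) = 0" using \<kappa> by (simp add: u_def field_simps)
      moreover have "norm (rv (fst (n, j))) \<le> R"
        unfolding R_def by (rule member_le_sum[OF nj(1)]) (auto simp: P(1))
      ultimately show ?thesis by auto
    qed
    fix n n' assume n: "n \<noteq> n'" "u (T n x) < 1" "u (T n' x) < 1"
    have "v (T n x) > 0" "v (T n' x) > 0"
      using n v0[of "T n x"] v0[of "T n' x"] \<kappa> by (auto simp: u_def field_simps less_le split: if_splits)
    then have in_U: "T n x \<in> U" "T n' x \<in> U" using vpos dynsys_in[OF dyn x] by auto
    have "T n x = T (n - n') (T n' x)" using dynsys_add[OF dyn x] by simp
    then have "U \<inter> T (n - n') ` U \<noteq> {}" using in_U by blast
    then have "n - n' \<notin> F" using U(3)[of "n - n'"] n(1) by auto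
    then show "\<exists>i. int M < \<bar>n$i - n'$i\<bar>" unfolding F_def by (auto simp: not_le) (metis abs_ge_self abs_minus_cancel le_less_trans not_less neg_less_iff_less minus_diff_eq abs_ge_minus_self linorder_not_le)+
  qed
qed

section \<open>Closed equivariant families of cubes inside the cells\<close>

definition cell_cost :: "('a \<Rightarrow> real) \<Rightarrow> (int^'k \<Rightarrow> 'a \<Rightarrow> 'a) \<Rightarrow> real \<Rightarrow> 'a \<Rightarrow> (int^'k) \<Rightarrow> (int^'k) \<Rightarrow> real" where
  "cell_cost u T \<Lambda> x v c = (norm (rv v - rv c))\<^sup>2 + \<Lambda> * u (T c x)"

text \<open>Points \<open>y\<close> such that the cube at the origin belongs to the cell of the site
  \<open>n\<close> and is aligned with the grid of mesh \<open>N\<close> through \<open>n\<close>.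
  Demanding the margin 1 and \<open>u \<le> \<theta>\<close>, instead of strict inequalities, makes
  the set closed; \<theta> will be below 1, so \<open>n\<close> is a genuine marker. Sites with
  \<open>u = 1\<close> do not compete.\<close>

definition tile_set :: "'a set \<Rightarrow> (int^'k \<Rightarrow> 'a \<Rightarrow> 'a) \<Rightarrow> ('a \<Rightarrow> real) \<Rightarrow> nat \<Rightarrow> real \<Rightarrow> real \<Rightarrow> int^'k \<Rightarrow> 'a set" where
  "tile_set X T u N \<theta> \<Lambda> n = {y\<in>X. (\<forall>i. int N dvd n$i) \<and> u (T n y) \<le> \<theta> \<and>
     (\<forall>n'. n' \<noteq> n \<longrightarrow> 1 \<le> u (T n' y) \<or> (\<forall>v\<in>cube N. cell_cost u T \<Lambda> y v n + 1 \<le> cell_cost u T \<Lambda> y v n'))}"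

lemma closed_tile_set:
  fixes T :: "int^'k \<Rightarrow> 'a::metric_space \<Rightarrow> 'a"
  assumes dyn: "dynsys X T" and u: "continuous_on X u"
  shows "closed (tile_set X T u N \<theta> \<Lambda> n)"
proof (cases "\<forall>i. int N dvd n$i")
  case False
  then have "tile_set X T u N \<theta> \<Lambda> n = {}" unfolding tile_set_def by blast
  then show ?thesis by simp
next
  case True
  have X: "closed X" by (rule compact_imp_closed[OF dynsys_compact[OF dyn]])
  have cu: "continuous_on X (\<lambda>y. u (T m y))" for m by (rule dynsys_cont_comp[OF dyn u])
  \<comment> \<open>The set \<open>{y\<in>X. 0 \<le> (0::real)}\<close> is \<open>X\<close> itself,
    written in the shape of a closed comparison set so that one rule treats all constituents; it
    keeps the intersection inside \<open>X\<close>.\<close>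
  have "tile_set X T u N \<theta> \<Lambda> n = {y\<in>X. u (T n y) \<le> \<theta>} \<inter> (\<Inter>n'\<in>-{n}. {y\<in>X. 1 \<le> u (T n' y)} \<union>
      ({y\<in>X. 0 \<le> (0::real)} \<inter> (\<Inter>v\<in>cube N. {y\<in>X. cell_cost u T \<Lambda> y v n + 1 \<le> cell_cost u T \<Lambda> y v n'})))"
    using True unfolding tile_set_def by auto
  also have "closed \<dots>"
    unfolding cell_cost_def
    by (intro closed_Int closed_INT closed_Un ballI continuous_on_closed_Collect_le continuous_intros cu X)
  finally show ?thesis .
qed

text \<open>The cost is covariant under translation, so membership of \<open>T a x\<close> becomes a
  statement about the orbit of \<open>x\<close>: the cube at \<open>a\<close> lies in the cell of
  the site \<open>n + a\<close>.\<close>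

lemma tile_setD:
  fixes T :: "int^'k \<Rightarrow> 'a::metric_space \<Rightarrow> 'a"
  assumes dyn: "dynsys X T" and x: "x \<in> X" and t: "T a x \<in> tile_set X T u N \<theta> \<Lambda> n"
  shows "int N dvd n$i" "u (T (n + a) x) \<le> \<theta>"
    "c' \<noteq> n + a \<Longrightarrow> u (T c' x) < 1 \<Longrightarrow> m - a \<in> cube N \<Longrightarrow> cell_cost u T \<Lambda> x m (n + a) + 1 \<le> cell_cost u T \<Lambda> x m c'"
proof -
  have tr: "cell_cost u T \<Lambda> (T a x) (m - a) (c - a) = cell_cost u T \<Lambda> x m c" for c m
    using dynsys_add[OF dyn x] by (simp add: cell_cost_def rv_diff)
  show "int N dvd n$i" "u (T (n + a) x) \<le> \<theta>"
    using t dynsys_add[OF dyn x] by (auto simp: tile_set_def)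
  assume c': "c' \<noteq> n + a" "u (T c' x) < 1" "m - a \<in> cube N"
  have "c' - a \<noteq> n" using c'(1) by auto
  moreover have "\<not> 1 \<le> u (T (c' - a) (T a x))" using c'(2) dynsys_add[OF dyn x] by simp
  ultimately have "\<forall>v\<in>cube N. cell_cost u T \<Lambda> (T a x) v n + 1 \<le> cell_cost u T \<Lambda> (T a x) v (c' - a)"
    using t unfolding tile_set_def by blast
  then have "cell_cost u T \<Lambda> (T a x) (m - a) ((n + a) - a) + 1 \<le> cell_cost u T \<Lambda> (T a x) (m - a) (c' - a)"
    using c'(3) by simp
  then show "cell_cost u T \<Lambda> x m (n + a) + 1 \<le> cell_cost u T \<Lambda> x m c'" unfolding tr .
qed

lemma tile_setI:
  fixes T :: "int^'k \<Rightarrow> 'a::metric_space \<Rightarrow> 'a"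
  assumes dyn: "dynsys X T" and x: "x \<in> X" and dvd: "\<And>i. int N dvd (c - a)$i" and u: "u (T c x) \<le> \<theta>"
    and gap: "\<And>c' m. c' \<noteq> c \<Longrightarrow> u (T c' x) < 1 \<Longrightarrow> m - a \<in> cube N \<Longrightarrow> cell_cost u T \<Lambda> x m c + 1 \<le> cell_cost u T \<Lambda> x m c'"
  shows "T a x \<in> tile_set X T u N \<theta> \<Lambda> (c - a)"
proof -
  have tr: "cell_cost u T \<Lambda> (T a x) v n = cell_cost u T \<Lambda> x (v + a) (n + a)" for v n
    using dynsys_add[OF dyn x] by (simp add: cell_cost_def rv_add)
  have "cell_cost u T \<Lambda> (T a x) v (c - a) + 1 \<le> cell_cost u T \<Lambda> (T a x) v n'"
    if "n' \<noteq> c - a" "\<not> 1 \<le> u (T n' (T a x))" "v \<in> cube N" for n' v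
    using gap[of "n' + a" "v + a"] that dynsys_add[OF dyn x] unfolding tr by (auto simp: algebra_simps)
  then show ?thesis
    using dvd u dynsys_add[OF dyn x] dynsys_in[OF dyn x] by (auto simp: tile_set_def)
qed

text \<open>Two cubes aligned with the same grid have origins congruent mod \<open>N\<close>, and a
  common point forces the origins to differ by less than \<open>N\<close> in every
  coordinate.\<close>

lemma cube_translate_unique:
  fixes a a' c m :: "int^'k"
  assumes "m - a \<in> cube N" "m - a' \<in> cube N" "\<And>i. int N dvd (c - a)$i" "\<And>i. int N dvd (c - a')$i"
  shows "a = a'"
proof -
  have "a$i = a'$i" for i
  proof -
    have "int N dvd (a$i - a'$i)" using dvd_diff[OF assms(4)[of i] assms(3)[of i]] by (simp add: algebra_simps)
    moreover have "\<bar>a$i - a'$i\<bar> < int N" using assms(1,2) by (auto simp: cube_def) (smt (verit))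
    ultimately show ?thesis using zdvd_not_zless[of "\<bar>a$i - a'$i\<bar>" "int N"] by (cases "a$i = a'$i") auto
  qed
  then show ?thesis by (simp add: vec_eq_iff)
qed

text \<open>\<open>T a x \<in> B\<close> says that a tile with origin \<open>a\<close> is placed on
  the orbit of \<open>x\<close>. The second assertion counts only tiles lying wholly in
  \<open>cube L\<close>, so that a window can be coded from its own tiles; the threshold
  \<open>L0\<close> does not depend on \<open>x\<close>.\<close>

lemma rokhlin_tiling:
  fixes T :: "int^'k \<Rightarrow> 'a::metric_space \<Rightarrow> 'a"
  assumes dyn: "dynsys X T" and mark: "marker_property X T" and N: "N \<ge> 1" and \<eta>: "\<eta> > 0"
  shows "\<exists>B L0. closed B \<and> B \<subseteq> X \<and>
    (\<forall>x\<in>X. \<forall>a a' m. T a x \<in> B \<longrightarrow> T a' x \<in> B \<longrightarrow> m - a \<in> cube N \<longrightarrow> m - a' \<in> cube N \<longrightarrow> a = a') \<and>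
    (\<forall>x\<in>X. \<forall>L\<ge>L0. real (card {m\<in>cube L. \<not> (\<exists>a. T a x \<in> B \<and> m - a \<in> cube N \<and> (+) a ` cube N \<subseteq> cube L)})
       \<le> \<eta> * real L ^ CARD('k))"
proof -
  define k where "k = CARD('k)"
  have k1: "k \<ge> 1" by (simp add: k_def Suc_leI)
  have "(\<lambda>q. (1 - 1 / real q) ^ k) \<longlonglongrightarrow> (1 - 0) ^ k" by (intro tendsto_intros lim_1_over_n)
  then have "eventually (\<lambda>q. (1 - 1 / real q) ^ k > 1 - \<eta>) sequentially"
    using \<eta> by (intro order_tendstoD) auto
  then obtain q0 where q0: "\<And>q. q \<ge> q0 \<Longrightarrow> (1 - 1 / real q) ^ k > 1 - \<eta>"
    by (auto simp: eventually_sequentially)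
  define q where "q = max q0 2"
  have q: "q \<ge> 2" "(1 - 1 / real q) ^ k > 1 - \<eta>" using q0[of q] by (auto simp: q_def)
  define s where "s = 1 / real q"
  have s: "0 < s" "s < 1" using q by (auto simp: s_def)
  \<comment> \<open>Bounds the distance from a point of real space to every lattice point that
    shares an \<open>N\<close>-cube with its integer part.\<close>
  define \<rho> where "\<rho> = real k * (real N + 1)"
  \<comment> \<open>Chosen so that \<open>M * s = 2 * \<rho> + 1\<close>: for sites more than
    \<open>M\<close> apart the gap term of \<open>power_diagram_gap\<close> is then at least
    1.\<close>
  define M where "M = q * (2 * k * (N + 1) + 1)"
  have M: "real M * s = 2 * \<rho> + 1" using q by (simp add: M_def s_def \<rho>_def field_simps)
  have M1: "M \<ge> 1" using q by (simp add: M_def)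
  obtain u :: "'a \<Rightarrow> real" and R0 where ex: "continuous_on X u" "\<forall>x. 0 \<le> u x \<and> u x \<le> 1"
    "\<forall>x\<in>X. \<forall>n n'. n \<noteq> n' \<longrightarrow> u (T n x) < 1 \<longrightarrow> u (T n' x) < 1 \<longrightarrow> (\<exists>i. int M < \<bar>n$i - n'$i\<bar>)"
    "R0 \<ge> 0" "\<forall>x\<in>X. \<exists>n. norm (rv n) \<le> R0 \<and> u (T n x) = 0"
    using marker_weight[OF dyn mark, of M] by (elim exE conjE) (rule that)
  have u: "continuous_on X u" "\<And>x. 0 \<le> u x" "\<And>x. u x \<le> 1"
    "\<And>x n n'. x \<in> X \<Longrightarrow> n \<noteq> n' \<Longrightarrow> u (T n x) < 1 \<Longrightarrow> u (T n' x) < 1 \<Longrightarrow> \<exists>i. int M < \<bar>n$i - n'$i\<bar>"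
    "R0 \<ge> 0" "\<And>x. x \<in> X \<Longrightarrow> \<exists>n. norm (rv n) \<le> R0 \<and> u (T n x) = 0"
    using ex by auto
  define R where "R = R0 + real k"
  have R: "R > 0" using u(5) k1 by (simp add: R_def)
  \<comment> \<open>Every point of real space has a weight 0 site within \<open>R\<close>, hence
    minimal cost at most the square of \<open>R\<close>. A nearest site therefore has
    \<open>u\<close> at most \<theta> < 1 and is a marker.\<close>
  define \<Lambda> where "\<Lambda> = R\<^sup>2 + 1"
  define \<theta> where "\<theta> = R\<^sup>2 / \<Lambda>"
  have \<Lambda>: "\<Lambda> > 0" by (simp add: \<Lambda>_def add_nonneg_pos)
  have \<theta>: "\<theta> < 1" by (simp add: \<theta>_def \<Lambda>_def add_nonneg_pos)
  define \<Lambda>' where "\<Lambda>' = (1 - s) * \<Lambda>"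
  \<comment> \<open>A tile is at distance at most \<open>R + \<rho>\<close> from its site, so
    finitely many relative positions suffice and the union stays closed.\<close>
  define Fin where "Fin = {n::int^'k. norm (rv n) \<le> R + \<rho>}"
  define B where "B = (\<Union>n\<in>Fin. tile_set X T u N \<theta> \<Lambda>' n)"
  have B1: "closed B"
    unfolding B_def Fin_def by (intro closed_UN finite_rv_ball0 ballI closed_tile_set[OF dyn u(1)])
  have B2: "B \<subseteq> X" by (auto simp: B_def tile_set_def)
  \<comment> \<open>At a common point of two tiles with different sites, each site would be cheaper
    than the other by at least 1. So the sites agree, and then the grid alignment identifies the
    tiles.\<close>
  have B3: "a = a'" if x: "x \<in> X" and a: "T a x \<in> B" "T a' x \<in> B" "m - a \<in> cube N" "m - a' \<in> cube N" for x a a' m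
  proof -
    obtain n where n: "T a x \<in> tile_set X T u N \<theta> \<Lambda>' n" using a(1) by (auto simp: B_def)
    obtain n' where n': "T a' x \<in> tile_set X T u N \<theta> \<Lambda>' n'" using a(2) by (auto simp: B_def)
    note t = tile_setD[OF dyn x n] and t' = tile_setD[OF dyn x n']
    have "n + a = n' + a'"
    proof (rule ccontr)
      assume ne: "n + a \<noteq> n' + a'"
      have "u (T (n + a) x) < 1" "u (T (n' + a') x) < 1" using t(2) t'(2) \<theta> by auto
      then show False
        using t(3)[of "n' + a'" m] t'(3)[of "n + a" m] ne a(3,4) by force
    qed
    then have "n + a - a = n" "n + a - a' = n'" by (simp_all add: algebra_simps)
    then show ?thesis
      using t(1) t'(1) by (intro cube_translate_unique[OF a(3,4), of "n + a"]) (simp_all only:)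
  qed
  define E where "E = nat \<lceil>R\<rceil> + N + 1"
  have E: "R + real N + 1 \<le> real E" unfolding E_def by (simp add: R less_imp_le)
  define Bad where "Bad x L = {m\<in>cube L. \<not> (\<exists>a. T a x \<in> B \<and> m - a \<in> cube N \<and> (+) a ` cube N \<subseteq> cube L)}" for x L
  have count: "real (card (Bad x L)) \<le> real L ^ k - (1 - s) ^ k * (real L - 2 * real E) ^ k"
    if x: "x \<in> X" and L: "L \<ge> 2 * E" for x L
  proof -
    \<comment> \<open>Sampling on the grid of mesh 1/(q-1) makes the contracted points
      \<open>z j\<close> equal to \<open>(j + c j) / q\<close>. They lie on the grid of mesh 1/q,
      and density becomes a count of the indices \<open>j\<close>.\<close>
    define pt :: "int^'k \<Rightarrow> real^'k" where "pt j = (1 / (real q - 1)) *\<^sub>R rv j" for j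
    have "\<exists>c. (\<forall>c'. (norm (pt j - rv c))\<^sup>2 + \<Lambda> * u (T c x) \<le> (norm (pt j - rv c'))\<^sup>2 + \<Lambda> * u (T c' x))
        \<and> (norm (pt j - rv c))\<^sup>2 + \<Lambda> * u (T c x) \<le> R\<^sup>2" for j
    proof -
      define cost where "cost c = (norm (pt j - rv c))\<^sup>2 + \<Lambda> * u (T c x)" for c
      define b :: "int^'k" where "b = (\<chi> i. \<lfloor>pt j $ i\<rfloor>)"
      obtain n where n: "norm (rv n) \<le> R0" "u (T n (T b x)) = 0" using u(6)[OF dynsys_in[OF dyn x]] by blast
      define c0 where "c0 = n + b"
      have "norm (pt j - rv b) \<le> real CARD('k) * 1"
      proof (rule norm_le_card)
        fix i
        show "\<bar>(pt j - rv b) $ i\<bar> \<le> 1" unfolding b_def by simp linarith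
      qed
      then have "norm ((pt j - rv b) - rv n) \<le> R"
        using norm_triangle_ineq4[of "pt j - rv b" "rv n"] n(1) by (simp add: R_def k_def)
      moreover have "pt j - rv c0 = (pt j - rv b) - rv n" by (simp add: c0_def rv_add)
      ultimately have nc0: "norm (pt j - rv c0) \<le> R" by (simp only:)
      have "u (T c0 x) = 0" using n(2) dynsys_add[OF dyn x] by (simp add: c0_def)
      then have cost0: "cost c0 \<le> R\<^sup>2" unfolding cost_def using nc0 by (simp add: power_mono)
      define A where "A = {c. norm (pt j - rv c) \<le> R}"
      have A: "finite A" "A \<noteq> {}" using nc0 finite_rv_ball by (auto simp: A_def)
      then obtain c where c: "c \<in> A" "\<And>c'. c' \<in> A \<Longrightarrow> cost c \<le> cost c'"
        using arg_min_least[of A] arg_min_if_finite(1)[of A] by metis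
      have "cost c \<le> R\<^sup>2" using c(2)[of c0] nc0 cost0 by (simp add: A_def)
      moreover have "cost c \<le> cost c'" for c'
      proof (cases "c' \<in> A")
        case False
        then have "R\<^sup>2 \<le> (norm (pt j - rv c'))\<^sup>2" using R by (intro power_mono) (auto simp: A_def)
        then have "R\<^sup>2 \<le> cost c'" using u(2)[of "T c' x"] \<Lambda> by (simp add: cost_def add_increasing2)
        then show ?thesis using \<open>cost c \<le> R\<^sup>2\<close> by simp
      qed (rule c(2))
      ultimately show ?thesis unfolding cost_def by blast
    qed
    then obtain c where c: "\<And>j c'. (norm (pt j - rv (c j)))\<^sup>2 + \<Lambda> * u (T (c j) x) \<le> (norm (pt j - rv c'))\<^sup>2 + \<Lambda> * u (T c' x)"
        "\<And>j. (norm (pt j - rv (c j)))\<^sup>2 + \<Lambda> * u (T (c j) x) \<le> R\<^sup>2" by metis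
    have uc: "u (T (c j) x) \<le> \<theta>" for j
    proof -
      have "\<Lambda> * u (T (c j) x) \<le> R\<^sup>2" using c(2)[of j] zero_le_power2[of "norm (pt j - rv (c j))"] by linarith
      then show ?thesis using \<Lambda> by (simp add: \<theta>_def field_simps)
    qed
    have pc: "norm (pt j - rv (c j)) \<le> R" for j
    proof (rule power2_le_imp_le)
      have "0 \<le> \<Lambda> * u (T (c j) x)" using \<Lambda> u(2) by simp
      then show "(norm (pt j - rv (c j)))\<^sup>2 \<le> R\<^sup>2" using c(2)[of j] by linarith
    qed (use R in simp)
    define z where "z j = (1 - s) *\<^sub>R pt j + s *\<^sub>R rv (c j)" for j
    have z_nth: "z j $ i = (real_of_int (j$i) + real_of_int (c j $ i)) / real q" for j i
      using q by (simp add: z_def pt_def s_def field_simps)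
    have gap: "cell_cost u T \<Lambda>' x v (c j) + 1 \<le> cell_cost u T \<Lambda>' x v c'"
      if v: "norm (rv v - z j) \<le> \<rho>" and c': "c' \<noteq> c j" "u (T c' x) < 1" for j v c'
    proof -
      have "u (T (c j) x) < 1" using uc[of j] \<theta> by simp
      then obtain i where i: "int M < \<bar>c j $ i - c' $ i\<bar>" using u(4)[OF x _ _ c'(2)] c'(1) by metis
      have "real M \<le> \<bar>(rv (c j) - rv c') $ i\<bar>" using i by simp
      also have "\<dots> \<le> norm (rv (c j) - rv c')" by (rule component_le_norm_cart)
      finally have D: "real M \<le> norm (rv (c j) - rv c')" .
      have "1 * 1 \<le> norm (rv (c j) - rv c') * (s * norm (rv (c j) - rv c') - 2 * \<rho>)"
      proof (rule mult_mono)
        have "real M * s \<le> norm (rv (c j) - rv c') * s" using D s by (intro mult_right_mono) auto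
        then show "1 \<le> s * norm (rv (c j) - rv c') - 2 * \<rho>" unfolding M by (simp add: mult.commute)
      qed (use D M1 in auto)
      moreover have "(norm (rv v - rv (c j)))\<^sup>2 + (1 - s) * (\<Lambda> * u (T (c j) x)) + norm (rv (c j) - rv c') * (s * norm (rv (c j) - rv c') - 2 * \<rho>)
         \<le> (norm (rv v - rv c'))\<^sup>2 + (1 - s) * (\<Lambda> * u (T c' x))"
        using s v unfolding z_def by (intro power_diagram_gap[OF _ _ c(1)]) auto
      ultimately show ?thesis unfolding cell_cost_def \<Lambda>'_def by (simp add: mult.assoc)
    qed
    define m :: "int^'k \<Rightarrow> int^'k" where "m j = (\<chi> i. (j$i + c j $ i) div int q)" for j
    have mz: "real_of_int (m j $ i) \<le> z j $ i" "z j $ i < real_of_int (m j $ i) + 1" for j i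
    proof -
      have "m j $ i = \<lfloor>z j $ i\<rfloor>"
        unfolding z_nth m_def using floor_divide_of_int_eq[of "j$i + c j $ i" "int q", where ?'a = real] by simp
      then show "real_of_int (m j $ i) \<le> z j $ i" "z j $ i < real_of_int (m j $ i) + 1" by linarith+
    qed
    have near: "norm (rv v - z j) \<le> \<rho>" if "\<And>i. \<bar>v$i - m j $ i\<bar> \<le> int N" for v j
      unfolding \<rho>_def k_def
    proof (rule norm_le_card)
      fix i
      have "\<bar>real_of_int (v$i) - real_of_int (m j $ i)\<bar> \<le> real N" using that[of i] by linarith
      then show "\<bar>(rv v - z j) $ i\<bar> \<le> real N + 1" using mz[of j i] by simp
    qed
    \<comment> \<open>The origin of the cube containing \<open>m j\<close> in the grid of mesh
      \<open>N\<close> through the site \<open>c j\<close>.\<close>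
    define a where "a j = (\<chi> i. m j $ i - (m j $ i - c j $ i) mod int N)" for j
    have ma: "m j - a j \<in> cube N" for j using N by (simp add: cube_def a_def)
    have va: "\<bar>v$i - m j $ i\<bar> \<le> int N" if "v - a j \<in> cube N" for v j i
    proof -
      have "0 \<le> (v - a j)$i" "(v - a j)$i < int N" "0 \<le> (m j - a j)$i" "(m j - a j)$i < int N"
        using that ma[of j] unfolding cube_def by blast+
      then show ?thesis by simp
    qed
    have tile: "T (a j) x \<in> B" for j
    proof -
      have "int N dvd (c j - a j) $ i" for i
      proof -
        have "(c j - a j) $ i = - ((m j $ i - c j $ i) - (m j $ i - c j $ i) mod int N)" by (simp add: a_def)
        then show ?thesis by (simp only: dvd_minus_iff dvd_minus_mod)
      qed
      then have "T (a j) x \<in> tile_set X T u N \<theta> \<Lambda>' (c j - a j)"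
        using gap near va by (intro tile_setI[where c = "c j" and a = "a j" and T = T and u = u, OF dyn x _ uc]) blast+
      moreover have "c j - a j \<in> Fin"
      proof -
        have "a j - a j \<in> cube N" using zero_in_cube[OF N] by simp
        then have 1: "norm (rv (a j) - z j) \<le> \<rho>" using near va by blast
        have "rv (c j) - z j = (1 - s) *\<^sub>R (rv (c j) - pt j)" by (simp add: z_def algebra_simps)
        then have "norm (rv (c j) - z j) = (1 - s) * norm (pt j - rv (c j))" using s by (simp add: norm_minus_commute)
        also have "\<dots> \<le> 1 * R" using pc[of j] s by (intro mult_mono) auto
        finally have "norm (rv (c j) - z j) \<le> R" by simp
        then have "norm ((rv (c j) - z j) - (rv (a j) - z j)) \<le> R + \<rho>" using 1 norm_triangle_ineq4 order_trans add_mono by meson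
        then show ?thesis by (simp add: Fin_def rv_diff)
      qed
      ultimately show ?thesis unfolding B_def by blast
    qed
    \<comment> \<open>The shift keeps \<open>pt j\<close> at distance \<open>E\<close> from the
      border of the large cube. Since \<open>E \<ge> R + N + 1\<close>, the whole tile around
      \<open>m j\<close> stays inside.\<close>
    define org :: "int^'k" where "org = (\<chi> i. int ((q - 1) * E))"
    define J where "J = (+) org ` cube ((q - 1) * (L - 2 * E))"
    have cardJ: "card J = ((q - 1) * (L - 2 * E)) ^ k"
      unfolding J_def k_def by (subst card_image) (auto simp: card_cube)
    have inside: "v \<in> cube L" if j: "j \<in> J" and v: "v - a j \<in> cube N" for j v
    proof -
      have "0 \<le> v$i \<and> v$i < int L" for i
      proof -
        obtain w where w: "w \<in> cube ((q - 1) * (L - 2 * E))" "j = org + w" using j by (auto simp: J_def)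
        have "0 \<le> w$i" "w$i < int ((q - 1) * (L - 2 * E))" using w(1) unfolding cube_def by blast+
        moreover have "j$i = int ((q - 1) * E) + w$i" unfolding w(2) by (simp add: org_def)
        ultimately have "int ((q - 1) * E) \<le> j$i" "j$i < int ((q - 1) * E) + int ((q - 1) * (L - 2 * E))"
          by linarith+
        then have j1: "real_of_int (int ((q - 1) * E)) \<le> real_of_int (j$i)"
            and j2: "real_of_int (j$i) < real_of_int (int ((q - 1) * E)) + real_of_int (int ((q - 1) * (L - 2 * E)))"
          by (simp_all only: of_int_le_iff of_int_less_iff of_int_add[symmetric])
        have e1: "real_of_int (int ((q - 1) * E)) = (real q - 1) * real E"
          using q by (simp add: of_nat_diff)
        have e2: "real_of_int (int ((q - 1) * (L - 2 * E))) = (real q - 1) * (real L - 2 * real E)"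
          using q L by (simp add: of_nat_diff)
        have e3: "(real q - 1) * real E + (real q - 1) * (real L - 2 * real E) = (real q - 1) * (real L - real E)"
          by (simp add: algebra_simps)
        have "(real q - 1) * real E \<le> real_of_int (j$i)" "real_of_int (j$i) < (real q - 1) * (real L - real E)"
          using j1 j2 unfolding e1 e2 e3 by simp_all
        then have p: "real E \<le> pt j $ i" "pt j $ i < real L - real E"
          using q by (simp_all add: pt_def field_simps)
        have "\<bar>(pt j - rv (c j)) $ i\<bar> \<le> R" using component_le_norm_cart pc[of j] by (rule order_trans)
        then have "s * \<bar>pt j $ i - real_of_int (c j $ i)\<bar> \<le> 1 * R" using s by (intro mult_mono) auto
        moreover have "z j $ i - pt j $ i = - (s * (pt j $ i - real_of_int (c j $ i)))"
          by (simp add: z_def algebra_simps)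
        ultimately have "\<bar>z j $ i - pt j $ i\<bar> \<le> R" using s by (simp add: abs_mult)
        moreover have "\<bar>real_of_int (v$i) - real_of_int (m j $ i)\<bar> \<le> real N" using va[OF v, of i] by linarith
        ultimately have "\<bar>real_of_int (v$i) - pt j $ i\<bar> \<le> R + real N + 1" using mz[of j i] by linarith
        then have "0 \<le> real_of_int (v$i)" "real_of_int (v$i) < real L" using p E by linarith+
        then show ?thesis by (simp_all)
      qed
      then show ?thesis by (simp add: cube_def)
    qed
    define Good where "Good = {v\<in>cube L. \<exists>a. T a x \<in> B \<and> v - a \<in> cube N \<and> (+) a ` cube N \<subseteq> cube L}"
    have mGood: "m ` J \<subseteq> Good"
    proof
      fix v assume "v \<in> m ` J"
      then obtain j where j: "j \<in> J" "v = m j" by blast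
      have "(+) (a j) ` cube N \<subseteq> cube L" using inside[OF j(1)] by auto
      moreover have "v \<in> cube L" unfolding j(2) by (rule inside[OF j(1) ma])
      ultimately show "v \<in> Good" using tile[of j] ma[of j] j(2) unfolding Good_def by blast
    qed
    \<comment> \<open>The gap shows that \<open>m j\<close> determines the site \<open>c j\<close>.
      Then \<open>j + c j\<close> has prescribed quotient by \<open>q\<close>, which leaves
      \<open>q ^ k\<close> remainders. Against about \<open>((q - 1) * L) ^ k\<close> indices this
      yields density about \<open>(1 - s) ^ k\<close>.\<close>
    have fib: "card {j\<in>J. m j = v} \<le> q ^ k" for v
    proof (cases "\<exists>j0. m j0 = v")
      case False
      then have "{j\<in>J. m j = v} = {}" by blast
      then have "card {j\<in>J. m j = v} = 0" by (simp only: card.empty)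
      then show ?thesis by linarith
    next
      case True
      then obtain j0 where j0: "m j0 = v" by blast
      have same: "c j = c j0" if "m j = v" for j
      proof (rule ccontr)
        assume ne: "c j \<noteq> c j0"
        have "norm (rv v - z j) \<le> \<rho>" "norm (rv v - z j0) \<le> \<rho>" using that j0 by (auto intro: near)
        moreover have "u (T (c j) x) < 1" "u (T (c j0) x) < 1" using uc \<theta> le_less_trans by blast+
        ultimately show False using gap[of v j "c j0"] gap[of v j0 "c j"] ne by force
      qed
      define w :: "int^'k" where "w = (\<chi> i. int q * v$i - c j0 $ i)"
      have "{j\<in>J. m j = v} \<subseteq> (+) w ` cube q"
      proof
        fix j assume "j \<in> {j\<in>J. m j = v}"
        then have j: "m j = v" "c j = c j0" using same by auto
        have "j - w \<in> cube q"
        proof -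
          have "0 \<le> (j - w)$i \<and> (j - w)$i < int q" for i
          proof -
            have "v$i = (j$i + c j0 $ i) div int q" using j unfolding m_def by auto
            then have "(j - w)$i = (j$i + c j0 $ i) mod int q"
              by (simp add: w_def minus_mult_div_eq_mod[symmetric])
            then show ?thesis using q by simp
          qed
          then show ?thesis by (simp add: cube_def)
        qed
        then show "j \<in> (+) w ` cube q" by (intro image_eqI[of _ _ "j - w"]) auto
      qed
      then have "card {j\<in>J. m j = v} \<le> card ((+) w ` cube q)" by (intro card_mono) auto
      also have "\<dots> \<le> card (cube q :: (int^'k) set)" by (rule card_image_le) simp
      finally show ?thesis by (simp add: card_cube k_def)
    qed
    have finJ: "finite J" by (simp add: J_def)
    have finG: "finite Good" unfolding Good_def by (rule finite_subset[OF _ finite_cube[of L]]) blast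
    have "card J = card (\<Union>v\<in>m ` J. {j\<in>J. m j = v})" by (rule arg_cong[where f = card]) blast
    also have "\<dots> \<le> (\<Sum>v\<in>m ` J. card {j\<in>J. m j = v})"
      by (rule card_UN_le) (simp add: finJ)
    also have "\<dots> \<le> card (m ` J) * q ^ k" using sum_bounded_above[of "m ` J" "\<lambda>v. card {j\<in>J. m j = v}" "q ^ k"] fib by simp
    also have "\<dots> \<le> card Good * q ^ k" by (intro mult_right_mono card_mono mGood finG) simp
    finally have "real (card J) \<le> real (card Good) * real q ^ k" by (metis of_nat_le_iff of_nat_mult of_nat_power)
    then have "((real q - 1) * (real L - 2 * real E)) ^ k \<le> real (card Good) * real q ^ k"
      using q L by (simp add: cardJ of_nat_diff)
    then have "((real q - 1) * (real L - 2 * real E)) ^ k / real q ^ k \<le> real (card Good)"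
      using q by (simp add: divide_le_eq)
    moreover have "((real q - 1) * (real L - 2 * real E)) ^ k / real q ^ k = (1 - s) ^ k * (real L - 2 * real E) ^ k"
      using q by (simp add: power_mult_distrib power_divide[symmetric] s_def diff_divide_distrib flip: times_divide_eq_left)
    moreover have "Bad x L = cube L - Good" unfolding Bad_def Good_def by blast
    then have "card (Bad x L) = L ^ k - card Good"
      using card_Diff_subset[OF finG, of "cube L"] by (simp add: card_cube k_def Good_def)
    moreover have "card Good \<le> L ^ k"
      using card_mono[OF finite_cube[of L], of Good] by (simp add: card_cube k_def Good_def)
    ultimately show ?thesis by (simp add: of_nat_diff)
  qed
  have "(\<lambda>L. (1 - s) ^ k * (1 - 2 * real E * (1 / real L)) ^ k) \<longlonglongrightarrow> (1 - s) ^ k * (1 - 2 * real E * 0) ^ k"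
    by (intro tendsto_intros lim_1_over_n)
  then have "eventually (\<lambda>L. (1 - s) ^ k * (1 - 2 * real E * (1 / real L)) ^ k > 1 - \<eta>) sequentially"
    using q(2) by (intro order_tendstoD) (auto simp: s_def)
  then obtain L1 where L1: "\<And>L. L \<ge> L1 \<Longrightarrow> (1 - s) ^ k * (1 - 2 * real E * (1 / real L)) ^ k > 1 - \<eta>"
    by (auto simp: eventually_sequentially)
  have "real (card (Bad x L)) \<le> \<eta> * real L ^ k" if x: "x \<in> X" and L: "L \<ge> max L1 (2 * E + 1)" for x L
  proof -
    have L0: "real L > 0" using L by simp
    have "real L - 2 * real E = real L * (1 - 2 * real E * (1 / real L))"
      using L0 by (simp add: field_simps)
    then have "(real L - 2 * real E) ^ k = (real L * (1 - 2 * real E * (1 / real L))) ^ k"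
      by (rule arg_cong)
    then have eq: "(1 - s) ^ k * (real L - 2 * real E) ^ k = real L ^ k * ((1 - s) ^ k * (1 - 2 * real E * (1 / real L)) ^ k)"
      by (simp add: power_mult_distrib mult.left_commute)
    have "real L ^ k * (1 - \<eta>) \<le> real L ^ k * ((1 - s) ^ k * (1 - 2 * real E * (1 / real L)) ^ k)"
      using L1[of L] L by (intro mult_left_mono) auto
    then show ?thesis using count[OF x, of L] L unfolding eq by (simp add: algebra_simps)
  qed
  then have "\<forall>x\<in>X. \<forall>L\<ge>max L1 (2 * E + 1). real (card (Bad x L)) \<le> \<eta> * real L ^ CARD('k)"
    unfolding k_def by blast
  moreover have "\<forall>x\<in>X. \<forall>a a' m. T a x \<in> B \<longrightarrow> T a' x \<in> B \<longrightarrow> m - a \<in> cube N \<longrightarrow> m - a' \<in> cube N \<longrightarrow> a = a'"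
    using B3 by blast
  ultimately show ?thesis unfolding Bad_def using B1 B2 by (intro exI[of _ B] exI[of _ "max L1 (2 * E + 1)"] conjI)
qed

section \<open>The metric on sequences and covering numbers\<close>

lemma sum_powr_abs_le:
  fixes \<theta> :: real
  assumes "0 \<le> \<theta>" "\<theta> < 1"
  shows "(\<Sum>j\<in>{- int J..int J}. \<theta> ^ nat \<bar>j\<bar>) \<le> 2 / (1 - \<theta>)"
proof -
  have geo: "(\<Sum>i\<le>J. \<theta> ^ i) \<le> 1 / (1 - \<theta>)"
    using sum_le_suminf[OF summable_geometric, of \<theta> "{..J}"] assms suminf_geometric[of \<theta>] by simp
  have "{- int J..int J} \<subseteq> int ` {..J} \<union> (\<lambda>i. - int i) ` {..J}"
  proof
    fix j assume j: "j \<in> {- int J..int J}"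
    show "j \<in> int ` {..J} \<union> (\<lambda>i. - int i) ` {..J}"
    proof (cases "j \<ge> 0")
      case True
      then have "j = int (nat j)" "nat j \<in> {..J}" using j by auto
      then show ?thesis by blast
    next
      case False
      then have "j = - int (nat (- j))" "nat (- j) \<in> {..J}" using j by auto
      then show ?thesis by blast
    qed
  qed
  then have "(\<Sum>j\<in>{- int J..int J}. \<theta> ^ nat \<bar>j\<bar>) \<le> (\<Sum>j\<in>int ` {..J} \<union> (\<lambda>i. - int i) ` {..J}. \<theta> ^ nat \<bar>j\<bar>)"
    using assms by (intro sum_mono2) auto
  also have "\<dots> \<le> (\<Sum>j\<in>int ` {..J}. \<theta> ^ nat \<bar>j\<bar>) + (\<Sum>j\<in>(\<lambda>i. - int i) ` {..J}. \<theta> ^ nat \<bar>j\<bar>)"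
  proof -
    have "sum g (A \<union> B) \<le> sum g A + sum g B" if "finite A" "finite B" "\<And>x. g x \<ge> 0" for g :: "int \<Rightarrow> real" and A B
    proof -
      have "0 \<le> sum g (A \<inter> B)" by (intro sum_nonneg that(3))
      then show ?thesis using sum.union_inter[OF that(1,2), of g] by linarith
    qed
    then show ?thesis using assms by simp
  qed
  also have "(\<Sum>j\<in>int ` {..J}. \<theta> ^ nat \<bar>j\<bar>) = (\<Sum>i\<le>J. \<theta> ^ i)" by (subst sum.reindex) auto
  also have "(\<Sum>j\<in>(\<lambda>i. - int i) ` {..J}. \<theta> ^ nat \<bar>j\<bar>) = (\<Sum>i\<le>J. \<theta> ^ i)"
    by (subst sum.reindex) (auto simp: inj_on_def)
  finally show ?thesis using geo by simp
qed

text \<open>The Euclidean norm is at least each |n_i|, hence at least their mean. So the weight is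
  at most a product of one-dimensional geometric weights with ratio \<open>2 powr (- 1 / k)\<close>,
  and finite sums factor over the coordinates.\<close>

lemma weight_summable: "(\<lambda>n::int^'k. 2 powr (- zabs n)) summable_on UNIV"
proof -
  define \<theta> :: real where "\<theta> = 2 powr (- 1 / real CARD('k))"
  have "\<theta> < 2 powr 0" unfolding \<theta>_def by (intro powr_less_mono) auto
  then have \<theta>: "0 \<le> \<theta>" "\<theta> < 1" by (simp_all add: \<theta>_def)
  define C where "C = (2 / (1 - \<theta>)) ^ CARD('k)"
  have wt: "2 powr (- zabs n) \<le> (\<Prod>i\<in>UNIV. \<theta> ^ nat \<bar>n$i\<bar>)" for n :: "int^'k"
  proof -
    have "real_of_int \<bar>n$i\<bar> \<le> zabs n" for i
    proof -
      have "(real_of_int (n$i))\<^sup>2 \<le> (\<Sum>i\<in>UNIV. (real_of_int (n$i))\<^sup>2)" by (intro member_le_sum) auto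
      then have "sqrt ((real_of_int (n$i))\<^sup>2) \<le> zabs n" unfolding zabs_def by (rule real_sqrt_le_mono)
      then show ?thesis by simp
    qed
    then have "(\<Sum>i\<in>UNIV. real_of_int \<bar>n$i\<bar>) \<le> (\<Sum>i\<in>(UNIV::'k set). zabs n)" by (intro sum_mono) auto
    then have "(\<Sum>i\<in>UNIV. real_of_int \<bar>n$i\<bar>) / real CARD('k) \<le> zabs n"
      by (simp add: divide_le_eq mult.commute)
    then have "2 powr (- zabs n) \<le> 2 powr (- ((\<Sum>i\<in>UNIV. real_of_int \<bar>n$i\<bar>) / real CARD('k)))"
      by (intro powr_mono) auto
    also have "\<dots> = 2 powr (\<Sum>i\<in>UNIV. (- 1 / real CARD('k)) * real_of_int \<bar>n$i\<bar>)"
      by (simp only: sum_distrib_left[symmetric]) simp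
    also have "\<dots> = (\<Prod>i\<in>UNIV. 2 powr ((- 1 / real CARD('k)) * real_of_int \<bar>n$i\<bar>))"
      by (rule powr_sum) auto
    also have "\<dots> = (\<Prod>i\<in>UNIV. \<theta> ^ nat \<bar>n$i\<bar>)"
    proof (rule prod.cong[OF refl])
      fix i
      have "2 powr ((- 1 / real CARD('k)) * real_of_int \<bar>n$i\<bar>) = \<theta> powr real (nat \<bar>n$i\<bar>)"
        unfolding \<theta>_def powr_powr by simp
      also have "\<dots> = \<theta> ^ nat \<bar>n$i\<bar>" by (rule powr_realpow) (simp add: \<theta>_def)
      finally show "2 powr ((- 1 / real CARD('k)) * real_of_int \<bar>n$i\<bar>) = \<theta> ^ nat \<bar>n$i\<bar>" .
    qed
    finally show ?thesis .
  qed
  have bound: "sum (\<lambda>n. 2 powr (- zabs n)) F \<le> C" if "finite F" for F :: "(int^'k) set"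
  proof -
    have "finite ((\<lambda>(n, i). nat \<bar>n$i\<bar>) ` (F \<times> UNIV))" using that by auto
    then obtain J where J: "\<And>y. y \<in> (\<lambda>(n, i). nat \<bar>n$i\<bar>) ` (F \<times> UNIV) \<Longrightarrow> y \<le> J"
      by (meson finite_nat_set_iff_bounded_le)
    define P where "P = PiE (UNIV :: 'k set) (\<lambda>i. {- int J..int J})"
    have sub: "F \<subseteq> vec_lambda ` P"
    proof
      fix n assume n: "n \<in> F"
      have "\<bar>n$i\<bar> \<le> int J" for i using J[of "nat \<bar>n$i\<bar>"] n by force
      then have "vec_nth n \<in> P" unfolding P_def by (auto simp: abs_le_iff minus_le_iff)
      then show "n \<in> vec_lambda ` P" by (intro image_eqI[of _ _ "vec_nth n"]) auto
    qed
    have finP: "finite P" unfolding P_def by (intro finite_PiE) auto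
    have "sum (\<lambda>n. 2 powr (- zabs n)) F \<le> (\<Sum>n\<in>F. \<Prod>i\<in>UNIV. \<theta> ^ nat \<bar>n$i\<bar>)"
      by (intro sum_mono wt)
    also have "\<dots> \<le> (\<Sum>n\<in>vec_lambda ` P. \<Prod>i\<in>UNIV. \<theta> ^ nat \<bar>n$i\<bar>)"
      using \<theta> finP by (intro sum_mono2 sub) (auto intro!: prod_nonneg)
    also have "\<dots> = (\<Sum>g\<in>P. \<Prod>i\<in>UNIV. \<theta> ^ nat \<bar>g i\<bar>)"
      by (subst sum.reindex) (auto intro!: inj_onI simp: vec_lambda_inject)
    also have "\<dots> = (\<Prod>i\<in>(UNIV::'k set). \<Sum>j\<in>{- int J..int J}. \<theta> ^ nat \<bar>j\<bar>)"
      unfolding P_def by (intro prod_sum_PiE[symmetric]) auto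
    also have "\<dots> \<le> (\<Prod>i\<in>(UNIV::'k set). 2 / (1 - \<theta>))"
      using \<theta> by (intro prod_mono conjI sum_nonneg sum_powr_abs_le) auto
    also have "\<dots> = C" by (simp add: C_def)
    finally show ?thesis .
  qed
  show ?thesis
    by (rule nonneg_bounded_partial_sums_imp_summable_on[where C = C])
       (auto simp: bound intro!: eventually_finite_subsets_at_top_weakI)
qed

text \<open>The factor converting a uniform bound on coordinates into a bound on
  \<open>Dmetric\<close>; the type argument fixes the dimension.\<close>

definition wsum :: "(int^'k) itself \<Rightarrow> real" where
  "wsum _ = infsum (\<lambda>n::int^'k. 2 powr (- zabs n)) UNIV"

lemma wsum_nonneg: "wsum TYPE(int^'k) \<ge> 0"
  unfolding wsum_def by (intro infsum_nonneg) auto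

context
  fixes x y :: "int^'k \<Rightarrow> 'v::real_normed_vector" and \<Delta> :: real
  assumes bdd: "\<And>n. norm (x n - y n) \<le> \<Delta>"
begin

lemma Dmetric_summable: "(\<lambda>n. 2 powr (- zabs n) * norm (x n - y n)) summable_on UNIV"
  by (rule summable_on_comparison_test[OF summable_on_cmult_left[OF weight_summable, of \<Delta>]])
     (auto intro!: mult_left_mono bdd)

lemma Dmetric_le: "Dmetric x y \<le> wsum TYPE(int^'k) * \<Delta>"
proof -
  have "Dmetric x y \<le> infsum (\<lambda>n::int^'k. 2 powr (- zabs n) * \<Delta>) UNIV"
    unfolding Dmetric_def
    by (intro infsum_mono Dmetric_summable summable_on_cmult_left weight_summable mult_left_mono bdd) auto
  then show ?thesis by (simp add: infsum_cmult_left' wsum_def)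
qed

end

lemma Dmetric_refl [simp]: "Dmetric x x = 0"
  by (simp add: Dmetric_def)

lemma Dmetric_commute: "Dmetric x y = Dmetric y x"
  by (simp add: Dmetric_def norm_minus_commute)

text \<open>The uniform bounds supply summability, without which \<open>infsum\<close> is 0 by
  convention and carries no information.\<close>

lemma Dmetric_triangle:
  fixes x y z :: "int^'k \<Rightarrow> 'v::real_normed_vector"
  assumes "\<And>n. norm (x n - y n) \<le> \<Delta>" "\<And>n. norm (y n - z n) \<le> \<Delta>" "\<And>n. norm (x n - z n) \<le> \<Delta>"
  shows "Dmetric x z \<le> Dmetric x y + Dmetric y z"
proof -
  note s = Dmetric_summable[OF assms(1)] Dmetric_summable[OF assms(2)] Dmetric_summable[OF assms(3)]
  have tri: "norm (x n - z n) \<le> norm (x n - y n) + norm (y n - z n)" for n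
    using norm_triangle_ineq[of "x n - y n" "y n - z n"] by simp
  have "Dmetric x z \<le> infsum (\<lambda>n. 2 powr (- zabs n) * norm (x n - y n) + 2 powr (- zabs n) * norm (y n - z n)) UNIV"
    unfolding Dmetric_def
    by (intro infsum_mono s summable_on_add) (simp only: distrib_left[symmetric], intro mult_left_mono tri, simp)
  also have "\<dots> = Dmetric x y + Dmetric y z" unfolding Dmetric_def by (intro infsum_add s)
  finally show ?thesis .
qed

text \<open>The tail of the weights outside a finite \<open>F\<close> is small, and differences are
  at most \<Delta> there. \<open>F\<close> depends only on \<open>e\<close> and \<Delta>, so the
  orbit pieces to be coded extend a window by a fixed margin.\<close>

lemma Dmetric_local:
  assumes "e > 0" "\<Delta> \<ge> 0"
  shows "\<exists>F. finite F \<and> (\<forall>(x :: int^'k \<Rightarrow> 'v::real_normed_vector) y e'. (\<forall>n. norm (x n - y n) \<le> \<Delta>) \<longrightarrow>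
     (\<forall>n\<in>F. norm (x n - y n) \<le> e') \<longrightarrow> e' \<ge> 0 \<longrightarrow> Dmetric x y \<le> wsum TYPE(int^'k) * e' + e)"
proof -
  define w where "w = (\<lambda>n::int^'k. 2 powr (- zabs n) :: real)"
  have w: "w summable_on UNIV" unfolding w_def by (rule weight_summable)
  have w0: "w n \<ge> 0" for n by (simp add: w_def)
  have "\<forall>\<^sub>F F in finite_subsets_at_top UNIV. dist (sum w F) (infsum w UNIV) < e / (\<Delta> + 1)"
    using assms by (intro tendstoD infsum_tendsto w) auto
  then obtain F where F: "finite F" "dist (sum w F) (infsum w UNIV) < e / (\<Delta> + 1)"
    unfolding eventually_finite_subsets_at_top by blast
  have tail: "(infsum w UNIV - sum w F) * \<Delta> \<le> e"
  proof -
    have "infsum w UNIV - sum w F \<le> e / (\<Delta> + 1)" using F(2) by (simp add: dist_real_def)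
    then have "(infsum w UNIV - sum w F) * \<Delta> \<le> e / (\<Delta> + 1) * \<Delta>" using assms by (intro mult_right_mono) auto
    also have "\<dots> \<le> e" using assms by (simp add: field_simps)
    finally show ?thesis .
  qed
  define h where "h n = (if n \<in> F then 0 else w n)" for n
  have h: "h summable_on UNIV"
    by (rule summable_on_comparison_test[OF w]) (auto simp: h_def w0)
  have "infsum h UNIV = infsum w (UNIV - F)" by (intro infsum_cong_neutral) (auto simp: h_def)
  also have "\<dots> = infsum w UNIV - sum w F" using F(1) w by (subst infsum_Diff) auto
  finally have hs: "infsum h UNIV = infsum w UNIV - sum w F" .
  have "Dmetric x y \<le> wsum TYPE(int^'k) * e' + e"
    if a: "\<And>n. norm (x n - y n) \<le> \<Delta>" "\<And>n. n \<in> F \<Longrightarrow> norm (x n - y n) \<le> e'" "e' \<ge> 0"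
    for x y :: "int^'k \<Rightarrow> 'v" and e'
  proof -
    have le: "w n * norm (x n - y n) \<le> w n * e' + h n * \<Delta>" for n
    proof (cases "n \<in> F")
      case True
      then show ?thesis using a(2) w0[of n] by (simp add: h_def mult_left_mono)
    next
      case False
      have "w n * norm (x n - y n) \<le> w n * \<Delta>" by (intro mult_left_mono a w0)
      moreover have "0 \<le> w n * e'" using w0 a(3) by simp
      ultimately show ?thesis using False by (simp add: h_def)
    qed
    have D: "Dmetric x y = infsum (\<lambda>n. w n * norm (x n - y n)) UNIV" by (simp add: Dmetric_def w_def)
    have S: "(\<lambda>n. w n * norm (x n - y n)) summable_on UNIV"
      using Dmetric_summable[of x y \<Delta>, OF a(1)] by (simp add: w_def)
    have "Dmetric x y \<le> infsum (\<lambda>n. w n * e' + h n * \<Delta>) UNIV"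
      unfolding D by (intro infsum_mono S summable_on_add summable_on_cmult_left w h le)
    also have "\<dots> = infsum (\<lambda>n. w n * e') UNIV + infsum (\<lambda>n. h n * \<Delta>) UNIV"
      by (intro infsum_add summable_on_cmult_left w h)
    also have "\<dots> = infsum w UNIV * e' + infsum h UNIV * \<Delta>" by (simp only: infsum_cmult_left')
    also have "\<dots> \<le> wsum TYPE(int^'k) * e' + e" using tail unfolding hs by (simp add: wsum_def w_def)
    finally show ?thesis .
  qed
  then show ?thesis using F(1) by (intro exI[of _ F] conjI allI impI) simp_all
qed

text \<open>The fibres of \<open>h\<close> form a cover by \<open>n\<close> sets that need not be open; this does not change covering
  numbers, since sets of diameter strictly less than \<open>\<epsilon>\<close> can be fattened.\<close>

definition coded :: "'a set \<Rightarrow> (int^'k \<Rightarrow> 'a \<Rightarrow> 'a) \<Rightarrow> ('a \<Rightarrow> 'v::real_normed_vector) \<Rightarrow> (int^'k) set \<Rightarrow> real \<Rightarrow> nat \<Rightarrow> bool" where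
  "coded X T f \<Omega> \<epsilon> n \<longleftrightarrow> (\<exists>h::'a \<Rightarrow> nat. (\<forall>x\<in>X. h x < n) \<and> (\<exists>c<\<epsilon>. \<forall>x\<in>X. \<forall>y\<in>X. h x = h y \<longrightarrow>
     (\<forall>m\<in>\<Omega>. Dmetric (I_map T f (T m x)) (I_map T f (T m y)) \<le> c)))"

lemma codedI:
  assumes "\<And>x. x \<in> X \<Longrightarrow> h x < n" "c < \<epsilon>"
    "\<And>x y m. x \<in> X \<Longrightarrow> y \<in> X \<Longrightarrow> h x = h y \<Longrightarrow> m \<in> \<Omega> \<Longrightarrow> Dmetric (I_map T f (T m x)) (I_map T f (T m y)) \<le> c"
  shows "coded X T f \<Omega> \<epsilon> n"
  unfolding coded_def using assms by blast

lemma codedE: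
  assumes "coded X T f \<Omega> \<epsilon> n"
  obtains h c where "\<And>x. x \<in> X \<Longrightarrow> h x < n" "c < \<epsilon>"
    "\<And>x y m. x \<in> X \<Longrightarrow> y \<in> X \<Longrightarrow> h x = h y \<Longrightarrow> m \<in> \<Omega> \<Longrightarrow> Dmetric (I_map T f (T m x)) (I_map T f (T m y)) \<le> c"
  using assms unfolding coded_def by blast

lemma coded_mono:
  assumes "coded X T f \<Omega> \<epsilon> n" "\<Omega>' \<subseteq> \<Omega>" "n \<le> n'"
  shows "coded X T f \<Omega>' \<epsilon> n'"
proof -
  obtain h c where h: "\<And>x. x \<in> X \<Longrightarrow> h x < n" "c < \<epsilon>"
    "\<And>x y m. x \<in> X \<Longrightarrow> y \<in> X \<Longrightarrow> h x = h y \<Longrightarrow> m \<in> \<Omega> \<Longrightarrow> Dmetric (I_map T f (T m x)) (I_map T f (T m y)) \<le> c"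
    using codedE[OF assms(1)] by metis
  show ?thesis
    by (rule codedI[of X h n' c]) (use h assms(2,3) in \<open>auto intro: less_le_trans\<close>)
qed

lemma coded_translate:
  assumes dyn: "dynsys X T" and "coded X T f \<Omega> \<epsilon> n"
  shows "coded X T f ((+) a ` \<Omega>) \<epsilon> n"
proof -
  obtain h c where h: "\<And>x. x \<in> X \<Longrightarrow> h x < n" "c < \<epsilon>"
    "\<And>x y m. x \<in> X \<Longrightarrow> y \<in> X \<Longrightarrow> h x = h y \<Longrightarrow> m \<in> \<Omega> \<Longrightarrow> Dmetric (I_map T f (T m x)) (I_map T f (T m y)) \<le> c"
    using codedE[OF assms(2)] by metis
  show ?thesis
  proof (rule codedI[of X "\<lambda>x. h (T a x)" n c])
    fix x y m assume xy: "x \<in> X" "y \<in> X" "h (T a x) = h (T a y)" "m \<in> (+) a ` \<Omega>"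
    then obtain m' where m': "m' \<in> \<Omega>" "m = m' + a" by (auto simp: add.commute)
    have "Dmetric (I_map T f (T m' (T a x))) (I_map T f (T m' (T a y))) \<le> c"
      using h(3) xy m'(1) dynsys_in[OF dyn] by blast
    then show "Dmetric (I_map T f (T m x)) (I_map T f (T m y)) \<le> c"
      using dynsys_add[OF dyn] xy(1,2) by (simp add: m'(2))
  qed (use h dynsys_in[OF dyn] in auto)
qed

text \<open>Pairs of codes are stored as \<open>h1 * n2 + h2\<close> and recovered by division, so
  that codes remain numbers below the product.\<close>

lemma coded_Un:
  assumes 1: "coded X T f \<Omega>1 \<epsilon> n1" and 2: "coded X T f \<Omega>2 \<epsilon> n2"
  shows "coded X T f (\<Omega>1 \<union> \<Omega>2) \<epsilon> (n1 * n2)"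
proof -
  obtain h1 c1 where h1: "\<And>x. x \<in> X \<Longrightarrow> h1 x < n1" "c1 < \<epsilon>"
    "\<And>x y m. x \<in> X \<Longrightarrow> y \<in> X \<Longrightarrow> h1 x = h1 y \<Longrightarrow> m \<in> \<Omega>1 \<Longrightarrow> Dmetric (I_map T f (T m x)) (I_map T f (T m y)) \<le> c1"
    using codedE[OF 1] by metis
  obtain h2 c2 where h2: "\<And>x. x \<in> X \<Longrightarrow> h2 x < n2" "c2 < \<epsilon>"
    "\<And>x y m. x \<in> X \<Longrightarrow> y \<in> X \<Longrightarrow> h2 x = h2 y \<Longrightarrow> m \<in> \<Omega>2 \<Longrightarrow> Dmetric (I_map T f (T m x)) (I_map T f (T m y)) \<le> c2"
    using codedE[OF 2] by metis
  show ?thesis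
  proof (rule codedI[of X "\<lambda>x. h1 x * n2 + h2 x" _ "max c1 c2"])
    fix x assume x: "x \<in> X"
    have "h1 x * n2 + h2 x < Suc (h1 x) * n2" using h2(1)[OF x] by simp
    also have "\<dots> \<le> n1 * n2" using h1(1)[OF x] by (intro mult_right_mono) auto
    finally show "h1 x * n2 + h2 x < n1 * n2" .
  next
    fix x y m assume xy: "x \<in> X" "y \<in> X" "h1 x * n2 + h2 x = h1 y * n2 + h2 y" "m \<in> \<Omega>1 \<union> \<Omega>2"
    have "(h1 x * n2 + h2 x) div n2 = h1 x" "(h1 y * n2 + h2 y) div n2 = h1 y"
      using h2(1)[OF xy(1)] h2(1)[OF xy(2)] by simp_all
    then have e1: "h1 x = h1 y" using xy(3) by simp
    then have e2: "h2 x = h2 y" using xy(3) by simp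
    show "Dmetric (I_map T f (T m x)) (I_map T f (T m y)) \<le> max c1 c2"
      using xy(4) h1(3)[OF xy(1,2) e1, of m] h2(3)[OF xy(1,2) e2, of m] by auto
  qed (use h1(2) h2(2) in auto)
qed

lemma coded_UN:
  assumes dyn: "dynsys X T" and "finite C" "C \<noteq> {}" "coded X T f \<Omega> \<epsilon> n"
  shows "coded X T f (\<Union>c\<in>C. (+) c ` \<Omega>) \<epsilon> (n ^ card C)"
  using assms(2,3)
proof (induction C rule: finite_ne_induct)
  case (singleton c)
  show ?case using coded_translate[OF dyn assms(4), of c] by simp
next
  case (insert c C)
  then show ?case
    using coded_Un[OF coded_translate[OF dyn assms(4), of c] insert.IH] by simp
qed

lemma coded_cube:
  fixes T :: "int^'k \<Rightarrow> 'a::metric_space \<Rightarrow> 'a"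
  assumes dyn: "dynsys X T" and "coded X T f (cube N) \<epsilon> n" "N \<ge> 1" "n \<ge> 1"
  shows "coded X T f (cube L) \<epsilon> (n ^ ((L div N + 1) ^ CARD('k)))"
proof -
  define C :: "(int^'k) set" where "C = zscale N ` cube (L div N + 1)"
  have C: "finite C" "C \<noteq> {}" unfolding C_def using cube_nonempty[of "L div N + 1"] by auto
  have "card C \<le> card (cube (L div N + 1) :: (int^'k) set)" unfolding C_def by (rule card_image_le) simp
  then have cC: "card C \<le> (L div N + 1) ^ CARD('k)" by (simp only: card_cube)
  have sub: "cube L \<subseteq> (\<Union>c\<in>C. (+) c ` cube N)" using cube_cover[OF assms(3), of L] unfolding C_def by simp
  show ?thesis
    by (rule coded_mono[OF coded_UN[OF dyn C assms(2)] sub]) (intro power_increasing cC assms(4))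
qed

section \<open>Codes compared with open covers\<close>

locale coded_system =
  fixes X :: "'a::metric_space set" and T :: "int^'k \<Rightarrow> 'a \<Rightarrow> 'a" and f :: "'a \<Rightarrow> 'v::real_normed_vector"
    and \<Delta> :: real
  assumes dyn: "dynsys X T" and bdd: "x \<in> X \<Longrightarrow> y \<in> X \<Longrightarrow> norm (f x - f y) \<le> \<Delta>"
begin

abbreviation "Y \<equiv> I_map T f ` X"

lemma shift_I: "x \<in> X \<Longrightarrow> shift m (I_map T f x) = I_map T f (T m x)"
  by (simp add: shift_def I_map_def dynsys_add[OF dyn] fun_eq_iff)

lemma Y_bdd: "u \<in> Y \<Longrightarrow> v \<in> Y \<Longrightarrow> norm (shift m u n - shift m v n) \<le> \<Delta>"
  by (auto simp: shift_def I_map_def intro!: bdd dynsys_in[OF dyn])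

lemma Y_triangle: "u \<in> Y \<Longrightarrow> v \<in> Y \<Longrightarrow> w \<in> Y \<Longrightarrow> Dmetric (shift m u) (shift m w) \<le> Dmetric (shift m u) (shift m v) + Dmetric (shift m v) (shift m w)"
  by (rule Dmetric_triangle[of _ _ \<Delta>]) (auto intro!: Y_bdd)

text \<open>Each fibre is thickened by \<open>r\<close>, a third of the slack between
  \<open>c\<close> and \<epsilon>. The result is open for the Bowen metric and its diameter is at
  most \<open>c + 2 * r < \<epsilon>\<close>.\<close>

lemma open_cover:
  assumes "N \<ge> 1" "coded X T f (cube N) \<epsilon> n"
  shows "\<exists>\<U>. finite \<U> \<and> card \<U> \<le> n \<and> (\<forall>U\<in>\<U>. rho_open Y (bowen shift Dmetric (cube N)) U
     \<and> diam_lt (bowen shift Dmetric (cube N)) U \<epsilon>) \<and> Y \<subseteq> \<Union>\<U>"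
proof -
  define \<rho> where "\<rho> = bowen (shift :: int^'k \<Rightarrow> _) (Dmetric :: _ \<Rightarrow> (int^'k \<Rightarrow> 'v) \<Rightarrow> real) (cube N)"
  have le_iff: "\<rho> u v \<le> c \<longleftrightarrow> (\<forall>m\<in>cube N. Dmetric (shift m u) (shift m v) \<le> c)" for u v c
    unfolding \<rho>_def by (rule bowen_le_iff[OF finite_cube cube_nonempty[OF assms(1)]])
  have sym: "\<rho> u v = \<rho> v u" for u v unfolding \<rho>_def bowen_def by (simp add: Dmetric_commute)
  have refl: "\<rho> u u \<le> 0" for u unfolding le_iff by simp
  have tri: "\<rho> u w \<le> \<rho> u v + \<rho> v w" if "u \<in> Y" "v \<in> Y" "w \<in> Y" for u v w
    unfolding le_iff
  proof
    fix m :: "int^'k" assume m: "m \<in> cube N"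
    have "Dmetric (shift m u) (shift m v) \<le> \<rho> u v" "Dmetric (shift m v) (shift m w) \<le> \<rho> v w"
      using le_iff[of u v "\<rho> u v"] le_iff[of v w "\<rho> v w"] m by auto
    then show "Dmetric (shift m u) (shift m w) \<le> \<rho> u v + \<rho> v w" using Y_triangle[OF that, of m] by linarith
  qed
  obtain h c where h: "\<And>x. x \<in> X \<Longrightarrow> h x < n" "c < \<epsilon>"
    "\<And>x y m. x \<in> X \<Longrightarrow> y \<in> X \<Longrightarrow> h x = h y \<Longrightarrow> m \<in> cube N \<Longrightarrow> Dmetric (I_map T f (T m x)) (I_map T f (T m y)) \<le> c"
    using codedE[OF assms(2)] by metis
  have hc: "\<rho> (I_map T f x) (I_map T f y) \<le> c" if "x \<in> X" "y \<in> X" "h x = h y" for x y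
    unfolding le_iff using h(3)[OF that] that by (simp add: shift_I)
  define r where "r = (\<epsilon> - c) / 3"
  have r: "r > 0" "c + 2 * r < \<epsilon>" using h(2) by (auto simp: r_def field_simps)
  define U where "U i = {v\<in>Y. \<exists>x\<in>X. h x = i \<and> \<rho> (I_map T f x) v < r}" for i
  have op: "rho_open Y \<rho> (U i)" for i
    unfolding rho_open_def
  proof (intro conjI ballI)
    show "U i \<subseteq> Y" by (auto simp: U_def)
    fix v assume "v \<in> U i"
    then obtain x where x: "v \<in> Y" "x \<in> X" "h x = i" "\<rho> (I_map T f x) v < r" by (auto simp: U_def)
    have "w \<in> U i" if "w \<in> Y" "\<rho> v w < r - \<rho> (I_map T f x) v" for w
      using tri[of "I_map T f x" v w] x that unfolding U_def by force
    then show "\<exists>r>0. \<forall>w\<in>Y. \<rho> v w < r \<longrightarrow> w \<in> U i"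
      using x(4) by (intro exI[of _ "r - \<rho> (I_map T f x) v"]) auto
  qed
  have dm: "diam_lt \<rho> (U i) \<epsilon>" for i
    unfolding diam_lt_def
  proof (intro exI[of _ "c + 2 * r"] conjI ballI r(2))
    fix v w assume "v \<in> U i" "w \<in> U i"
    then obtain x y where x: "v \<in> Y" "x \<in> X" "h x = i" "\<rho> (I_map T f x) v < r"
      and y: "w \<in> Y" "y \<in> X" "h y = i" "\<rho> (I_map T f y) w < r" by (auto simp: U_def)
    have "\<rho> v w \<le> \<rho> v (I_map T f x) + \<rho> (I_map T f x) w" using x y by (intro tri) auto
    also have "\<rho> (I_map T f x) w \<le> \<rho> (I_map T f x) (I_map T f y) + \<rho> (I_map T f y) w" using x y by (intro tri) auto
    finally show "\<rho> v w \<le> c + 2 * r" using hc[of x y] x y sym[of v "I_map T f x"] by simp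
  qed
  have cov: "Y \<subseteq> \<Union>(U ` {..<n})"
  proof
    fix v assume "v \<in> Y"
    then obtain x where x: "x \<in> X" "v = I_map T f x" by blast
    have "v \<in> U (h x)" using x refl[of v] r(1) unfolding U_def by force
    then show "v \<in> \<Union>(U ` {..<n})" using h(1)[OF x(1)] by blast
  qed
  have "card (U ` {..<n}) \<le> n" using card_image_le[of "{..<n}" U] by simp
  then show ?thesis using op dm cov unfolding \<rho>_def[symmetric] by (intro exI[of _ "U ` {..<n}"]) auto
qed

lemma cover_num_le:
  assumes "N \<ge> 1" "coded X T f (cube N) \<epsilon> n"
  shows "cover_num Y \<epsilon> (bowen shift Dmetric (cube N)) \<le> n"
proof -
  obtain \<U> where U: "finite \<U>" "card \<U> \<le> n" "\<forall>U\<in>\<U>. rho_open Y (bowen shift Dmetric (cube N)) U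
     \<and> diam_lt (bowen shift Dmetric (cube N)) U \<epsilon>" "Y \<subseteq> \<Union>\<U>"
    using open_cover[OF assms] by (elim exE conjE) (rule that)
  have "cover_num Y \<epsilon> (bowen shift Dmetric (cube N)) \<le> card \<U>"
    unfolding cover_num_def by (rule Least_le) (use U in blast)
  then show ?thesis using U(2) by linarith
qed

text \<open>The converse direction: label each point by a member of a minimal cover containing its
  image. The given code ensures that some finite cover exists, so that the \<open>LEAST\<close> is
  attained.\<close>

lemma coded_cover_num:
  assumes N: "N \<ge> 1" and ex: "coded X T f (cube N) \<epsilon> n0"
  shows "coded X T f (cube N) \<epsilon> (cover_num Y \<epsilon> (bowen shift Dmetric (cube N)))"
proof -
  define \<rho> where "\<rho> = bowen (shift :: int^'k \<Rightarrow> _) (Dmetric :: _ \<Rightarrow> (int^'k \<Rightarrow> 'v) \<Rightarrow> real) (cube N)"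
  have le_iff: "\<rho> u v \<le> c \<longleftrightarrow> (\<forall>m\<in>cube N. Dmetric (shift m u) (shift m v) \<le> c)" for u v c
    unfolding \<rho>_def by (rule bowen_le_iff[OF finite_cube cube_nonempty[OF N]])
  define P where "P n \<longleftrightarrow> (\<exists>\<U>. finite \<U> \<and> card \<U> = n \<and> (\<forall>U\<in>\<U>. rho_open Y \<rho> U \<and> diam_lt \<rho> U \<epsilon>) \<and> Y \<subseteq> \<Union>\<U>)" for n
  have "\<exists>n. P n" using open_cover[OF N ex] unfolding P_def \<rho>_def[symmetric] by blast
    then have "P (Least P)" by (rule LeastI_ex)
    moreover have "cover_num Y \<epsilon> \<rho> = Least P" unfolding cover_num_def P_def ..
    ultimately obtain \<U> where U: "finite \<U>" "card \<U> = cover_num Y \<epsilon> \<rho>" "\<And>U. U \<in> \<U> \<Longrightarrow> diam_lt \<rho> U \<epsilon>" "Y \<subseteq> \<Union>\<U>"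
      unfolding P_def by auto
    obtain g where g: "bij_betw g \<U> {0..<card \<U>}" using ex_bij_betw_finite_nat[OF U(1)] by blast
    have "\<forall>x\<in>X. \<exists>V. V \<in> \<U> \<and> I_map T f x \<in> V" using U(4) by blast
    then obtain V where V: "\<And>x. x \<in> X \<Longrightarrow> V x \<in> \<U>" "\<And>x. x \<in> X \<Longrightarrow> I_map T f x \<in> V x" by metis
    have "\<forall>U\<in>\<U>. \<exists>c<\<epsilon>. \<forall>u\<in>U. \<forall>v\<in>U. \<rho> u v \<le> c" using U(3) unfolding diam_lt_def by blast
    then obtain cc where cc: "\<And>U. U \<in> \<U> \<Longrightarrow> cc U < \<epsilon>" "\<And>U u v. U \<in> \<U> \<Longrightarrow> u \<in> U \<Longrightarrow> v \<in> U \<Longrightarrow> \<rho> u v \<le> cc U"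
      by metis
    \<comment> \<open>Finitely many diameter bounds below \<epsilon> have a common one;
      \<open>\<epsilon> - 1\<close> keeps the set nonempty if the cover is empty.\<close>
    define c where "c = Max (insert (\<epsilon> - 1) (cc ` \<U>))"
    have c: "c < \<epsilon>" unfolding c_def using U(1) cc(1) by (subst Max_less_iff) auto
    have ccc: "cc U \<le> c" if "U \<in> \<U>" for U unfolding c_def using U(1) that by (intro Max_ge) auto
    show ?thesis unfolding \<rho>_def[symmetric]
    proof (rule codedI[of X "\<lambda>x. g (V x)" _ c])
      fix x assume "x \<in> X"
      then show "g (V x) < cover_num Y \<epsilon> \<rho>" using bij_betwE[OF g] V(1) U(2) by auto
    next
      fix x y and m :: "int^'k" assume a: "x \<in> X" "y \<in> X" "g (V x) = g (V y)" "m \<in> cube N"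
      have "V x = V y" using g a V(1) unfolding bij_betw_def inj_on_def by blast
      then have "\<rho> (I_map T f x) (I_map T f y) \<le> cc (V x)" using V a by (intro cc(2)) auto
      also have "\<dots> \<le> c" using ccc V(1) a(1) by blast
      finally show "Dmetric (I_map T f (T m x)) (I_map T f (T m y)) \<le> c"
        unfolding le_iff using a by (simp add: shift_I)
    qed (rule c)
qed

text \<open>The limit is the infimum of the normalized logarithms, so a code on a single cube bounds
  it from above. This is what lets genericity be tested on finite windows.\<close>

lemma S_ent_le:
  assumes ne: "X \<noteq> {}" and N: "N \<ge> 1" and cod: "coded X T f (cube N) \<epsilon> n"
  shows "S_ent shift Y \<epsilon> Dmetric \<le> ln (real n) / real N ^ CARD('k)"
proof -
  have pos: "m \<ge> 1" if "coded X T f \<Omega> \<epsilon> m" for m \<Omega>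
    using that ne unfolding coded_def by fastforce
  define cn where "cn L = cover_num Y \<epsilon> (bowen shift Dmetric (cube L))" for L
  have ex: "coded X T f (cube L) \<epsilon> (cn L)" if "L \<ge> 1" for L
    unfolding cn_def by (rule coded_cover_num[OF that coded_cube[OF dyn cod N pos[OF cod]]])
  define a where "a L = ln (real (cn L))" for L
  have a0: "a L \<ge> 0" for L unfolding a_def by (cases "cn L = 0") auto
  have sub: "a L \<le> real (L div M' + 1) ^ CARD('k) * a M'" if "M' \<ge> 1" "L \<ge> 1" for L M'
  proof -
    have "cn L \<le> cn M' ^ ((L div M' + 1) ^ CARD('k))"
      unfolding cn_def[of L] by (rule cover_num_le[OF that(2) coded_cube[OF dyn ex[OF that(1)] that(1) pos[OF ex[OF that(1)]]]])
    then have "real (cn L) \<le> real (cn M') ^ ((L div M' + 1) ^ CARD('k))"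
      by (metis of_nat_le_iff of_nat_power)
    then have "ln (real (cn L)) \<le> ln (real (cn M') ^ ((L div M' + 1) ^ CARD('k)))"
      using pos[OF ex[OF that(2)]] by (intro ln_mono) auto
    also have "\<dots> = real ((L div M' + 1) ^ CARD('k)) * ln (real (cn M'))"
      using pos[OF ex[OF that(1)]] by (simp add: ln_realpow)
    finally show ?thesis unfolding a_def by (simp only: of_nat_power)
  qed
  obtain l where l: "(\<lambda>L. a L / real L ^ CARD('k)) \<longlonglongrightarrow> l" "\<And>N. N \<ge> 1 \<Longrightarrow> l \<le> a N / real N ^ CARD('k)"
    using subadditive_cubes[of a "CARD('k)", OF a0 sub] by blast
  have "S_ent shift Y \<epsilon> Dmetric = l"
    unfolding S_ent_def using limI[OF l(1)] by (simp add: a_def cn_def)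
  also have "\<dots> \<le> a N / real N ^ CARD('k)" by (rule l(2)[OF N])
  also have "\<dots> \<le> ln (real n) / real N ^ CARD('k)"
    unfolding a_def using cover_num_le[OF N cod] pos[OF ex[OF N]]
    by (intro divide_right_mono ln_mono) (auto simp: cn_def)
  finally show ?thesis .
qed

end

section \<open>Lipschitz partitions, tile weights and codes\<close>

lemma continuous_on_fst_snd:
  assumes "continuous_on X g"
  shows "continuous_on (X \<times> X) (\<lambda>p. g (fst p))" "continuous_on (X \<times> X) (\<lambda>p. g (snd p))"
  by (rule continuous_on_compose2[OF assms]; force intro: continuous_intros)+

text \<open>Quantitative form of the \<epsilon>-embedding. Pairs at Bowen distance at least
  \<epsilon> form a compact set on which the images differ, so the distance of the images has a
  positive minimum there.\<close>

lemma eps_map_separates: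
  fixes T :: "int^'k \<Rightarrow> 'a::metric_space \<Rightarrow> 'a"
  assumes dyn: "dynsys X T" and phi: "eps_map X T \<Omega> \<epsilon> S \<phi>" and \<Omega>: "finite \<Omega>" and m: "\<Union>S \<subseteq> {..<m}"
  shows "\<exists>\<rho>>0. \<forall>x\<in>X. \<forall>y\<in>X. (\<Sum>i<m. \<bar>\<phi> x i - \<phi> y i\<bar>) < \<rho> \<longrightarrow> (\<forall>n\<in>\<Omega>. dist (T n x) (T n y) < \<epsilon>)"
proof -
  have XX: "compact (X \<times> X)" using dynsys_compact[OF dyn] by (intro compact_Times)
  define d where "d p = (\<Sum>i<m. \<bar>\<phi> (fst p) i - \<phi> (snd p) i\<bar>)" for p
  have d: "continuous_on (X \<times> X) d"
    unfolding d_def by (intro continuous_intros continuous_on_fst_snd eps_mapD(2)[OF phi])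
  define Z where "Z = (\<Union>n\<in>\<Omega>. {p\<in>X \<times> X. \<epsilon> \<le> dist (T n (fst p)) (T n (snd p))})"
  have "closed Z" unfolding Z_def
    by (intro closed_UN \<Omega> ballI continuous_on_closed_Collect_le continuous_intros continuous_on_fst_snd dynsys_cont[OF dyn]
        compact_imp_closed XX)
  then have "compact ((X \<times> X) \<inter> Z)" by (rule compact_Int_closed[OF XX])
  moreover have ZX: "(X \<times> X) \<inter> Z = Z" unfolding Z_def by blast
  ultimately have Z: "compact Z" by simp
  have pos: "d p > 0" if p: "p \<in> Z" for p
  proof (rule ccontr)
    assume "\<not> d p > 0"
    moreover have "d p \<ge> 0" unfolding d_def by (intro sum_nonneg) auto
    ultimately have "d p = 0" by simp
    then have eq: "\<forall>i<m. \<phi> (fst p) i = \<phi> (snd p) i" unfolding d_def by (subst (asm) sum_nonneg_eq_0_iff) auto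
    have X: "fst p \<in> X" "snd p \<in> X" using p unfolding Z_def by auto
    have z: "\<phi> x i = 0" if "x \<in> X" "\<not> i < m" for x i
    proof -
      have "{i. \<phi> x i \<noteq> 0} \<in> S" using eps_mapD(3)[OF phi that(1)] by (simp add: realization_def)
      then show ?thesis using m that(2) by blast
    qed
    have "\<phi> (fst p) i = \<phi> (snd p) i" for i using eq z[OF X(1)] z[OF X(2)] by (cases "i < m") auto
    then have e: "\<phi> (fst p) = \<phi> (snd p)" by blast
    obtain n where n: "n \<in> \<Omega>" "\<epsilon> \<le> dist (T n (fst p)) (T n (snd p))" using p unfolding Z_def by blast
    obtain c where "c < \<epsilon>" "\<forall>x\<in>X. \<forall>y\<in>X. \<phi> x = \<phi> (fst p) \<longrightarrow> \<phi> y = \<phi> (fst p) \<longrightarrow> (\<forall>n\<in>\<Omega>. dist (T n x) (T n y) \<le> c)"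
      using eps_mapD(4)[OF phi] by blast
    then have "dist (T n (fst p)) (T n (snd p)) < \<epsilon>" using X e n(1) by fastforce
    then show False using n(2) by simp
  qed
  have "\<exists>\<rho>>0. \<forall>p\<in>Z. \<rho> \<le> d p"
  proof (cases "Z = {}")
    case True
    then show ?thesis by (intro exI[of _ 1]) auto
  next
    case False
    have "continuous_on Z d" by (rule continuous_on_subset[OF d]) (use ZX in blast)
    then obtain p where "p \<in> Z" "\<And>q. q \<in> Z \<Longrightarrow> d p \<le> d q" using continuous_attains_inf[OF Z False] by blast
    then show ?thesis using pos by blast
  qed
  then obtain \<rho> where \<rho>: "\<rho> > 0" "\<And>p. p \<in> Z \<Longrightarrow> \<rho> \<le> d p" by blast
  show ?thesis
  proof (intro exI[of _ \<rho>] conjI ballI impI \<rho>(1))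
    fix x y n assume a: "x \<in> X" "y \<in> X" "(\<Sum>i<m. \<bar>\<phi> x i - \<phi> y i\<bar>) < \<rho>" "n \<in> \<Omega>"
    then have "(x, y) \<notin> Z" using \<rho>(2)[of "(x, y)"] by (auto simp: d_def)
    then show "dist (T n x) (T n y) < \<epsilon>" using a unfolding Z_def by (simp add: not_le)
  qed
qed

text \<open>With sums s and s', the difference of the quotients is ((b_j - b'_j) + (b'_j / s') (s' -
  s)) / s, where b'_j / s' lies in [0,1]. Only the lower bound on the sums enters the
  constant.\<close>

lemma normalized_lipschitz:
  fixes b b' :: "nat \<Rightarrow> real"
  assumes lip: "\<And>i. i < J \<Longrightarrow> \<bar>b i - b' i\<bar> \<le> d" and b': "\<And>i. 0 \<le> b' i"
    and low: "c \<le> (\<Sum>i<J. b i)" "c \<le> (\<Sum>i<J. b' i)" and c: "c > 0" and j: "j < J"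
  shows "\<bar>b j / (\<Sum>i<J. b i) - b' j / (\<Sum>i<J. b' i)\<bar> \<le> (real J + 1) / c * d"
proof -
  define s where "s = (\<Sum>i<J. b i)"
  define s' where "s' = (\<Sum>i<J. b' i)"
  have s: "s > 0" "s' > 0" using low c by (auto simp: s_def s'_def)
  have d0: "d \<ge> 0" using lip[OF j] by linarith
  have ss: "\<bar>s' - s\<bar> \<le> real J * d"
  proof -
    have "\<bar>s' - s\<bar> \<le> (\<Sum>i<J. \<bar>b' i - b i\<bar>)" unfolding s_def s'_def sum_subtractf[symmetric] by (rule sum_abs)
    also have "\<dots> \<le> (\<Sum>i<J. d)" using lip by (intro sum_mono) (auto simp: abs_minus_commute)
    finally show ?thesis by simp
  qed
  have frac: "0 \<le> b' j / s'" "b' j / s' \<le> 1"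
    using b' s member_le_sum[of j "{..<J}" b'] j by (auto simp: s'_def)
  have "b j / s - b' j / s' = ((b j - b' j) + (b' j / s') * (s' - s)) / s"
    using s by (simp add: field_simps)
  also have "\<bar>\<dots>\<bar> = \<bar>(b j - b' j) + (b' j / s') * (s' - s)\<bar> / s" using s by (simp add: abs_divide)
  also have "\<dots> \<le> (d + 1 * (real J * d)) / s"
  proof (intro divide_right_mono)
    have "\<bar>(b' j / s') * (s' - s)\<bar> \<le> 1 * (real J * d)" unfolding abs_mult using frac ss by (intro mult_mono) auto
    then show "\<bar>(b j - b' j) + (b' j / s') * (s' - s)\<bar> \<le> d + 1 * (real J * d)" using lip[OF j] by linarith
  qed (use s in auto)
  also have "\<dots> \<le> (d + 1 * (real J * d)) / c"
    using low c d0 by (intro divide_left_mono) (auto simp: s_def)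
  also have "\<dots> = (real J + 1) / c * d" by (simp add: field_simps)
  finally show ?thesis unfolding s_def s'_def .
qed

text \<open>Lipschitz dependence on \<phi>, and not just continuity, is the point: quantizing \<phi>
  with mesh 1/q then costs an error of order 1/q, so the number of codes has the dimension of the
  complex as its exponent.\<close>

lemma lipschitz_partition:
  fixes T :: "int^'k \<Rightarrow> 'a::metric_space \<Rightarrow> 'a" and f :: "'a \<Rightarrow> 'v::real_normed_vector"
  assumes dyn: "dynsys X T" and f: "continuous_on X f" and md: "mdim T X dist < ereal D" and r: "r > 0"
  shows "\<exists>N S \<phi> J \<gamma> (v :: int^'k \<Rightarrow> nat \<Rightarrow> 'v) C. N \<ge> 1 \<and> simplicial_complex S \<and> real (sc_dim S) < D * real N ^ CARD('k) \<and>
     (\<forall>x\<in>X. \<phi> x \<in> realization S) \<and> (\<forall>j. continuous_on X (\<lambda>x. \<gamma> j (\<phi> x))) \<and> C \<ge> 0 \<and>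
     (\<forall>x\<in>X. \<forall>j::nat. 0 \<le> \<gamma> j (\<phi> x)) \<and> (\<forall>x\<in>X. (\<Sum>j<J. \<gamma> j (\<phi> x)) = (1::real)) \<and>
     (\<forall>n. \<forall>j<J. v n j \<in> f ` X) \<and>
     (\<forall>x\<in>X. \<forall>n\<in>cube N. \<forall>j<J. \<gamma> j (\<phi> x) \<noteq> 0 \<longrightarrow> norm (v n j - f (T n x)) \<le> r) \<and>
     (\<forall>x\<in>X. \<forall>y\<in>X. \<forall>h. \<forall>j<J. (\<forall>i. \<bar>\<phi> x i - \<phi> y i\<bar> \<le> h) \<longrightarrow> \<bar>\<gamma> j (\<phi> x) - \<gamma> j (\<phi> y)\<bar> \<le> C * h)"
proof -
  have "uniformly_continuous_on X f" by (rule compact_uniformly_continuous[OF f dynsys_compact[OF dyn]])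
  then obtain \<delta> where \<delta>: "\<delta> > 0" "\<And>x y. x \<in> X \<Longrightarrow> y \<in> X \<Longrightarrow> dist x y < \<delta> \<Longrightarrow> dist (f x) (f y) < r"
    using r unfolding uniformly_continuous_on_def by metis
  obtain N S \<phi> where N: "N \<ge> 1" and phi: "eps_map X T (cube N) \<delta> S \<phi>" and dim: "real (sc_dim S) < D * real N ^ CARD('k)"
    using mdim_properties(2)[OF dyn \<delta>(1) md] by blast
  note S = eps_mapD(1)[OF phi]
  obtain m where m: "\<Union>S \<subseteq> {..<m}" using S simplicial_complex_bounded by blast
  obtain \<rho> where \<rho>: "\<rho> > 0" "\<And>x y n. x \<in> X \<Longrightarrow> y \<in> X \<Longrightarrow> (\<Sum>i<m. \<bar>\<phi> x i - \<phi> y i\<bar>) < \<rho> \<Longrightarrow> n \<in> cube N \<Longrightarrow> dist (T n x) (T n y) < \<delta>"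
    using eps_map_separates[OF dyn phi finite_cube m] by blast
  have "\<exists>\<delta>'>0. \<forall>x\<in>X. \<forall>y\<in>X. dist x y < \<delta>' \<longrightarrow> (\<Sum>i<m. \<bar>\<phi> x i - \<phi> y i\<bar>) < \<rho> / 2"
  proof -
    have "\<exists>\<delta>'>0. \<forall>x\<in>X. \<forall>y\<in>X. dist x y < \<delta>' \<longrightarrow> \<bar>\<phi> x i - \<phi> y i\<bar> < \<rho> / (2 * (real m + 1))" for i
    proof -
      have "uniformly_continuous_on X (\<lambda>x. \<phi> x i)"
        by (rule compact_uniformly_continuous[OF eps_mapD(2)[OF phi] dynsys_compact[OF dyn]])
      then obtain d where d: "d > 0" "\<forall>x\<in>X. \<forall>y\<in>X. dist y x < d \<longrightarrow> dist (\<phi> y i) (\<phi> x i) < \<rho> / (2 * (real m + 1))"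
        using \<rho>(1) unfolding uniformly_continuous_on_def
        by (metis divide_pos_pos mult_pos_pos of_nat_0_le_iff add_nonneg_pos zero_less_numeral zero_less_one)
      then show ?thesis by (intro exI[of _ d]) (auto simp: dist_real_def)
    qed
    then obtain dd where dd: "\<And>i. dd i > 0" "\<And>i x y. x \<in> X \<Longrightarrow> y \<in> X \<Longrightarrow> dist x y < dd i \<Longrightarrow> \<bar>\<phi> x i - \<phi> y i\<bar> < \<rho> / (2 * (real m + 1))"
      by metis
    define d where "d = Min (insert 1 (dd ` {..<m}))"
    have d: "d > 0" "\<And>i. i < m \<Longrightarrow> d \<le> dd i" unfolding d_def using dd(1) by auto
    have "(\<Sum>i<m. \<bar>\<phi> x i - \<phi> y i\<bar>) < \<rho> / 2" if "x \<in> X" "y \<in> X" "dist x y < d" for x y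
    proof -
      have "(\<Sum>i<m. \<bar>\<phi> x i - \<phi> y i\<bar>) \<le> (\<Sum>i<m. \<rho> / (2 * (real m + 1)))"
        using dd(2)[OF that(1,2)] d(2) that(3) by (intro sum_mono) (meson less_imp_le less_le_trans lessThan_iff)
      also have "\<dots> < \<rho> / 2" using \<rho>(1) by (simp add: field_simps)
      finally show ?thesis .
    qed
    then show ?thesis using d(1) by blast
  qed
  then obtain \<delta>' where \<delta>': "\<delta>' > 0" "\<And>x y. x \<in> X \<Longrightarrow> y \<in> X \<Longrightarrow> dist x y < \<delta>' \<Longrightarrow> (\<Sum>i<m. \<bar>\<phi> x i - \<phi> y i\<bar>) < \<rho> / 2"
    by blast
  obtain k where k: "k \<subseteq> X" "finite k" "X \<subseteq> (\<Union>x\<in>k. ball x \<delta>')"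
    by (rule compactE_image[OF dynsys_compact[OF dyn], of X "\<lambda>x. ball x \<delta>'"]) (use \<delta>'(1) in auto)
  obtain xs where xs: "set xs = k" using k(2) finite_list by blast
  define J where "J = length xs"
  \<comment> \<open>The support radius \<rho> is the scale at which closeness of images controls the
    Bowen distance. The sample points are so dense that some bump is at least \<rho>/2 at every
    point, which bounds the normalizing sum below.\<close>
  define b where "b j t = max 0 (\<rho> - (\<Sum>i<m. \<bar>t i - \<phi> (xs ! j) i\<bar>))" for j and t :: "nat \<Rightarrow> real"
  define \<gamma> where "\<gamma> j t = b j t / (\<Sum>i<J. b i t)" for j t
  define v where "v n j = f (T n (xs ! j))" for n j
  define C where "C = (real J + 1) / (\<rho> / 2) * real m"
  have xsX: "xs ! j \<in> X" if "j < J" for j using that xs k(1) by (auto simp: J_def)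
  have b0: "0 \<le> b j t" for j t by (simp add: b_def)
  have low: "\<rho> / 2 \<le> (\<Sum>j<J. b j (\<phi> x))" if x: "x \<in> X" for x
  proof -
    obtain z where z: "z \<in> k" "dist z x < \<delta>'" using k(3) x by auto
    then obtain j where j: "j < J" "xs ! j = z" using xs unfolding J_def by (metis in_set_conv_nth)
    have "(\<Sum>i<m. \<bar>\<phi> x i - \<phi> z i\<bar>) < \<rho> / 2" using \<delta>'(2)[OF x, of z] z k(1) by (auto simp: dist_commute)
    then have "\<rho> / 2 \<le> b j (\<phi> x)" unfolding b_def j(2) by linarith
    also have "\<dots> \<le> (\<Sum>j<J. b j (\<phi> x))" using j b0 by (intro member_le_sum) auto
    finally show ?thesis .
  qed
  have bcont: "continuous_on X (\<lambda>x. b j (\<phi> x))" for j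
    unfolding b_def by (intro continuous_intros eps_mapD(2)[OF phi])
  show ?thesis
  proof (rule exI[of _ N], rule exI[of _ S], rule exI[of _ \<phi>], rule exI[of _ J], rule exI[of _ \<gamma>], rule exI[of _ v],
      rule exI[of _ C], intro conjI ballI allI impI)
    show "1 \<le> N" by (rule N)
    show "simplicial_complex S" by (rule S)
    show "real (sc_dim S) < D * real N ^ CARD('k)" by (rule dim)
    show "\<phi> x \<in> realization S" if "x \<in> X" for x using eps_mapD(3)[OF phi that] .
    show "continuous_on X (\<lambda>x. \<gamma> j (\<phi> x))" for j
      unfolding \<gamma>_def
    proof (intro continuous_intros bcont ballI)
      fix x assume "x \<in> X"
      then show "(\<Sum>i<J. b i (\<phi> x)) \<noteq> 0" using low[of x] \<rho>(1) by auto
    qed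
    show "0 \<le> C" using \<rho>(1) by (simp add: C_def)
    show "0 \<le> \<gamma> j (\<phi> x)" for x j unfolding \<gamma>_def by (intro divide_nonneg_nonneg sum_nonneg b0)
    show "(\<Sum>j<J. \<gamma> j (\<phi> x)) = 1" if "x \<in> X" for x
      using low[OF that] \<rho>(1) unfolding \<gamma>_def sum_divide_distrib[symmetric] by simp
    show "v n j \<in> f ` X" if "j < J" for n j unfolding v_def using dynsys_in[OF dyn xsX[OF that]] by blast
  next
    fix x j and n :: "int^'k" assume a: "x \<in> X" "n \<in> cube N" "j < J" "\<gamma> j (\<phi> x) \<noteq> 0"
    have "b j (\<phi> x) \<noteq> 0" using a(4) by (auto simp: \<gamma>_def)
    then have "(\<Sum>i<m. \<bar>\<phi> x i - \<phi> (xs ! j) i\<bar>) < \<rho>" by (auto simp: b_def max_def split: if_splits)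
    then have "dist (T n x) (T n (xs ! j)) < \<delta>" using \<rho>(2)[OF a(1) xsX[OF a(3)]] a(2) by blast
    then have "dist (f (T n x)) (f (T n (xs ! j))) < r" using \<delta>(2) dynsys_in[OF dyn] a xsX by blast
    then show "norm (v n j - f (T n x)) \<le> r" by (simp add: v_def dist_norm norm_minus_commute)
  next
    fix x y h j assume a: "x \<in> X" "y \<in> X" "j < J" "\<forall>i. \<bar>\<phi> x i - \<phi> y i\<bar> \<le> h"
    have lip: "\<bar>b i (\<phi> x) - b i (\<phi> y)\<bar> \<le> real m * h" for i
    proof -
      have "\<bar>(\<Sum>l<m. \<bar>\<phi> x l - \<phi> (xs ! i) l\<bar>) - (\<Sum>l<m. \<bar>\<phi> y l - \<phi> (xs ! i) l\<bar>)\<bar>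
          \<le> (\<Sum>l<m. \<bar>\<bar>\<phi> x l - \<phi> (xs ! i) l\<bar> - \<bar>\<phi> y l - \<phi> (xs ! i) l\<bar>\<bar>)"
        unfolding sum_subtractf[symmetric] by (rule sum_abs)
      also have "\<dots> \<le> (\<Sum>l<m. h)"
      proof (rule sum_mono)
        fix l
        have "\<bar>\<phi> x l - \<phi> y l\<bar> \<le> h" using a(4) by blast
        then show "\<bar>\<bar>\<phi> x l - \<phi> (xs ! i) l\<bar> - \<bar>\<phi> y l - \<phi> (xs ! i) l\<bar>\<bar> \<le> h" by linarith
      qed
      finally have "\<bar>(\<Sum>l<m. \<bar>\<phi> x l - \<phi> (xs ! i) l\<bar>) - (\<Sum>l<m. \<bar>\<phi> y l - \<phi> (xs ! i) l\<bar>)\<bar> \<le> real m * h" by simp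
      then show ?thesis unfolding b_def by linarith
    qed
    have "\<bar>\<gamma> j (\<phi> x) - \<gamma> j (\<phi> y)\<bar> \<le> (real J + 1) / (\<rho> / 2) * (real m * h)"
      unfolding \<gamma>_def using \<rho>(1) by (intro normalized_lipschitz lip b0 low a) auto
    then show "\<bar>\<gamma> j (\<phi> x) - \<gamma> j (\<phi> y)\<bar> \<le> C * h" by (simp add: C_def mult.assoc)
  qed
qed

text \<open>\<open>T (- n) x \<in> B\<close> means that \<open>x\<close> occupies position
  \<open>n\<close> of a tile. With \<open>b\<close> vanishing exactly on \<open>B\<close>, the
  product over the other positions vanishes as soon as one of them is occupied. By disjointness at
  most one is, so the products have positive sum and can be normalized.\<close>

lemma tile_weights:
  fixes T :: "int^'k \<Rightarrow> 'a::metric_space \<Rightarrow> 'a"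
  assumes dyn: "dynsys X T" and N: "N \<ge> 1" and B: "closed B"
    and disj': "\<forall>x\<in>X. \<forall>a a' m. T a x \<in> B \<longrightarrow> T a' x \<in> B \<longrightarrow> m - a \<in> cube N \<longrightarrow> m - a' \<in> cube N \<longrightarrow> a = a'"
  shows "\<exists>w :: int^'k \<Rightarrow> 'a \<Rightarrow> real. (\<forall>n. continuous_on X (w n)) \<and> (\<forall>n. \<forall>x\<in>X. 0 \<le> w n x) \<and>
     (\<forall>x\<in>X. (\<Sum>n\<in>cube N. w n x) = 1) \<and> (\<forall>x\<in>X. \<forall>n\<in>cube N. T (- n) x \<in> B \<longrightarrow> w n x = 1)"
proof -
  have disj: "a = a'" if "x \<in> X" "T a x \<in> B" "T a' x \<in> B" "m - a \<in> cube N" "m - a' \<in> cube N" for x a a' m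
    using disj' that by blast
  define b where "b y = (if B = {} then 1 else infdist y B)" for y
  have b0: "b y \<ge> 0" for y by (simp add: b_def infdist_nonneg)
  have bB: "b y = 0 \<longleftrightarrow> y \<in> B" for y
    using in_closed_iff_infdist_zero[OF B, of y] by (cases "B = {}") (auto simp: b_def)
  have bc: "continuous_on X b" unfolding b_def by (cases "B = {}") (auto intro!: continuous_intros)
  define p where "p n x = (\<Prod>n'\<in>cube N - {n}. b (T (- n') x))" for n x
  define w where "w n x = p n x / (\<Sum>n\<in>cube N. p n x)" for n x
  have p0: "p n x \<ge> 0" for n x unfolding p_def by (intro prod_nonneg b0)
  have pz: "p n' x = 0" if "n \<in> cube N" "T (- n) x \<in> B" "n' \<noteq> n" for n n' x
    unfolding p_def using that bB by (intro prod_zero) auto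
  have ppos: "p n x > 0" if "x \<in> X" "n \<in> cube N" "\<And>n'. n' \<in> cube N \<Longrightarrow> n' \<noteq> n \<Longrightarrow> T (- n') x \<notin> B" for n x
    unfolding p_def using that bB b0 by (intro prod_pos) (metis DiffE insertI1 order_le_less)
  have sumpos: "(\<Sum>n\<in>cube N. p n x) > 0" if x: "x \<in> X" for x
  proof -
    obtain n where n: "n \<in> cube N" "\<And>n'. n' \<in> cube N \<Longrightarrow> n' \<noteq> n \<Longrightarrow> T (- n') x \<notin> B"
    proof (cases "\<exists>n\<in>cube N. T (- n) x \<in> B")
      case True
      then obtain n where n: "n \<in> cube N" "T (- n) x \<in> B" by blast
      have "n' = n" if "n' \<in> cube N" "T (- n') x \<in> B" for n'
        using disj[OF x that(2) n(2), of 0] that(1) n(1) by simp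
      then show ?thesis using n(1) that by blast
    next
      case False
      then show ?thesis using zero_in_cube[OF N] that by blast
    qed
    have "0 < p n x" by (rule ppos[OF x n])
    also have "p n x \<le> (\<Sum>n\<in>cube N. p n x)" using n(1) p0 by (intro member_le_sum) auto
    finally show ?thesis .
  qed
  have pc: "continuous_on X (p n)" for n
    unfolding p_def by (intro continuous_intros dynsys_cont_comp[OF dyn bc])
  show ?thesis
  proof (intro exI[of _ w] conjI allI ballI impI)
    show "continuous_on X (w n)" for n
      unfolding w_def using sumpos by (intro continuous_intros pc) (metis less_irrefl)
    show "0 \<le> w n x" if "x \<in> X" for n x unfolding w_def by (intro divide_nonneg_nonneg sum_nonneg p0)
    show "(\<Sum>n\<in>cube N. w n x) = 1" if "x \<in> X" for x
      using sumpos[OF that] unfolding w_def sum_divide_distrib[symmetric] by simp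
    fix x n assume a: "x \<in> X" "n \<in> cube N" "T (- n) x \<in> B"
    have "(\<Sum>n\<in>cube N. p n x) = p n x + (\<Sum>n'\<in>cube N - {n}. p n' x)"
      by (rule sum.remove[OF finite_cube a(2)])
    also have "(\<Sum>n'\<in>cube N - {n}. p n' x) = 0" using pz[OF a(2,3)] by (intro sum.neutral) auto
    finally show "w n x = 1" using sumpos[OF a(1)] unfolding w_def by simp
  qed
qed

section \<open>Quantization and counting of codes\<close>

definition mesh_code :: "nat \<Rightarrow> 'i set \<Rightarrow> ('i \<Rightarrow> real) \<Rightarrow> 'i \<Rightarrow> nat" where
  "mesh_code q I t = restrict (\<lambda>i. nat \<lfloor>t i * real q\<rfloor>) I"

lemma mesh_code_range:
  assumes "\<And>i. i \<in> I \<Longrightarrow> 0 \<le> t i \<and> t i \<le> 1"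
  shows "mesh_code q I t \<in> PiE I (\<lambda>_. {..q})"
proof -
  have "nat \<lfloor>t i * real q\<rfloor> \<le> q" if "i \<in> I" for i
  proof -
    have "t i * real q \<le> 1 * real q" using assms[OF that] by (intro mult_right_mono) auto
    then show ?thesis by linarith
  qed
  then show ?thesis by (auto simp: mesh_code_def)
qed

lemma mesh_code_close:
  assumes "mesh_code q I t = mesh_code q I t'" "i \<in> I" "0 \<le> t i" "0 \<le> t' i" "q \<ge> 1"
  shows "\<bar>t i - t' i\<bar> \<le> 1 / real q"
proof -
  have "nat \<lfloor>t i * real q\<rfloor> = nat \<lfloor>t' i * real q\<rfloor>"
    using fun_cong[OF assms(1), of i] assms(2) by (simp add: mesh_code_def)
  moreover have "0 \<le> t i * real q" "0 \<le> t' i * real q" using assms by auto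
  ultimately have "\<bar>t i * real q - t' i * real q\<bar> \<le> 1" by linarith
  then have "\<bar>t i - t' i\<bar> * real q \<le> 1" by (simp add: left_diff_distrib[symmetric] abs_mult)
  then show ?thesis using assms(5) by (simp add: field_simps)
qed

text \<open>Quantizing all but one of the barycentric coordinates suffices, since they sum to 1: this is
  why the number of codes grows with the exponent \<open>sc_dim S\<close>.\<close>

definition simplex_code :: "nat \<Rightarrow> (nat \<Rightarrow> real) \<Rightarrow> nat set \<times> (nat \<Rightarrow> nat)" where
  "simplex_code q t = (let \<sigma> = {i. t i \<noteq> 0} in (\<sigma>, mesh_code q (\<sigma> - {Min \<sigma>}) t))"

lemma simplex_code_range:
  assumes S: "simplicial_complex S" and t: "t \<in> realization S"
  shows "simplex_code q t \<in> Sigma S (\<lambda>\<sigma>. PiE (\<sigma> - {Min \<sigma>}) (\<lambda>_. {..q}))"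
proof -
  have "{i. t i \<noteq> 0} \<in> S" "\<And>i. 0 \<le> t i" using t by (auto simp: realization_def)
  then show ?thesis unfolding simplex_code_def Let_def
    using realization_le_1[OF t S] by (intro SigmaI mesh_code_range) auto
qed

text \<open>A simplex has at most \<open>sc_dim S + 1\<close> vertices and one is omitted, so each
  contributes at most \<open>(q + 1) ^ sc_dim S\<close> codes.\<close>

lemma card_simplex_codes:
  assumes S: "simplicial_complex S"
  shows "finite (Sigma S (\<lambda>\<sigma>. PiE (\<sigma> - {Min \<sigma>}) (\<lambda>_. {..q})))"
    "card (Sigma S (\<lambda>\<sigma>. PiE (\<sigma> - {Min \<sigma>}) (\<lambda>_. {..q}))) \<le> card S * (q + 1) ^ sc_dim S"
proof -
  have fin: "finite (PiE (\<sigma> - {Min \<sigma>}) (\<lambda>_. {..q}))" if "\<sigma> \<in> S" for \<sigma>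
    using simplex_finite[OF S that] by (intro finite_PiE) auto
  show "finite (Sigma S (\<lambda>\<sigma>. PiE (\<sigma> - {Min \<sigma>}) (\<lambda>_. {..q})))"
    by (rule finite_SigmaI[OF simplicial_complex_finite[OF S] fin])
  have "card (Sigma S (\<lambda>\<sigma>. PiE (\<sigma> - {Min \<sigma>}) (\<lambda>_. {..q}))) = (\<Sum>\<sigma>\<in>S. card (PiE (\<sigma> - {Min \<sigma>}) (\<lambda>_. {..q})))"
    using simplicial_complex_finite[OF S] fin by (intro card_SigmaI) auto
  also have "\<dots> \<le> (\<Sum>\<sigma>\<in>S. (q + 1) ^ sc_dim S)"
  proof (rule sum_mono)
    fix \<sigma> assume \<sigma>: "\<sigma> \<in> S"
    have fs: "finite \<sigma>" "\<sigma> \<noteq> {}" using simplex_finite[OF S \<sigma>] simplex_nonempty[OF S \<sigma>] .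
    then have "card (\<sigma> - {Min \<sigma>}) = card \<sigma> - 1" by simp
    then have "card (\<sigma> - {Min \<sigma>}) \<le> sc_dim S" using card_le_sc_dim[OF S \<sigma>] by simp
    then have "(q + 1) ^ card (\<sigma> - {Min \<sigma>}) \<le> (q + 1) ^ sc_dim S" by (intro power_increasing) auto
    moreover have "card (PiE (\<sigma> - {Min \<sigma>}) (\<lambda>_. {..q})) = (q + 1) ^ card (\<sigma> - {Min \<sigma>})"
      using fs by (simp add: card_PiE)
    ultimately show "card (PiE (\<sigma> - {Min \<sigma>}) (\<lambda>_. {..q})) \<le> (q + 1) ^ sc_dim S" by simp
  qed
  finally show "card (Sigma S (\<lambda>\<sigma>. PiE (\<sigma> - {Min \<sigma>}) (\<lambda>_. {..q}))) \<le> card S * (q + 1) ^ sc_dim S" by simp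
qed

lemma simplex_code_close:
  assumes S: "simplicial_complex S" and t: "t \<in> realization S" and t': "t' \<in> realization S"
    and eq: "simplex_code q t = simplex_code q t'" and q: "q \<ge> 1"
  shows "\<bar>t i - t' i\<bar> \<le> (real (sc_dim S) + 1) * (1 / real q)"
proof -
  define \<sigma> where "\<sigma> = {i. t i \<noteq> 0}"
  have e: "{i. t' i \<noteq> 0} = \<sigma>" "mesh_code q (\<sigma> - {Min \<sigma>}) t = mesh_code q (\<sigma> - {Min \<sigma>}) t'"
    using eq unfolding simplex_code_def Let_def \<sigma>_def by auto
  have \<sigma>: "\<sigma> \<in> S" using t by (simp add: realization_def \<sigma>_def)
  have fs: "finite \<sigma>" "\<sigma> \<noteq> {}" using simplex_finite[OF S \<sigma>] simplex_nonempty[OF S \<sigma>] .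
  have nn: "0 \<le> t i" "0 \<le> t' i" for i using t t' by (auto simp: realization_def)
  have s: "sum t \<sigma> = 1" "sum t' \<sigma> = 1" using t t' e(1) by (auto simp: realization_def \<sigma>_def)
  have close: "\<bar>t i - t' i\<bar> \<le> 1 / real q" if "i \<in> \<sigma> - {Min \<sigma>}" for i
    by (rule mesh_code_close[OF e(2) that nn q])
  have q0: "1 / real q \<ge> 0" by simp
  consider "i \<notin> \<sigma>" | "i \<in> \<sigma> - {Min \<sigma>}" | "i = Min \<sigma>" by blast
  then show ?thesis
  proof cases
    case 1
    then have "t i = 0" "t' i = 0" using e(1) by (auto simp: \<sigma>_def)
    then show ?thesis using q0 by simp
  next
    case 2
    have "1 * (1 / real q) \<le> (real (sc_dim S) + 1) * (1 / real q)" by (intro mult_right_mono q0) auto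
    then show ?thesis using close[OF 2] by simp
  next
    \<comment> \<open>The omitted coordinate is 1 minus the others, so its error is at most the sum
      of theirs: the origin of the factor \<open>sc_dim S + 1\<close>.\<close>
    case 3
    have M: "Min \<sigma> \<in> \<sigma>" using fs by simp
    have "t i = 1 - sum t (\<sigma> - {Min \<sigma>})" "t' i = 1 - sum t' (\<sigma> - {Min \<sigma>})"
      using sum.remove[OF fs(1) M, of t] sum.remove[OF fs(1) M, of t'] s 3 by simp_all
    then have "\<bar>t i - t' i\<bar> = \<bar>\<Sum>j\<in>\<sigma> - {Min \<sigma>}. t' j - t j\<bar>" by (simp add: sum_subtractf)
    also have "\<dots> \<le> (\<Sum>j\<in>\<sigma> - {Min \<sigma>}. \<bar>t' j - t j\<bar>)" by (rule sum_abs)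
    also have "\<dots> \<le> (\<Sum>j\<in>\<sigma> - {Min \<sigma>}. 1 / real q)" using close by (intro sum_mono) (auto simp: abs_minus_commute)
    also have "\<dots> = real (card (\<sigma> - {Min \<sigma>})) * (1 / real q)" by simp
    also have "\<dots> \<le> (real (sc_dim S) + 1) * (1 / real q)"
      using card_le_sc_dim[OF S \<sigma>] fs M by (intro mult_right_mono q0) auto
    finally show ?thesis .
  qed
qed

lemma convex_combination_close:
  fixes v :: "'i \<Rightarrow> 'v::real_normed_vector"
  assumes "finite A" "\<And>i. i \<in> A \<Longrightarrow> 0 \<le> w i" "sum w A = 1" "\<And>i. i \<in> A \<Longrightarrow> w i \<noteq> 0 \<Longrightarrow> norm (v i - y) \<le> e"
  shows "norm ((\<Sum>i\<in>A. w i *\<^sub>R v i) - y) \<le> e"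
proof -
  have "(\<Sum>i\<in>A. w i *\<^sub>R v i) - y = (\<Sum>i\<in>A. w i *\<^sub>R (v i - y))"
    using assms(3) by (simp add: scaleR_diff_right sum_subtractf scaleR_left.sum[symmetric])
  also have "norm \<dots> \<le> (\<Sum>i\<in>A. w i * e)"
  proof (rule sum_norm_le)
    fix i assume i: "i \<in> A"
    show "norm (w i *\<^sub>R (v i - y)) \<le> w i * e"
      using assms(2,4)[OF i] by (cases "w i = 0") (auto intro: mult_left_mono)
  qed
  also have "\<dots> = e" by (simp add: sum_distrib_right[symmetric] assms(3))
  finally show ?thesis .
qed

lemma finite_set_coding:
  assumes "finite Z"
  shows "\<exists>e::'c \<Rightarrow> nat. (\<forall>z\<in>Z. e z < card Z) \<and> inj_on e Z"
proof -
  obtain e where "bij_betw e Z {0..<card Z}" using ex_bij_betw_finite_nat[OF assms] by blast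
  then show ?thesis by (intro exI[of _ e]) (auto simp: bij_betw_def)
qed

text \<open>The code records the set of origins of the complete tiles, one \<open>cP\<close>-value
  per tile and one \<open>cQ\<close>-value per uncovered site. The three summands of the bound are
  their prices: at most 2 to the number of sites for the set, at most \<open>(L / N) ^ k\<close>
  tiles by disjointness, at most \<eta> times the volume uncovered.\<close>

lemma tiling_code:
  fixes T :: "int^'k \<Rightarrow> 'a::metric_space \<Rightarrow> 'a" and cP :: "'a \<Rightarrow> 'c" and cQ :: "'a \<Rightarrow> 'd"
  assumes dyn: "dynsys X T" and ne: "X \<noteq> {}" and N: "N \<ge> 1"
    and disj': "\<forall>x\<in>X. \<forall>a a' m. T a x \<in> B \<longrightarrow> T a' x \<in> B \<longrightarrow> m - a \<in> cube N \<longrightarrow> m - a' \<in> cube N \<longrightarrow> a = a'"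
    and bad: "\<forall>x\<in>X. real (card {m\<in>cube L. \<not> (\<exists>a. T a x \<in> B \<and> m - a \<in> cube N \<and> (+) a ` cube N \<subseteq> cube L)})
       \<le> \<eta> * real L ^ CARD('k)"
    and ZP: "finite ZP" "\<forall>x\<in>X. cP x \<in> ZP" and ZQ: "finite ZQ" "\<forall>x\<in>X. cQ x \<in> ZQ"
  shows "\<exists>(H :: 'a \<Rightarrow> nat) M. M \<ge> 1 \<and> (\<forall>x\<in>X. H x < M) \<and>
     ln (real M) \<le> real L ^ CARD('k) * (ln 2 + ln (real (card ZP)) / real N ^ CARD('k) + \<eta> * ln (real (card ZQ))) \<and>
     (\<forall>x\<in>X. \<forall>y\<in>X. H x = H y \<longrightarrow> (\<forall>m\<in>cube L.
        (\<exists>a. T a x \<in> B \<and> T a y \<in> B \<and> m - a \<in> cube N \<and> cP (T a x) = cP (T a y)) \<or> cQ (T m x) = cQ (T m y)))"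
proof -
  have disj: "a = a'" if "x \<in> X" "T a x \<in> B" "T a' x \<in> B" "m - a \<in> cube N" "m - a' \<in> cube N" for x a a' m
    using disj' that by blast
  define k where "k = CARD('k)"
  define A where "A x = {a. T a x \<in> B \<and> (+) a ` cube N \<subseteq> cube L}" for x
  \<comment> \<open>It depends on \<open>x\<close> only through the recorded set, so equal codes
    agree on which sites are uncovered.\<close>
  define R where "R A = {m\<in>cube L. \<not> (\<exists>a\<in>A. m - a \<in> cube N)}" for A :: "(int^'k) set"
  have finR: "finite (R A)" for A unfolding R_def by simp
  have A_sub: "A x \<subseteq> cube L" for x
  proof
    fix a assume "a \<in> A x"
    then have "a + 0 \<in> cube L" using zero_in_cube[OF N] unfolding A_def by blast
    then show "a \<in> cube L" by simp
  qed
  have RA: "real (card (R (A x))) \<le> \<eta> * real L ^ k" if x: "x \<in> X" for x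
  proof -
    have "R (A x) = {m\<in>cube L. \<not> (\<exists>a. T a x \<in> B \<and> m - a \<in> cube N \<and> (+) a ` cube N \<subseteq> cube L)}"
      unfolding R_def A_def by auto
    then show ?thesis using bspec[OF bad x] by (simp only: k_def)
  qed
  have cA: "card (A x) * N ^ k \<le> L ^ k" if x: "x \<in> X" for x
  proof -
    have "card (\<Union>a\<in>A x. (+) a ` cube N) = (\<Sum>a\<in>A x. card ((+) a ` (cube N :: (int^'k) set)))"
    proof (rule card_UN_disjoint)
      show "finite (A x)" using A_sub finite_cube finite_subset by blast
      show "\<forall>a\<in>A x. finite ((+) a ` (cube N :: (int^'k) set))" by simp
      show "\<forall>a\<in>A x. \<forall>a'\<in>A x. a \<noteq> a' \<longrightarrow> (+) a ` cube N \<inter> (+) a' ` cube N = {}"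
      proof (intro ballI impI, rule ccontr)
        fix a a' assume a: "a \<in> A x" "a' \<in> A x" "a \<noteq> a'" "(+) a ` cube N \<inter> (+) a' ` cube N \<noteq> {}"
        then obtain n n' where n: "n \<in> cube N" "n' \<in> cube N" "a + n = a' + n'" by blast
        have "a + n - a \<in> cube N" using n(1) by simp
        moreover have "a + n - a' \<in> cube N" using n(2) unfolding n(3) by simp
        ultimately have "a = a'" using disj[OF x, of a a' "a + n"] a(1,2) unfolding A_def by blast
        then show False using a(3) by blast
      qed
    qed
    also have "\<dots> = card (A x) * N ^ k" by (simp add: card_image card_cube k_def)
    finally have "card (A x) * N ^ k = card (\<Union>a\<in>A x. (+) a ` (cube N :: (int^'k) set))" ..
    also have "\<dots> \<le> card (cube L :: (int^'k) set)" by (rule card_mono) (auto simp: A_def)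
    finally show ?thesis by (simp only: card_cube k_def)
  qed
  define AA where "AA = {A \<in> Pow (cube L). card A * N ^ k \<le> L ^ k \<and> real (card (R A)) \<le> \<eta> * real L ^ k}"
  have finAA: "finite AA" unfolding AA_def by simp
  define Z where "Z = Sigma AA (\<lambda>A. PiE A (\<lambda>_. ZP) \<times> PiE (R A) (\<lambda>_. ZQ))"
  define code where "code x = (A x, restrict (\<lambda>a. cP (T a x)) (A x), restrict (\<lambda>m. cQ (T m x)) (R (A x)))" for x
  have fin_in: "finite A" if "A \<in> AA" for A
    using that finite_cube[of L] unfolding AA_def by (auto intro: finite_subset)
  have fin1: "finite (PiE A (\<lambda>_. ZP) \<times> PiE (R A) (\<lambda>_. ZQ))" if "A \<in> AA" for A
    using fin_in[OF that] finR ZP(1) ZQ(1) by (intro finite_cartesian_product finite_PiE) auto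
  have finZ: "finite Z" unfolding Z_def by (rule finite_SigmaI[OF finAA fin1])
  have codeZ: "code x \<in> Z" if x: "x \<in> X" for x
    using A_sub RA[OF x] cA[OF x] ZP(2) ZQ(2) dynsys_in[OF dyn x] unfolding code_def Z_def AA_def by auto
  obtain x0 where x0: "x0 \<in> X" using ne by blast
  have p1: "card ZP \<ge> 1" "card ZQ \<ge> 1"
    using ZP ZQ x0 by (metis One_nat_def Suc_leI card_gt_0_iff empty_iff)+
  define E where "E = exp (real L ^ k * (ln (real (card ZP)) / real N ^ k + \<eta> * ln (real (card ZQ))))"
  have powexp: "real p ^ n = exp (real n * ln (real p))" if "p \<ge> 1" for p n :: nat
    using that by (simp add: exp_of_nat_mult)
  have each: "real (card (PiE A (\<lambda>_. ZP) \<times> PiE (R A) (\<lambda>_. ZQ))) \<le> E" if "A \<in> AA" for A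
  proof -
    have 1: "real (card A) * ln (real (card ZP)) \<le> real L ^ k * (ln (real (card ZP)) / real N ^ k)"
    proof -
      have "real (card A * N ^ k) \<le> real (L ^ k)" using that unfolding AA_def of_nat_le_iff by simp
      then have "real (card A) \<le> real L ^ k / real N ^ k" using N by (simp add: pos_le_divide_eq)
      then have "real (card A) * ln (real (card ZP)) \<le> real L ^ k / real N ^ k * ln (real (card ZP))"
        using p1 by (intro mult_right_mono) auto
      then show ?thesis by simp
    qed
    have 2: "real (card (R A)) * ln (real (card ZQ)) \<le> \<eta> * real L ^ k * ln (real (card ZQ))"
      using that p1 unfolding AA_def by (intro mult_right_mono) auto
    have "real (card (PiE A (\<lambda>_. ZP) \<times> PiE (R A) (\<lambda>_. ZQ))) = real (card ZP) ^ card A * real (card ZQ) ^ card (R A)"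
      using fin_in[OF that] finR by (simp add: card_cartesian_product card_PiE)
    also have "\<dots> = exp (real (card A) * ln (real (card ZP)) + real (card (R A)) * ln (real (card ZQ)))"
      by (simp only: powexp[OF p1(1)] powexp[OF p1(2)] exp_add)
    also have "\<dots> \<le> E" unfolding E_def exp_le_cancel_iff using 1 2 by (simp add: algebra_simps)
    finally show ?thesis .
  qed
  have "card Z = (\<Sum>A\<in>AA. card (PiE A (\<lambda>_. ZP) \<times> PiE (R A) (\<lambda>_. ZQ)))"
    unfolding Z_def using finAA fin1 by (intro card_SigmaI) auto
  then have "real (card Z) = (\<Sum>A\<in>AA. real (card (PiE A (\<lambda>_. ZP) \<times> PiE (R A) (\<lambda>_. ZQ))))" by simp
  also have "\<dots> \<le> (\<Sum>A\<in>AA. E)" by (intro sum_mono each)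
  also have "\<dots> = real (card AA) * E" by simp
  also have "\<dots> \<le> 2 ^ (L ^ k) * E"
  proof (rule mult_right_mono)
    have "card AA \<le> card (Pow (cube L :: (int^'k) set))" by (rule card_mono) (auto simp: AA_def)
    also have "\<dots> = 2 ^ (L ^ k)" by (simp add: card_Pow card_cube k_def)
    finally have "real (card AA) \<le> real (2 ^ (L ^ k))" by (simp only: of_nat_le_iff)
    then show "real (card AA) \<le> 2 ^ (L ^ k)" by simp
  qed (simp add: E_def)
  finally have cZ: "real (card Z) \<le> 2 ^ (L ^ k) * E" .
  have Z1: "card Z \<ge> 1" using finZ codeZ[OF x0] by (metis One_nat_def Suc_leI card_gt_0_iff empty_iff)
  have "ln (real (card Z)) \<le> ln (2 ^ (L ^ k) * E)" using cZ Z1 by (intro ln_mono) auto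
  also have "\<dots> = real (L ^ k) * ln 2 + ln E" by (subst ln_mult) (simp_all add: E_def ln_realpow)
  also have "\<dots> = real L ^ k * (ln 2 + ln (real (card ZP)) / real N ^ k + \<eta> * ln (real (card ZQ)))"
    by (simp add: E_def algebra_simps)
  finally have lnZ: "ln (real (card Z)) \<le> real L ^ k * (ln 2 + ln (real (card ZP)) / real N ^ k + \<eta> * ln (real (card ZQ)))" .
  obtain e where e: "\<forall>z\<in>Z. e z < card Z" "inj_on e Z" using finite_set_coding[OF finZ] by blast
  have dec: "(\<exists>a. T a x \<in> B \<and> T a y \<in> B \<and> m - a \<in> cube N \<and> cP (T a x) = cP (T a y)) \<or> cQ (T m x) = cQ (T m y)"
    if xy: "x \<in> X" "y \<in> X" "e (code x) = e (code y)" and m: "m \<in> cube L" for x y m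
  proof -
    have "code x = code y" using inj_onD[OF e(2) xy(3)] codeZ xy by blast
    then have eqs: "A y = A x" "restrict (\<lambda>a. cP (T a x)) (A x) = restrict (\<lambda>a. cP (T a y)) (A x)"
        "restrict (\<lambda>m. cQ (T m x)) (R (A x)) = restrict (\<lambda>m. cQ (T m y)) (R (A x))"
      unfolding code_def by auto
    show ?thesis
    proof (cases "m \<in> R (A x)")
      case True
      then show ?thesis using fun_cong[OF eqs(3), of m] by simp
    next
      case False
      then obtain a where a: "a \<in> A x" "m - a \<in> cube N" using m unfolding R_def by blast
      then have "cP (T a x) = cP (T a y)" using fun_cong[OF eqs(2), of a] by simp
      moreover have "T a x \<in> B" "T a y \<in> B" using a(1) eqs(1) unfolding A_def by blast+
      ultimately show ?thesis using a(2) by blast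
    qed
  qed
  show ?thesis
    using Z1 e(1) codeZ lnZ dec unfolding k_def
    by (intro exI[of _ "\<lambda>x. e (code x)"] exI[of _ "card Z"] conjI ballI impI) auto
qed

section \<open>The perturbed function\<close>

lemma ln_mesh_bound:
  assumes q: "real q + 1 \<le> exp l" and n: "real n \<le> real s * (real q + 1) ^ d" "n \<ge> 1" "s \<ge> 1"
  shows "ln (real n) \<le> ln (real s) + real d * l"
proof -
  have "real n \<le> real s * exp l ^ d"
    using n(1) mult_left_mono[OF power_mono[OF q, of d], of "real s"] by simp
  then have "ln (real n) \<le> ln (real s * exp l ^ d)" using n(2) by (intro ln_mono) auto
  also have "\<dots> = ln (real s) + ln (exp l ^ d)" using n(3) by (subst ln_mult) auto
  also have "ln (exp l ^ d) = real d * l" by (simp add: ln_realpow)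
  finally show ?thesis .
qed

text \<open>The density half of the Baire argument: near \<open>f\<close> there is \<open>g\<close>
  with few codes at some scale below the prescribed \<open>e0\<close>. Convexity of \<open>K\<close>
  keeps the averaged function \<open>K\<close>-valued.\<close>

lemma exists_small_entropy_function:
  fixes T :: "int^'k \<Rightarrow> 'a::metric_space \<Rightarrow> 'a" and K :: "'v::banach set"
  assumes dyn: "dynsys X T" and ne: "X \<noteq> {}" and mark: "marker_property X T"
    and K: "compact K" "convex K" and f: "f \<in> CXK X K" and r: "r > 0"
    and md: "mdim T X dist < ereal D" and e0: "e0 > 0"
  shows "\<exists>g\<in>CXK X K. (\<forall>x\<in>X. norm (f x - g x) \<le> r) \<and> (\<exists>\<epsilon> N M. 0 < \<epsilon> \<and> \<epsilon> < e0 \<and> N \<ge> 1 \<and> M \<ge> 1 \<and>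
     coded X T g (cube N) \<epsilon> M \<and> ln (real M) / real N ^ CARD('k) < D * \<bar>ln \<epsilon>\<bar>)"
proof -
  define k where "k = CARD('k)"
  obtain D1' where "mdim T X dist < D1'" "D1' < ereal D" using dense[OF md] by blast
  have "0 < D1'" using mdim_properties(1)[OF dyn] \<open>mdim T X dist < D1'\<close> by (rule le_less_trans)
  obtain D1 where "D1' = ereal D1"
    using \<open>0 < D1'\<close> \<open>D1' < ereal D\<close> by (cases D1') auto
  then have D1: "mdim T X dist < ereal D1" "D1 < D" "D1 > 0"
    using \<open>mdim T X dist < D1'\<close> \<open>D1' < ereal D\<close> \<open>0 < D1'\<close> by auto
  have f': "continuous_on X f" "f ` X \<subseteq> K" using f by (auto simp: CXK_def)
  obtain N S and \<phi> :: "'a \<Rightarrow> nat \<Rightarrow> real" and J \<gamma> and v :: "int^'k \<Rightarrow> nat \<Rightarrow> 'v" and C where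
    N: "N \<ge> 1" and S: "simplicial_complex S" and dim': "real (sc_dim S) < D1 * real N ^ CARD('k)"
    and phi': "\<forall>x\<in>X. \<phi> x \<in> realization S" and \<gamma>c': "\<forall>j. continuous_on X (\<lambda>x. \<gamma> j (\<phi> x))" and C: "C \<ge> 0"
    and \<gamma>0': "\<forall>x\<in>X. \<forall>j::nat. 0 \<le> \<gamma> j (\<phi> x)" and \<gamma>1': "\<forall>x\<in>X. (\<Sum>j<J. \<gamma> j (\<phi> x)) = (1::real)"
    and vf': "\<forall>n. \<forall>j<J. v n j \<in> f ` X"
    and \<gamma>f': "\<forall>x\<in>X. \<forall>n\<in>cube N. \<forall>j<J. \<gamma> j (\<phi> x) \<noteq> 0 \<longrightarrow> norm (v n j - f (T n x)) \<le> r"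
    and \<gamma>L': "\<forall>x\<in>X. \<forall>y\<in>X. \<forall>h. \<forall>j<J. (\<forall>i. \<bar>\<phi> x i - \<phi> y i\<bar> \<le> h) \<longrightarrow> \<bar>\<gamma> j (\<phi> x) - \<gamma> j (\<phi> y)\<bar> \<le> C * h"
    using lipschitz_partition[OF dyn f'(1) D1(1) r] by (elim exE conjE) (rule that)
  have dim: "real (sc_dim S) < D1 * real N ^ k" using dim' by (simp only: k_def)
  have phi: "\<And>x. x \<in> X \<Longrightarrow> \<phi> x \<in> realization S" and \<gamma>c: "\<And>j. continuous_on X (\<lambda>x. \<gamma> j (\<phi> x))"
    and \<gamma>0: "\<And>x j. x \<in> X \<Longrightarrow> 0 \<le> \<gamma> j (\<phi> x)" and \<gamma>1: "\<And>x. x \<in> X \<Longrightarrow> (\<Sum>j<J. \<gamma> j (\<phi> x)) = 1"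
    and vf: "\<And>n j. j < J \<Longrightarrow> v n j \<in> f ` X"
    using phi' \<gamma>c' \<gamma>0' \<gamma>1' vf' by simp_all
  have \<gamma>f: "norm (v n j - f (T n x)) \<le> r" if "x \<in> X" "n \<in> cube N" "j < J" "\<gamma> j (\<phi> x) \<noteq> 0" for x n j
    using \<gamma>f' that by simp
  have \<gamma>L: "\<bar>\<gamma> j (\<phi> x) - \<gamma> j (\<phi> y)\<bar> \<le> C * h" if "x \<in> X" "y \<in> X" "j < J" "\<forall>i. \<bar>\<phi> x i - \<phi> y i\<bar> \<le> h" for x y h j
    using \<gamma>L' that by simp
  have vK: "v n j \<in> K" if "j < J" for n j using vf[OF that] f'(2) by blast
  \<comment> \<open>The room above \<open>D1\<close> is spent as follows: one \<delta> on uncovered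
    sites, one on the constants in \<open>C5\<close>, and the rest on the border of the enlarged
    window.\<close>
  define \<delta> where "\<delta> = (D - D1) / 4"
  have \<delta>: "\<delta> > 0" using D1(2) by (simp add: \<delta>_def)
  define I where "I = (cube N :: (int^'k) set) \<times> {..<J}"
  \<comment> \<open>An uncovered site costs \<open>card I\<close> quantized coordinates, so their
    total price per site of the window is at most \<delta> times \<open>l\<close>.\<close>
  define \<eta> where "\<eta> = \<delta> / (real (card I) + 1)"
  have \<eta>: "\<eta> > 0" "\<eta> * real (card I) \<le> \<delta>" using \<delta> by (auto simp: \<eta>_def field_simps)
  obtain B L0 where B: "closed B" "B \<subseteq> X"
      "\<forall>x\<in>X. \<forall>a a' m. T a x \<in> B \<longrightarrow> T a' x \<in> B \<longrightarrow> m - a \<in> cube N \<longrightarrow> m - a' \<in> cube N \<longrightarrow> a = a'"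
      "\<forall>x\<in>X. \<forall>L\<ge>L0. real (card {m\<in>cube L. \<not> (\<exists>a. T a x \<in> B \<and> m - a \<in> cube N \<and> (+) a ` cube N \<subseteq> cube L)})
       \<le> \<eta> * real L ^ CARD('k)"
    using rokhlin_tiling[OF dyn mark N \<eta>(1)] by (elim exE conjE) (rule that)
  obtain w :: "int^'k \<Rightarrow> 'a \<Rightarrow> real" where w: "\<forall>n. continuous_on X (w n)" "\<forall>n. \<forall>x\<in>X. 0 \<le> w n x"
     "\<forall>x\<in>X. (\<Sum>n\<in>cube N. w n x) = 1" "\<forall>x\<in>X. \<forall>n\<in>cube N. T (- n) x \<in> B \<longrightarrow> w n x = 1"
    using tile_weights[OF dyn N B(1) B(3)] by (elim exE conjE) (rule that)
  \<comment> \<open>\<open>G n y\<close> approximates \<open>f (T n y)\<close> and is a Lipschitz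
    function of \<open>\<phi> y\<close>. Hence every \<open>G n (T (- n) x)\<close> is close to
    \<open>f x\<close>, and so is any convex combination of them: the approximation holds on and off
    the tiles alike.\<close>
  define G where "G n x = (\<Sum>j<J. \<gamma> j (\<phi> x) *\<^sub>R v n j)" for n x
  define g where "g x = (if x \<in> X then (\<Sum>n\<in>cube N. w n x *\<^sub>R G n (T (- n) x)) else 0)" for x
  have GK: "G n x \<in> K" if "x \<in> X" for n x
    unfolding G_def using vK \<gamma>0[OF that] \<gamma>1[OF that] by (intro convex_sum K(2)) auto
  have gcont: "continuous_on X g"
  proof -
    have "continuous_on X (\<lambda>x. G n x)" for n unfolding G_def by (intro continuous_intros \<gamma>c)
    then have "continuous_on X (\<lambda>x. \<Sum>n\<in>cube N. w n x *\<^sub>R G n (T (- n) x))"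
      using w(1) by (intro continuous_on_sum continuous_on_scaleR dynsys_cont_comp[OF dyn]) auto
    then show ?thesis by (rule continuous_on_eq) (simp add: g_def)
  qed
  have gK: "g x \<in> K" if x: "x \<in> X" for x
  proof -
    have "(\<Sum>n\<in>cube N. w n x *\<^sub>R G n (T (- n) x)) \<in> K"
      using w(2,3) x GK[OF dynsys_in[OF dyn x]] by (intro convex_sum K(2)) auto
    then show ?thesis using x by (simp add: g_def)
  qed
  have gCXK: "g \<in> CXK X K" using gcont gK by (auto simp: CXK_def g_def)
  have gf: "norm (f x - g x) \<le> r" if x: "x \<in> X" for x
  proof -
    have "norm (G n (T (- n) x) - f x) \<le> r" if n: "n \<in> cube N" for n
    proof -
      have "T n (T (- n) x) = x" using dynsys_add[OF dyn x] dynsys_0[OF dyn x] by simp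
      then show ?thesis
        unfolding G_def using \<gamma>0 \<gamma>1 \<gamma>f[OF dynsys_in[OF dyn x] n, of _ "- n"] dynsys_in[OF dyn x]
        by (intro convex_combination_close) auto
    qed
    then have "norm (g x - f x) \<le> r"
      unfolding g_def using x w(2,3) by (simp, intro convex_combination_close) auto
    then show ?thesis by (simp add: norm_minus_commute)
  qed
  \<comment> \<open>On a tile with origin \<open>a\<close> a single weight survives, so all values
    of \<open>g\<close> there are determined by the one point \<open>\<phi> (T a x)\<close>. This is
    the saving.\<close>
  have g_tile: "g (T m x) = G (m - a) (T a x)" if x: "x \<in> X" and a: "T a x \<in> B" "m - a \<in> cube N" for x m a
  proof -
    have inv: "T (- (m - a)) (T m x) = T a x" using dynsys_add[OF dyn x] by simp
    have w1: "w (m - a) (T m x) = 1" using w(4) a dynsys_in[OF dyn x] inv by metis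
    have "(\<Sum>n\<in>cube N. w n (T m x)) = w (m - a) (T m x) + (\<Sum>n\<in>cube N - {m - a}. w n (T m x))"
      by (rule sum.remove[OF finite_cube a(2)])
    then have "(\<Sum>n\<in>cube N - {m - a}. w n (T m x)) = 0" using w(3) w1 dynsys_in[OF dyn x] by simp
    then have w0: "w n (T m x) = 0" if "n \<in> cube N - {m - a}" for n
      using w(2) dynsys_in[OF dyn x] that by (subst (asm) sum_nonneg_eq_0_iff) auto
    have "g (T m x) = (\<Sum>n\<in>cube N. w n (T m x) *\<^sub>R G n (T (- n) (T m x)))"
      using dynsys_in[OF dyn x] by (simp add: g_def)
    also have "\<dots> = w (m - a) (T m x) *\<^sub>R G (m - a) (T (- (m - a)) (T m x))
        + (\<Sum>n\<in>cube N - {m - a}. w n (T m x) *\<^sub>R G n (T (- n) (T m x)))"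
      by (rule sum.remove[OF finite_cube a(2)])
    also have "\<dots> = G (m - a) (T a x)" unfolding inv w1 by (simp add: w0)
    finally show ?thesis .
  qed
  \<comment> \<open>Coordinates of \<open>g x\<close> with respect to \<open>card I\<close> fixed
    vectors; they are available at every point and serve as the costly code at uncovered
    sites.\<close>
  define c where "c x p = w (fst p) x * \<gamma> (snd p) (\<phi> (T (- fst p) x))" for x p
  have g_c: "g x = (\<Sum>p\<in>I. c x p *\<^sub>R v (fst p) (snd p))" if x: "x \<in> X" for x
  proof -
    have "g x = (\<Sum>n\<in>cube N. \<Sum>j<J. c x (n, j) *\<^sub>R v n j)"
      using x by (simp add: g_def G_def c_def scaleR_sum_right)
    then show ?thesis unfolding I_def by (simp add: sum.cartesian_product case_prod_unfold)
  qed
  have c01: "0 \<le> c x p \<and> c x p \<le> 1" if x: "x \<in> X" and p: "p \<in> I" for x p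
  proof -
    have "fst p \<in> cube N" "snd p < J" using p by (auto simp: I_def)
    then have "w (fst p) x \<le> (\<Sum>n\<in>cube N. w n x)" "\<gamma> (snd p) (\<phi> (T (- fst p) x)) \<le> (\<Sum>j<J. \<gamma> j (\<phi> (T (- fst p) x)))"
      using w(2) x \<gamma>0 dynsys_in[OF dyn x] by (auto intro!: member_le_sum)
    then have "w (fst p) x \<le> 1" "\<gamma> (snd p) (\<phi> (T (- fst p) x)) \<le> 1"
      using w(3) x \<gamma>1 dynsys_in[OF dyn x] by auto
    then show ?thesis unfolding c_def using w(2) x \<gamma>0 dynsys_in[OF dyn x] by (auto intro: mult_le_one)
  qed
  obtain Vm where Vm: "Vm \<ge> 0" "\<And>u. u \<in> K \<Longrightarrow> norm u \<le> Vm"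
    using compact_imp_bounded[OF K(1)] unfolding bounded_pos by (metis less_imp_le)
  define CG where "CG = real J * (C * (real (sc_dim S) + 1)) * Vm"
  \<comment> \<open>One constant for both kinds of code: \<open>CG\<close> comes from the Lipschitz
    bound on tiles, the other term from the coordinates \<open>c\<close>.\<close>
  define CC where "CC = CG + real (card I) * Vm"
  have CG0: "CG \<ge> 0" using C Vm(1) by (simp add: CG_def)
  have CC0: "CC \<ge> 0" "CG \<le> CC" "real (card I) * Vm \<le> CC" using CG0 Vm(1) by (auto simp: CC_def)
  have G_close: "norm (G n x - G n y) \<le> CC / real q"
    if xy: "x \<in> X" "y \<in> X" and eq: "simplex_code q (\<phi> x) = simplex_code q (\<phi> y)" and q: "q \<ge> 1" for x y n q
  proof -
    have "\<forall>i. \<bar>\<phi> x i - \<phi> y i\<bar> \<le> (real (sc_dim S) + 1) * (1 / real q)"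
      using simplex_code_close[OF S phi phi eq q] xy by blast
    then have \<gamma>le: "\<bar>\<gamma> j (\<phi> x) - \<gamma> j (\<phi> y)\<bar> \<le> C * ((real (sc_dim S) + 1) * (1 / real q))" if "j < J" for j
      by (rule \<gamma>L[OF xy that])
    have "G n x - G n y = (\<Sum>j<J. (\<gamma> j (\<phi> x) - \<gamma> j (\<phi> y)) *\<^sub>R v n j)"
      by (simp add: G_def sum_subtractf scaleR_diff_left)
    also have "norm \<dots> \<le> (\<Sum>j<J. C * ((real (sc_dim S) + 1) * (1 / real q)) * Vm)"
    proof (rule sum_norm_le)
      fix j assume "j \<in> {..<J}"
      then have j: "j < J" by simp
      have "norm ((\<gamma> j (\<phi> x) - \<gamma> j (\<phi> y)) *\<^sub>R v n j) = \<bar>\<gamma> j (\<phi> x) - \<gamma> j (\<phi> y)\<bar> * norm (v n j)" by simp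
      also have "\<dots> \<le> C * ((real (sc_dim S) + 1) * (1 / real q)) * Vm"
        using \<gamma>le[OF j] Vm(2)[OF vK[OF j]] C by (intro mult_mono) auto
      finally show "norm ((\<gamma> j (\<phi> x) - \<gamma> j (\<phi> y)) *\<^sub>R v n j) \<le> C * ((real (sc_dim S) + 1) * (1 / real q)) * Vm" .
    qed
    also have "\<dots> = CG / real q" by (simp add: CG_def)
    also have "\<dots> \<le> CC / real q" using CC0 by (intro divide_right_mono) auto
    finally show ?thesis .
  qed
  have g_close: "norm (g x - g y) \<le> CC / real q"
    if xy: "x \<in> X" "y \<in> X" and eq: "mesh_code q I (c x) = mesh_code q I (c y)" and q: "q \<ge> 1" for x y q
  proof -
    have cle: "\<bar>c x p - c y p\<bar> \<le> 1 / real q" if p: "p \<in> I" for p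
      using mesh_code_close[OF eq p _ _ q] c01[OF xy(1) p] c01[OF xy(2) p] by blast
    have "g x - g y = (\<Sum>p\<in>I. (c x p - c y p) *\<^sub>R v (fst p) (snd p))"
      by (simp add: g_c xy sum_subtractf scaleR_diff_left)
    also have "norm \<dots> \<le> (\<Sum>p\<in>I. (1 / real q) * Vm)"
    proof (rule sum_norm_le)
      fix p assume p: "p \<in> I"
      have "\<bar>c x p - c y p\<bar> * norm (v (fst p) (snd p)) \<le> (1 / real q) * Vm"
        using cle[OF p] p by (intro mult_mono Vm(2) vK) (auto simp: I_def)
      then show "norm ((c x p - c y p) *\<^sub>R v (fst p) (snd p)) \<le> (1 / real q) * Vm" by simp
    qed
    also have "\<dots> = real (card I) * Vm / real q" by simp
    also have "\<dots> \<le> CC / real q" using CC0 by (intro divide_right_mono) auto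
    finally show ?thesis .
  qed
  define \<sigma> where "\<sigma> = wsum TYPE(int^'k)"
  have \<sigma>: "\<sigma> \<ge> 0" unfolding \<sigma>_def by (rule wsum_nonneg)
  define C4 where "C4 = 4 * \<sigma> * CC + 3"
  have C4: "C4 \<ge> 1" using \<sigma> CC0 by (simp add: C4_def)
  \<comment> \<open>Everything in the final bound that does not depend on \<epsilon>. The
    exponential in the next definition is what makes it at most \<delta> times |ln
    \<epsilon>|.\<close>
  define C5 where "C5 = ln 2 + ln (real (card S)) / real N ^ k + (D1 + \<delta>) * ln C4"
  define \<epsilon> where "\<epsilon> = min (e0 / 2) (min (1 / 2) (exp (- C5 / \<delta>)))"
  have \<epsilon>: "0 < \<epsilon>" "\<epsilon> < e0" "\<epsilon> < 1" using e0 by (auto simp: \<epsilon>_def min_less_iff_disj)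
  have "\<epsilon> \<le> exp (- C5 / \<delta>)" by (simp add: \<epsilon>_def)
  then have "ln \<epsilon> \<le> - C5 / \<delta>" using \<epsilon>(1) by (metis ln_exp ln_mono)
  then have C5: "C5 \<le> \<delta> * \<bar>ln \<epsilon>\<bar>" using \<delta> \<epsilon> by (simp add: field_simps)
  have lnpos: "\<bar>ln \<epsilon>\<bar> > 0" "\<bar>ln \<epsilon>\<bar> = - ln \<epsilon>" using \<epsilon> by auto
  \<comment> \<open>The mesh is so fine that coordinate errors contribute at most \<epsilon>/4 to
    \<open>Dmetric\<close>, yet \<open>q + 1\<close> is at most \<open>C4 / \<epsilon>\<close>. The
    \<open>+ 3\<close> in \<open>C4\<close> covers rounding and the two increments.\<close>
  define q where "q = nat \<lceil>4 * \<sigma> * CC / \<epsilon>\<rceil> + 1"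
  have q1: "q \<ge> 1" by (simp add: q_def)
  have nn: "0 \<le> 4 * \<sigma> * CC / \<epsilon>" using \<sigma> CC0 \<epsilon> by simp
  have qlow: "4 * \<sigma> * CC / \<epsilon> \<le> real q" unfolding q_def by linarith
  have qup: "real q + 1 \<le> 4 * \<sigma> * CC / \<epsilon> + 3" using nn unfolding q_def by linarith
  have \<sigma>CC: "\<sigma> * (CC / real q) \<le> \<epsilon> / 4"
  proof -
    have "4 * \<sigma> * CC \<le> real q * \<epsilon>" using qlow \<epsilon>(1) by (simp add: divide_le_eq)
    then show ?thesis using q1 by (simp add: field_simps)
  qed
  define l where "l = ln C4 + \<bar>ln \<epsilon>\<bar>"
  have l0: "l \<ge> 0" using C4 by (simp add: l_def)
  have ql: "real q + 1 \<le> exp l"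
  proof -
    have "3 \<le> 3 / \<epsilon>" using \<epsilon> by (simp add: field_simps)
    then have "real q + 1 \<le> C4 / \<epsilon>" using qup by (simp add: C4_def add_divide_distrib)
    moreover have "l = ln C4 - ln \<epsilon>" using lnpos(2) by (simp add: l_def)
    then have "C4 / \<epsilon> = exp l" using C4 \<epsilon>(1) by (simp add: exp_diff)
    ultimately show ?thesis by simp
  qed
  define ZP where "ZP = Sigma S (\<lambda>\<sigma>. PiE (\<sigma> - {Min \<sigma>}) (\<lambda>_. {..q}))"
  define ZQ where "ZQ = PiE I (\<lambda>_. {..q})"
  have finI: "finite I" by (simp add: I_def)
  have ZP: "finite ZP" "card ZP \<le> card S * (q + 1) ^ sc_dim S" unfolding ZP_def by (rule card_simplex_codes[OF S])+
  have ZQ: "finite ZQ" "card ZQ = (q + 1) ^ card I" unfolding ZQ_def using finI by (auto intro!: finite_PiE simp: card_PiE)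
  have cP: "\<forall>x\<in>X. simplex_code q (\<phi> x) \<in> ZP" unfolding ZP_def by (intro ballI simplex_code_range[OF S phi])
  have cQ: "\<forall>x\<in>X. mesh_code q I (c x) \<in> ZQ" unfolding ZQ_def by (intro ballI mesh_code_range c01)
  obtain x0 where x0: "x0 \<in> X" using ne by blast
  have ZP1: "card ZP \<ge> 1" using ZP(1) bspec[OF cP x0] by (metis One_nat_def Suc_leI card_gt_0_iff empty_iff)
  have S1: "card S \<ge> 1" using simplicial_complex_finite[OF S] simplicial_complex_ne[OF S] by (metis One_nat_def Suc_leI card_gt_0_iff)
  have lnP: "ln (real (card ZP)) \<le> ln (real (card S)) + real (sc_dim S) * l"
  proof (rule ln_mesh_bound[OF ql _ ZP1 S1])
    have "real (card ZP) \<le> real (card S * (q + 1) ^ sc_dim S)" using ZP(2) by (simp only: of_nat_le_iff)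
    then show "real (card ZP) \<le> real (card S) * (real q + 1) ^ sc_dim S" by (simp add: add.commute)
  qed
  have lnQ: "ln (real (card ZQ)) \<le> real (card I) * l"
    using ln_mesh_bound[OF ql, of "card ZQ" 1 "card I"] ZQ(2) by (simp add: add.commute)
  have Nk: "real N ^ k > 0" using N by simp
  have vol: "ln 2 + ln (real (card ZP)) / real N ^ k + \<eta> * ln (real (card ZQ)) \<le> (D1 + 2 * \<delta>) * \<bar>ln \<epsilon>\<bar>"
  proof -
    have "ln (real (card ZP)) / real N ^ k \<le> (ln (real (card S)) + real (sc_dim S) * l) / real N ^ k"
      using lnP by (intro divide_right_mono) auto
    moreover have "real (sc_dim S) / real N ^ k * l \<le> D1 * l"
      using dim Nk l0 by (intro mult_right_mono) (auto simp: divide_le_eq)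
    moreover have "\<eta> * ln (real (card ZQ)) \<le> \<delta> * l"
    proof -
      have "\<eta> * ln (real (card ZQ)) \<le> \<eta> * (real (card I) * l)" using lnQ \<eta>(1) by (intro mult_left_mono) auto
      also have "\<dots> \<le> \<delta> * l" using mult_right_mono[OF \<eta>(2) l0] by (simp add: mult.assoc)
      finally show ?thesis .
    qed
    ultimately have "ln 2 + ln (real (card ZP)) / real N ^ k + \<eta> * ln (real (card ZQ)) \<le> ln 2 + ln (real (card S)) / real N ^ k + D1 * l + \<delta> * l"
      by (simp add: add_divide_distrib)
    also have "\<dots> = C5 + (D1 + \<delta>) * \<bar>ln \<epsilon>\<bar>" by (simp add: C5_def l_def algebra_simps)
    also have "\<dots> \<le> \<delta> * \<bar>ln \<epsilon>\<bar> + (D1 + \<delta>) * \<bar>ln \<epsilon>\<bar>" using C5 by simp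
    also have "\<dots> = (D1 + 2 * \<delta>) * \<bar>ln \<epsilon>\<bar>" by (simp add: algebra_simps)
    finally show ?thesis .
  qed
  obtain F where F: "finite F" "\<And>(x :: int^'k \<Rightarrow> 'v) y e'. (\<forall>n. norm (x n - y n) \<le> 2 * Vm) \<Longrightarrow>
     (\<forall>n\<in>F. norm (x n - y n) \<le> e') \<Longrightarrow> e' \<ge> 0 \<Longrightarrow> Dmetric x y \<le> \<sigma> * e' + \<epsilon> / 4"
    using Dmetric_local[of "\<epsilon> / 4" "2 * Vm"] \<epsilon>(1) Vm(1) unfolding \<sigma>_def by (metis mult_nonneg_nonneg zero_le_numeral divide_pos_pos zero_less_numeral)
  have "finite ((\<lambda>(n, i). nat \<bar>n$i\<bar>) ` (F \<times> UNIV))" using F(1) by auto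
  then obtain E where E: "\<And>y. y \<in> (\<lambda>(n, i). nat \<bar>n$i\<bar>) ` (F \<times> UNIV) \<Longrightarrow> y \<le> E"
    by (meson finite_nat_set_iff_bounded_le)
  have FE: "\<bar>n$i\<bar> \<le> int E" if "n \<in> F" for n :: "int^'k" and i using E[of "nat \<bar>n$i\<bar>"] that by force
  define ev :: "int^'k" where "ev = (\<chi> i. int E)"
  have "(\<lambda>L. (1 + 2 * real E * (1 / real L)) ^ k * (D1 + 2 * \<delta>)) \<longlonglongrightarrow> (1 + 2 * real E * 0) ^ k * (D1 + 2 * \<delta>)"
    by (intro tendsto_intros lim_1_over_n)
  moreover have "D1 + 2 * \<delta> < D" using D1(2) by (simp add: \<delta>_def field_simps)
  ultimately have "eventually (\<lambda>L. (1 + 2 * real E * (1 / real L)) ^ k * (D1 + 2 * \<delta>) < D) sequentially"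
    by (intro order_tendstoD) auto
  then obtain L1 where L1: "\<And>L. L \<ge> L1 \<Longrightarrow> (1 + 2 * real E * (1 / real L)) ^ k * (D1 + 2 * \<delta>) < D"
    by (auto simp: eventually_sequentially)
  define L where "L = max 1 (max L0 L1)"
  have L: "L \<ge> 1" "L \<ge> L0" "L \<ge> L1" by (auto simp: L_def)
  \<comment> \<open>To control \<open>Dmetric\<close> over \<open>cube L\<close> the values of
    \<open>g\<close> must be known on a margin of width \<open>E\<close>, the extent of
    \<open>F\<close>. Coding \<open>cube L'\<close> after a shift by \<open>- ev\<close> centres the
    margin, and \<open>L\<close> is large enough that \<open>(L' / L) ^ k\<close> fits into the
    remaining room.\<close>
  define L' where "L' = L + 2 * E"
  have bad: "\<forall>x\<in>X. real (card {m\<in>cube L'. \<not> (\<exists>a. T a x \<in> B \<and> m - a \<in> cube N \<and> (+) a ` cube N \<subseteq> cube L')}) \<le> \<eta> * real L' ^ CARD('k)"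
  proof -
    have "L0 \<le> L'" using L(2) by (simp add: L'_def)
    then show ?thesis using B(4) by blast
  qed
  obtain H :: "'a \<Rightarrow> nat" and M where H: "M \<ge> 1" "\<forall>x\<in>X. H x < M"
     "ln (real M) \<le> real L' ^ CARD('k) * (ln 2 + ln (real (card ZP)) / real N ^ CARD('k) + \<eta> * ln (real (card ZQ)))"
     "\<forall>x\<in>X. \<forall>y\<in>X. H x = H y \<longrightarrow> (\<forall>m\<in>cube L'.
        (\<exists>a. T a x \<in> B \<and> T a y \<in> B \<and> m - a \<in> cube N \<and> simplex_code q (\<phi> (T a x)) = simplex_code q (\<phi> (T a y)))
          \<or> mesh_code q I (c (T m x)) = mesh_code q I (c (T m y)))"
    using tiling_code[OF dyn ne N B(3) bad ZP(1) cP ZQ(1) cQ] by (elim exE conjE) (rule that)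
  have close: "norm (g (T m x) - g (T m y)) \<le> CC / real q"
    if xy: "x \<in> X" "y \<in> X" "H x = H y" and m: "m \<in> cube L'" for x y m
  proof -
    have Tin: "T a x \<in> X" "T a y \<in> X" for a using dynsys_in[OF dyn] xy by auto
    from H(4) xy m consider a where "T a x \<in> B" "T a y \<in> B" "m - a \<in> cube N" "simplex_code q (\<phi> (T a x)) = simplex_code q (\<phi> (T a y))"
      | "mesh_code q I (c (T m x)) = mesh_code q I (c (T m y))" by blast
    then show ?thesis
    proof cases
      case 1
      show ?thesis unfolding g_tile[OF xy(1) 1(1,3)] g_tile[OF xy(2) 1(2,3)] by (rule G_close[OF Tin 1(4) q1])
    next
      case 2
      show ?thesis by (rule g_close[OF Tin 2 q1])
    qed
  qed
  have "coded X T g (cube L) \<epsilon> M"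
  proof (rule codedI[of X "\<lambda>x. H (T (- ev) x)" M "\<epsilon> / 2"])
    fix x y and m :: "int^'k" assume a: "x \<in> X" "y \<in> X" "H (T (- ev) x) = H (T (- ev) y)" "m \<in> cube L"
    have "Dmetric (I_map T g (T m x)) (I_map T g (T m y)) \<le> \<sigma> * (CC / real q) + \<epsilon> / 4"
    proof (rule F(2))
      show "\<forall>n. norm (I_map T g (T m x) n - I_map T g (T m y) n) \<le> 2 * Vm"
      proof
        fix n
        have "norm (I_map T g (T m x) n) \<le> Vm" "norm (I_map T g (T m y) n) \<le> Vm"
          unfolding I_map_def using a(1,2) by (intro Vm(2) gK dynsys_in[OF dyn]; simp)+
        then show "norm (I_map T g (T m x) n - I_map T g (T m y) n) \<le> 2 * Vm"
          using norm_triangle_ineq4[of "I_map T g (T m x) n" "I_map T g (T m y) n"] by linarith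
      qed
      show "\<forall>n\<in>F. norm (I_map T g (T m x) n - I_map T g (T m y) n) \<le> CC / real q"
      proof
        fix n assume n: "n \<in> F"
        have tr: "I_map T g (T m z) n = g (T (n + m + ev) (T (- ev) z))" if "z \<in> X" for z
          using dynsys_add[OF dyn that] by (simp add: I_map_def)
        have "n + m + ev \<in> cube L'"
        proof -
          have "0 \<le> (n + m + ev)$i \<and> (n + m + ev)$i < int L'" for i
          proof -
            have "\<bar>n$i\<bar> \<le> int E" "0 \<le> m$i" "m$i < int L" using FE[OF n] a(4) by (auto simp: cube_def)
            moreover have "(n + m + ev)$i = n$i + m$i + int E" "int L' = int L + 2 * int E" by (simp_all add: ev_def L'_def)
            ultimately show ?thesis by linarith
          qed
          then show ?thesis by (simp add: cube_def)
        qed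
        then show "norm (I_map T g (T m x) n - I_map T g (T m y) n) \<le> CC / real q"
          unfolding tr[OF a(1)] tr[OF a(2)] using a by (intro close dynsys_in[OF dyn]) auto
      qed
      show "0 \<le> CC / real q" using CC0 by simp
    qed
    then show "Dmetric (I_map T g (T m x)) (I_map T g (T m y)) \<le> \<epsilon> / 2" using \<sigma>CC by linarith
  qed (use H(2) dynsys_in[OF dyn] \<epsilon>(1) in auto)
  moreover have "ln (real M) / real L ^ CARD('k) < D * \<bar>ln \<epsilon>\<bar>"
  proof -
    have Lp: "real L > 0" using L(1) by simp
    have "ln (real M) \<le> real L' ^ k * ((D1 + 2 * \<delta>) * \<bar>ln \<epsilon>\<bar>)"
      using H(3) mult_left_mono[OF vol, of "real L' ^ k"] unfolding k_def by simp
    then have "ln (real M) / real L ^ k \<le> real L' ^ k * ((D1 + 2 * \<delta>) * \<bar>ln \<epsilon>\<bar>) / real L ^ k"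
      by (intro divide_right_mono) auto
    also have "\<dots> = (real L' / real L) ^ k * (D1 + 2 * \<delta>) * \<bar>ln \<epsilon>\<bar>" by (simp add: power_divide)
    also have "real L' / real L = 1 + 2 * real E * (1 / real L)" using Lp by (simp add: L'_def field_simps)
    also have "(1 + 2 * real E * (1 / real L)) ^ k * (D1 + 2 * \<delta>) * \<bar>ln \<epsilon>\<bar> < D * \<bar>ln \<epsilon>\<bar>"
      using L1[OF L(3)] lnpos(1) by (rule mult_strict_right_mono)
    finally show ?thesis unfolding k_def .
  qed
  ultimately have "\<exists>\<epsilon> N M. 0 < \<epsilon> \<and> \<epsilon> < e0 \<and> N \<ge> 1 \<and> M \<ge> 1 \<and> coded X T g (cube N) \<epsilon> M \<and> ln (real M) / real N ^ CARD('k) < D * \<bar>ln \<epsilon>\<bar>"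
    using \<epsilon>(1,2) L(1) H(1) by blast
  then show ?thesis using gCXK gf by blast
qed

section \<open>Genericity\<close>

lemma CXK_bounded:
  assumes "compact K"
  obtains b where "b \<ge> 0" "\<And>f g x y. f \<in> CXK X K \<Longrightarrow> g \<in> CXK X K \<Longrightarrow> x \<in> X \<Longrightarrow> y \<in> X \<Longrightarrow> norm (f x - g y) \<le> b"
proof -
  obtain b where b: "b > 0" "\<And>u. u \<in> K \<Longrightarrow> norm u \<le> b"
    using compact_imp_bounded[OF assms] unfolding bounded_pos by blast
  have "norm (f x - g y) \<le> 2 * b" if "f \<in> CXK X K" "g \<in> CXK X K" "x \<in> X" "y \<in> X" for f g x y
  proof -
    have "norm (f x) \<le> b" "norm (g y) \<le> b" using that b(2) by (auto simp: CXK_def)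
    then show ?thesis using norm_triangle_ineq4[of "f x" "g y"] by linarith
  qed
  then show ?thesis using that[of "2 * b"] b(1) by simp
qed

lemma supdist_le:
  assumes "r \<ge> 0" "\<And>x. x \<in> X \<Longrightarrow> norm (f x - g x) \<le> r"
  shows "supdist X f g \<le> r"
  unfolding supdist_def using assms by (intro cSup_least) auto

lemma
  assumes "compact K" "f \<in> CXK X K" "g \<in> CXK X K"
  shows norm_le_supdist: "x \<in> X \<Longrightarrow> norm (f x - g x) \<le> supdist X f g"
    and supdist_nonneg: "0 \<le> supdist X f g"
proof -
  obtain b where b: "b \<ge> 0" "\<And>f g x y. f \<in> CXK X K \<Longrightarrow> g \<in> CXK X K \<Longrightarrow> x \<in> X \<Longrightarrow> y \<in> X \<Longrightarrow> norm (f x - g y) \<le> b"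
    using CXK_bounded[OF assms(1), of X] by blast
  then have bdd: "bdd_above (insert 0 ((\<lambda>x. norm (f x - g x)) ` X))"
    using assms(2,3) by (intro bdd_aboveI[of _ b]) auto
  show "x \<in> X \<Longrightarrow> norm (f x - g x) \<le> supdist X f g"
    unfolding supdist_def using bdd by (intro cSup_upper) auto
  show "0 \<le> supdist X f g"
    unfolding supdist_def using bdd by (intro cSup_upper) auto
qed

lemma supdist_commute: "supdist X f g = supdist X g f"
  by (simp add: supdist_def norm_minus_commute)

text \<open>\<open>Metric_space\<close> demands nonnegativity for all functions, including those
  outside the carrier, where the supremum may be of an unbounded set. The absolute value secures
  this and changes nothing on the carrier.\<close>

lemma Metric_space_CXK:
  fixes X :: "'a::topological_space set" and K :: "'v::real_normed_vector set"
  assumes "compact K"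
  shows "Metric_space (CXK X K) (\<lambda>f g. \<bar>supdist X f g\<bar>)"
proof
  fix f g :: "'a \<Rightarrow> 'v"
  show "0 \<le> \<bar>supdist X f g\<bar>" by simp
  show "\<bar>supdist X f g\<bar> = \<bar>supdist X g f\<bar>" by (simp add: supdist_commute)
  assume fg: "f \<in> CXK X K" "g \<in> CXK X K"
  show "\<bar>supdist X f g\<bar> = 0 \<longleftrightarrow> f = g"
  proof
    assume z: "\<bar>supdist X f g\<bar> = 0"
    have "f x = g x" for x
    proof (cases "x \<in> X")
      case True
      then show ?thesis using norm_le_supdist[OF assms fg True] z by simp
    next
      case False
      then show ?thesis using fg by (simp add: CXK_def)
    qed
    then show "f = g" by blast
  next
    assume "f = g"
    then show "\<bar>supdist X f g\<bar> = 0"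
      using supdist_le[of 0 X f g] supdist_nonneg[OF assms fg] by simp
  qed
next
  fix f g h :: "'a \<Rightarrow> 'v" assume fgh: "f \<in> CXK X K" "g \<in> CXK X K" "h \<in> CXK X K"
  have "supdist X f h \<le> supdist X f g + supdist X g h"
  proof (rule supdist_le)
    show "0 \<le> supdist X f g + supdist X g h" using supdist_nonneg[OF assms] fgh by (intro add_nonneg_nonneg) blast+
    fix x assume x: "x \<in> X"
    have "norm (f x - h x) \<le> norm (f x - g x) + norm (g x - h x)"
      using norm_triangle_ineq[of "f x - g x" "g x - h x"] by simp
    then show "norm (f x - h x) \<le> supdist X f g + supdist X g h"
      using norm_le_supdist[OF assms fgh(1,2) x] norm_le_supdist[OF assms fgh(2,3) x] by linarith
  qed
  then show "\<bar>supdist X f h\<bar> \<le> \<bar>supdist X f g\<bar> + \<bar>supdist X g h\<bar>"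
    using supdist_nonneg[OF assms fgh(1,3)] by linarith
qed

lemma mcomplete_CXK:
  fixes X :: "'a::metric_space set" and K :: "'v::banach set"
  assumes K: "compact K"
  shows "Metric_space.mcomplete (CXK X K) (\<lambda>f g. \<bar>supdist X f g\<bar>)"
proof -
  interpret Metric_space "CXK X K" "\<lambda>f g. \<bar>supdist X f g\<bar>" by (rule Metric_space_CXK[OF K])
  show ?thesis
    unfolding mcomplete_def
  proof (intro allI impI)
    fix \<sigma> assume C: "MCauchy \<sigma>"
    have \<sigma>: "\<sigma> n \<in> CXK X K" for n using C by (auto simp: MCauchy_def)
    have "uniformly_Cauchy_on X \<sigma>"
      unfolding uniformly_Cauchy_on_def
    proof (intro allI impI)
      fix e :: real assume "e > 0"
      then obtain N where N: "\<And>n n'. N \<le> n \<Longrightarrow> N \<le> n' \<Longrightarrow> \<bar>supdist X (\<sigma> n) (\<sigma> n')\<bar> < e"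
        using C unfolding MCauchy_def by meson
      have "dist (\<sigma> m x) (\<sigma> n x) < e" if "x \<in> X" "m \<ge> N" "n \<ge> N" for x m n
        using norm_le_supdist[OF K \<sigma> \<sigma> that(1), of m n] N[OF that(2,3)] by (simp add: dist_norm)
      then show "\<exists>M. \<forall>x\<in>X. \<forall>m\<ge>M. \<forall>n\<ge>M. dist (\<sigma> m x) (\<sigma> n x) < e" by blast
    qed
    then have "uniformly_convergent_on X \<sigma>" by (rule Cauchy_uniformly_convergent)
    then obtain l where l: "uniform_limit X \<sigma> l sequentially" unfolding uniformly_convergent_on_def by blast
    \<comment> \<open>The uniform limit is determined only on \<open>X\<close>; the normalization to
      0 outside has to be restored.\<close>
    define l' where "l' x = (if x \<in> X then l x else 0)" for x
    have "continuous_on X l"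
      by (rule uniform_limit_theorem[OF _ l]) (use \<sigma> in \<open>auto simp: CXK_def\<close>)
    then have "continuous_on X l'" by (rule continuous_on_eq) (simp add: l'_def)
    moreover have "l x \<in> K" if x: "x \<in> X" for x
    proof (rule closed_sequentially[OF compact_imp_closed[OF K]])
      show "(\<lambda>n. \<sigma> n x) \<longlonglongrightarrow> l x" by (rule tendsto_uniform_limitI[OF l x])
      show "\<sigma> n x \<in> K" for n using \<sigma> x by (auto simp: CXK_def)
    qed
    ultimately have l'C: "l' \<in> CXK X K" by (auto simp: CXK_def l'_def)
    have "limitin mtopology \<sigma> l' sequentially"
      unfolding limit_metric_sequentially
    proof (intro conjI allI impI l'C)
      fix e :: real assume e: "e > 0"
      have "\<forall>\<^sub>F n in sequentially. \<forall>x\<in>X. dist (\<sigma> n x) (l x) < e / 2"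
        using l e unfolding uniform_limit_iff by (meson half_gt_zero)
      then obtain N where N: "\<And>n x. n \<ge> N \<Longrightarrow> x \<in> X \<Longrightarrow> dist (\<sigma> n x) (l x) < e / 2"
        unfolding eventually_sequentially by blast
      have "\<bar>supdist X (\<sigma> n) l'\<bar> < e" if n: "n \<ge> N" for n
      proof -
        have "supdist X (\<sigma> n) l' \<le> e / 2"
          using e N[OF n] by (intro supdist_le) (auto simp: l'_def dist_norm less_imp_le)
        then show ?thesis using supdist_nonneg[OF K \<sigma> l'C, of n] e by simp
      qed
      then show "\<exists>N. \<forall>n\<ge>N. \<sigma> n \<in> CXK X K \<and> \<bar>supdist X (\<sigma> n) l'\<bar> < e" using \<sigma> by blast
    qed
    then show "\<exists>x. limitin mtopology \<sigma> x sequentially" by blast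
  qed
qed

lemma dense_Gdelta_Inter:
  fixes X :: "'a::metric_space set" and K :: "'v::banach set" and U :: "nat \<Rightarrow> ('a \<Rightarrow> 'v) set"
  assumes K: "compact K" and op: "\<And>m. rho_open (CXK X K) (supdist X) (U m)"
    and de: "\<And>m f r. f \<in> CXK X K \<Longrightarrow> r > 0 \<Longrightarrow> \<exists>g\<in>U m. supdist X f g < r"
  shows "dense_Gdelta_in (CXK X K) (supdist X) (\<Inter>m. U m)"
proof -
  interpret Metric_space "CXK X K" "\<lambda>f g. \<bar>supdist X f g\<bar>" by (rule Metric_space_CXK[OF K])
  have sub: "U m \<subseteq> CXK X K" for m using op unfolding rho_open_def by blast
  have ball: "g \<in> mball f r \<longleftrightarrow> f \<in> CXK X K \<and> g \<in> CXK X K \<and> supdist X f g < r" for f g r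
    by (auto simp: in_mball abs_of_nonneg supdist_nonneg[OF K])
  have 1: "openin mtopology (U m)" for m
    unfolding openin_mtopology
  proof (intro conjI allI impI sub)
    fix f assume f: "f \<in> U m"
    then obtain r where r: "r > 0" "\<forall>g\<in>CXK X K. supdist X f g < r \<longrightarrow> g \<in> U m"
      using op unfolding rho_open_def by meson
    have "mball f r \<subseteq> U m" using r(2) ball by blast
    then show "\<exists>r>0. mball f r \<subseteq> U m" using r(1) by blast
  qed
  have 2: "mtopology closure_of (U m) = CXK X K" for m
  proof -
    have "f \<in> mtopology closure_of (U m)" if f: "f \<in> CXK X K" for f
      unfolding metric_closure_of using f de[OF f, of _ m] ball sub by blast
    then show ?thesis using closure_of_subset_topspace[of mtopology "U m"] by auto
  qed
  have "mtopology closure_of (\<Inter>(range U)) = CXK X K"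
    by (rule metric_Baire_category[OF mcomplete_CXK[OF K]]) (use 1 2 in auto)
  then have "\<exists>g\<in>\<Inter>(range U). supdist X f g < r" if "f \<in> CXK X K" "r > 0" for f r
    using that ball unfolding metric_closure_of by blast
  moreover have "(\<Inter>m. U m) \<subseteq> CXK X K" using sub by blast
  ultimately show ?thesis unfolding dense_Gdelta_in_def by (intro conjI exI[of _ U] allI op) auto
qed

text \<open>The same code works for nearby maps: replacing \<open>f\<close> by \<open>g\<close>
  moves each sequence by at most \<sigma> times \<open>r\<close>, twice per pair, and
  \<open>r\<close> is chosen to fit the slack between \<open>c\<close> and \<epsilon>. This is the
  openness half of the Baire argument.\<close>

lemma coded_perturb:
  fixes T :: "int^'k \<Rightarrow> 'a::metric_space \<Rightarrow> 'a" and K :: "'v::banach set"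
  assumes dyn: "dynsys X T" and K: "compact K" and f: "f \<in> CXK X K" and cod: "coded X T f \<Omega> \<epsilon> n"
  shows "\<exists>r>0. \<forall>g\<in>CXK X K. supdist X f g < r \<longrightarrow> coded X T g \<Omega> \<epsilon> n"
proof -
  obtain b where b: "b \<ge> 0" "\<And>f g x y. f \<in> CXK X K \<Longrightarrow> g \<in> CXK X K \<Longrightarrow> x \<in> X \<Longrightarrow> y \<in> X \<Longrightarrow> norm (f x - g y) \<le> b"
    using CXK_bounded[OF K, of X] by blast
  define \<sigma> where "\<sigma> = wsum TYPE(int^'k)"
  have \<sigma>: "\<sigma> \<ge> 0" unfolding \<sigma>_def by (rule wsum_nonneg)
  obtain h c where h: "\<And>x. x \<in> X \<Longrightarrow> h x < n" "c < \<epsilon>"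
    "\<And>x y m. x \<in> X \<Longrightarrow> y \<in> X \<Longrightarrow> h x = h y \<Longrightarrow> m \<in> \<Omega> \<Longrightarrow> Dmetric (I_map T f (T m x)) (I_map T f (T m y)) \<le> c"
    using codedE[OF cod] by metis
  define r where "r = (\<epsilon> - c) / (2 * \<sigma> + 1)"
  have r: "r > 0" using h(2) \<sigma> by (simp add: r_def)
  have "r * (2 * \<sigma> + 1) = \<epsilon> - c" using \<sigma> by (simp add: r_def)
  then have r2: "\<sigma> * r + c + \<sigma> * r < \<epsilon>" using r by (simp add: algebra_simps)
  have "coded X T g \<Omega> \<epsilon> n" if g: "g \<in> CXK X K" "supdist X f g < r" for g
  proof (rule codedI[of X h n "\<sigma> * r + c + \<sigma> * r"])
    fix x y m assume a: "x \<in> X" "y \<in> X" "h x = h y" "m \<in> \<Omega>"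
    have near: "Dmetric (I_map T f u) (I_map T g u) \<le> \<sigma> * r" if u: "u \<in> X" for u
      unfolding \<sigma>_def
    proof (rule Dmetric_le)
      fix n
      show "norm (I_map T f u n - I_map T g u n) \<le> r"
        using norm_le_supdist[OF K f g(1) dynsys_in[OF dyn u, of n]] g(2) by (simp add: I_map_def)
    qed
    have tri: "Dmetric (I_map T f1 u1) (I_map T f3 u3) \<le> Dmetric (I_map T f1 u1) (I_map T f2 u2) + Dmetric (I_map T f2 u2) (I_map T f3 u3)"
      if "f1 \<in> CXK X K" "f2 \<in> CXK X K" "f3 \<in> CXK X K" "u1 \<in> X" "u2 \<in> X" "u3 \<in> X" for f1 f2 f3 u1 u2 u3
      by (rule Dmetric_triangle[of _ _ b]) (use that b(2) dynsys_in[OF dyn] in \<open>auto simp: I_map_def\<close>)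
    have X: "T m x \<in> X" "T m y \<in> X" using dynsys_in[OF dyn] a by auto
    have "Dmetric (I_map T g (T m x)) (I_map T g (T m y)) \<le> Dmetric (I_map T g (T m x)) (I_map T f (T m x)) + Dmetric (I_map T f (T m x)) (I_map T g (T m y))"
      by (rule tri[OF g(1) f g(1) X(1) X(1) X(2)])
    also have "Dmetric (I_map T f (T m x)) (I_map T g (T m y)) \<le> Dmetric (I_map T f (T m x)) (I_map T f (T m y)) + Dmetric (I_map T f (T m y)) (I_map T g (T m y))"
      by (rule tri[OF f f g(1) X(1) X(2) X(2)])
    finally show "Dmetric (I_map T g (T m x)) (I_map T g (T m y)) \<le> \<sigma> * r + c + \<sigma> * r"
      using near[OF X(1)] near[OF X(2)] h(3)[OF a] Dmetric_commute[of "I_map T g (T m x)" "I_map T f (T m x)"] by linarith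
  qed (use h(1) r2 in auto)
  then show ?thesis using r by blast
qed

text \<open>A limit inferior above \<open>D\<close> would keep the ratio above some
  \<open>y > D\<close> at all small scales. For large \<open>m\<close> the supplied scale is small
  enough and its excess 1/(m+1) is below \<open>y - D\<close>, a contradiction.\<close>

lemma mdim_M_le:
  fixes T :: "int^'k \<Rightarrow> 'a::metric_space \<Rightarrow> 'a" and K :: "'v::banach set"
  assumes dyn: "dynsys X T" and ne: "X \<noteq> {}" and K: "compact K" and f: "f \<in> CXK X K"
    and small: "\<And>m::nat. \<exists>\<epsilon> N M. 0 < \<epsilon> \<and> \<epsilon> < 1 / (real m + 1) \<and> N \<ge> 1 \<and> M \<ge> 1 \<and> coded X T f (cube N) \<epsilon> M \<and>
       ln (real M) / real N ^ CARD('k) < (D + 1 / (real m + 1)) * \<bar>ln \<epsilon>\<bar>"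
  shows "mdim_M shift (I_map T f ` X) Dmetric \<le> ereal D"
proof (rule ccontr)
  obtain b where b: "b \<ge> 0" "\<And>f g x y. f \<in> CXK X K \<Longrightarrow> g \<in> CXK X K \<Longrightarrow> x \<in> X \<Longrightarrow> y \<in> X \<Longrightarrow> norm (f x - g y) \<le> b"
    using CXK_bounded[OF K, of X] by blast
  interpret coded_system X T f b by unfold_locales (use dyn b(2) f in auto)
  assume "\<not> mdim_M shift (I_map T f ` X) Dmetric \<le> ereal D"
  then have "ereal D < mdim_M shift (I_map T f ` X) Dmetric" by simp
  then obtain y where y: "ereal D < ereal y" "ereal y < mdim_M shift (I_map T f ` X) Dmetric"
    using ereal_dense2 by blast
  have "\<forall>\<^sub>F \<epsilon> in at_right 0. ereal y < ereal (S_ent shift (I_map T f ` X) \<epsilon> Dmetric / \<bar>ln \<epsilon>\<bar>)"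
    using y(2) unfolding mdim_M_def by (rule less_LiminfD)
  then obtain e where e: "e > 0" "\<And>\<epsilon>. 0 < \<epsilon> \<Longrightarrow> \<epsilon> < e \<Longrightarrow> y < S_ent shift (I_map T f ` X) \<epsilon> Dmetric / \<bar>ln \<epsilon>\<bar>"
    unfolding eventually_at_right_field by auto
  have "min e (y - D) > 0" using e(1) y(1) by simp
  then obtain m where "inverse (real (Suc m)) < min e (y - D)" using reals_Archimedean by blast
  then have m: "1 / (real m + 1) < e" "1 / (real m + 1) < y - D" by (auto simp: inverse_eq_divide add.commute)
  obtain \<epsilon> N M where s: "0 < \<epsilon>" "\<epsilon> < 1 / (real m + 1)" "N \<ge> 1" "coded X T f (cube N) \<epsilon> M"
      "ln (real M) / real N ^ CARD('k) < (D + 1 / (real m + 1)) * \<bar>ln \<epsilon>\<bar>"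
    using small[of m] by blast
  have "1 / (real m + 1) \<le> 1" by simp
  then have "\<epsilon> < 1" using s(2) by linarith
  then have ln: "\<bar>ln \<epsilon>\<bar> > 0" using s(1) by simp
  have "S_ent shift (I_map T f ` X) \<epsilon> Dmetric < (D + 1 / (real m + 1)) * \<bar>ln \<epsilon>\<bar>"
    using S_ent_le[OF ne s(3,4)] s(5) by linarith
  also have "\<dots> < y * \<bar>ln \<epsilon>\<bar>" using ln m(2) by (intro mult_strict_right_mono) auto
  finally have "S_ent shift (I_map T f ` X) \<epsilon> Dmetric / \<bar>ln \<epsilon>\<bar> < y" using ln by (simp add: divide_less_eq)
  then show False using e(2)[OF s(1)] s(2) m(1) by simp
qed

lemma mdim_M_empty: "mdim_M T {} \<rho> = 0"
proof -
  have "cover_num {} \<epsilon> \<rho>' = 0" for \<epsilon> and \<rho>' :: "'b \<Rightarrow> 'b \<Rightarrow> real"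
    unfolding cover_num_def by (intro Least_eq_0 exI[of _ "{}"]) auto
  then have "S_ent T {} \<epsilon> \<rho> = 0" for \<epsilon> by (simp add: S_ent_def)
  then show ?thesis by (simp add: mdim_M_def Liminf_const zero_ereal_def)
qed

theorem theorem6p2:
  fixes X :: "'a::metric_space set" and T :: "int^'k \<Rightarrow> 'a \<Rightarrow> 'a"
    and K :: "'v::banach set"
  assumes "dynsys X T" and "compact K" and "convex K" and "marker_property X T"
  shows "\<exists>G. dense_Gdelta_in (CXK X K) (supdist X) G \<and>
           (\<forall>f\<in>G. mdim_M shift (I_map T f ` X) Dmetric \<le> mdim T X dist)"
\<comment> \<open>In these cases the bound holds for every map, and the whole space serves as the
  set: the right side is infinite, or \<open>X\<close> is empty and the metric mean dimension is
  0.\<close>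
proof (cases "X = {} \<or> mdim T X dist = \<infinity>")
  case True
  have "dense_Gdelta_in (CXK X K) (supdist X) (\<Inter>m::nat. CXK X K)"
  proof (rule dense_Gdelta_Inter[OF assms(2)])
    show "rho_open (CXK X K) (supdist X) (CXK X K)" for m :: nat
      unfolding rho_open_def by (auto intro: exI[of _ 1])
    show "\<exists>g\<in>CXK X K. supdist X f g < r" if "f \<in> CXK X K" "r > 0" for m :: nat and f r
      using that supdist_le[of 0 X f f] by (intro bexI[of _ f]) auto
  qed
  moreover have "mdim_M shift (I_map T f ` X) Dmetric \<le> mdim T X dist" for f :: "'a \<Rightarrow> 'v"
  proof (cases "X = {}")
    case True
    then show ?thesis using mdim_properties(1)[OF assms(1)] by (simp add: mdim_M_empty)
  next
    case False
    then show ?thesis using True by simp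
  qed
  ultimately show ?thesis by blast
next
  case False
  then have ne: "X \<noteq> {}" by blast
  obtain D where D: "mdim T X dist = ereal D"
    using False mdim_properties(1)[OF assms(1)] by (cases "mdim T X dist") auto
  \<comment> \<open>The excess 1/(m+1) over the mean dimension leaves the room needed for density,
    and the bound on the scale forces the witnesses towards 0, so that all conditions together
    control the limit inferior.\<close>
  define P where "P m f \<longleftrightarrow> (\<exists>\<epsilon> N M. 0 < \<epsilon> \<and> \<epsilon> < 1 / (real m + 1) \<and> N \<ge> 1 \<and> M \<ge> 1 \<and> coded X T f (cube N) \<epsilon> M \<and>
       ln (real M) / real N ^ CARD('k) < (D + 1 / (real m + 1)) * \<bar>ln \<epsilon>\<bar>)" for m :: nat and f :: "'a \<Rightarrow> 'v"
  define U where "U m = {f \<in> CXK X K. P m f}" for m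
  have "dense_Gdelta_in (CXK X K) (supdist X) (\<Inter>m. U m)"
  proof (rule dense_Gdelta_Inter[OF assms(2)])
    fix m
    show "rho_open (CXK X K) (supdist X) (U m)"
      unfolding rho_open_def
    proof (intro conjI ballI)
      show "U m \<subseteq> CXK X K" by (auto simp: U_def)
      fix f assume f: "f \<in> U m"
      then obtain \<epsilon> N M where s: "0 < \<epsilon>" "\<epsilon> < 1 / (real m + 1)" "N \<ge> 1" "M \<ge> 1" "coded X T f (cube N) \<epsilon> M"
        "ln (real M) / real N ^ CARD('k) < (D + 1 / (real m + 1)) * \<bar>ln \<epsilon>\<bar>"
        unfolding U_def P_def by blast
      have "f \<in> CXK X K" using f by (simp add: U_def)
      then obtain r where r: "r > 0" "\<forall>g\<in>CXK X K. supdist X f g < r \<longrightarrow> coded X T g (cube N) \<epsilon> M"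
        using coded_perturb[OF assms(1,2) _ s(5)] by blast
      then show "\<exists>r>0. \<forall>g\<in>CXK X K. supdist X f g < r \<longrightarrow> g \<in> U m"
        unfolding U_def P_def using s by blast
    qed
    fix f :: "'a \<Rightarrow> 'v" and r :: real assume f: "f \<in> CXK X K" and r: "r > 0"
    have "\<exists>g\<in>CXK X K. (\<forall>x\<in>X. norm (f x - g x) \<le> r / 2) \<and> P m g"
      unfolding P_def
    proof (rule exists_small_entropy_function[OF assms(1) ne assms(4,2,3) f])
      show "mdim T X dist < ereal (D + 1 / (real m + 1))" unfolding D by simp
    qed (use r in auto)
    then obtain g where g: "g \<in> CXK X K" "\<forall>x\<in>X. norm (f x - g x) \<le> r / 2" "P m g" by blast
    have "supdist X f g \<le> r / 2" using g(2) r by (intro supdist_le) auto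
    then have "supdist X f g < r" using r by simp
    then show "\<exists>g\<in>U m. supdist X f g < r" using g unfolding U_def by blast
  qed
  moreover have "mdim_M shift (I_map T f ` X) Dmetric \<le> mdim T X dist" if "f \<in> (\<Inter>m. U m)" for f
    unfolding D using that by (intro mdim_M_le[OF assms(1) ne assms(2)]) (auto simp: U_def P_def)
  ultimately show ?thesis by blast
qed

end
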